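(* Let $(\mathbb X,w)$ be a weighted Bratteli diagram with $d(\varnothing,\mathbb X_n)<\infty$ for all $n$. Let $(X_n)_{n\ge0}$ be a MERW on $(\mathbb X,w)$, with law $\mu^*$ (started from the root), harmonic function $\varphi^*$ and support $\mathbb X^*=\{x\in\mathbb X:\varphi^*(x)>0\}$. Then $\mu^*$ is a central measure on the saturated sub-Bratteli diagram $\mathbb X^*$ and $(X_n)_{n\ge0}$ is the associated central Markov chain. In particular, for all $x,y\in\mathbb X^*$ and all $t\in\{x\to y\}$ of length $n$, $$\mathbb P(X_1=t_1,\dots,X_{n-1}=t_{n-1}\mid X_0=x,X_n=y)=\frac{w_t}{\sum_{s\in\{x\to y\}}w_s}.$$ Furthermore, there is a bijective relationship between MERWs and the limit points $m^*$, in the space of probability measures on $\mathbb X\sqcup\partial\mathbb X$, of the sequence $(m_n)_{n\ge0}$. Each MERW is characterized by a non-negative harmonic function $\varphi^*$ such that, for all $x\in\mathbb X$, with $m^*$ the corresponding limit point, $$\varphi^*(x)=\int_{\partial\mathbb X}K(x,\zeta)\,m^*(d\zeta).$$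
   Context: A Bratteli diagram (BD) is a graded directed graph $\mathbb X=\bigsqcup_{n\ge0}\mathbb X_n$ such that every edge goes from $\mathbb X_n$ to $\mathbb X_{n+1}$ for some $n$ (written $x\nearrow y$), there is a unique vertex $\varnothing$ (the root) without incoming edge, every vertex has at least one outgoing edge, and each $\mathbb X_n$ is finite or countably infinite. $n_x$ is the index of the level containing $x$. Each edge has a weight $w(x,y)>0$; the weight $w_s$ of a finite path $s$ is the product of the weights of its edges. $\{x\to y\}$ is the set of directed paths from $x$ to $y$; $d(x,y)=\sum_{s\in\{x\to y\}}w_s$ for $x\neq y$, $d(x,x)=1$, and $d(x,\mathbb X_n)=\sum_{y\in\mathbb X_n}d(x,y)$. $\mathcal T$ is the set of infinite paths from $\varnothing$, with the $\sigma$-algebra generated by the cylinders $C_s$ (paths extending the finite path $s$). Non-negative harmonic function (NNHF): $\varphi:\mathbb X\to[0,\infty)$ with $\varphi(\varnothing)=1$ and $\varphi(x)=\sum_{x\nearrow y}w(x,y)\varphi(y)$ for all $x$. MERW (maximal entropy random walk): with $\varphi_n(x)=d(x,\mathbb X_n)/d(\varnothing,\mathbb X_n)$, let $\varphi^*$ be any pointwise limit of a subsequence $\varphi_{n_k}$ ($n_k\to\infty$); it is an NNHF. The associated MERW is the Markov chain on $\{\varphi^*>0\}$ with kernel $p^*(x,y)=w(x,y)\varphi^*(y)/\varphi^*(x)$; its law from the root satisfies $\mu^*(C_s)=w_s\varphi^*(y)$ for every path $s$ from $\varnothing$ to $y$. A BD $\mathbb Y$ is a saturated sub-Bratteli diagram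 (SSBD) of $\mathbb X$ if it is a subgraph of $\mathbb X$ and whenever $y\in\mathbb Y$ and $x\nearrow y$ in $\mathbb X$, one has $x\in\mathbb Y$. A central measure on a weighted BD is a probability measure $\mu$ on its path space whose support is the whole BD and such that $w_s\mu(C_t)=w_t\mu(C_s)$ for all vertices $y$ and $s,t\in\{\varnothing\to y\}$; it is the law of a Markov chain started from the root, called the associated central Markov chain. Martin boundary: $K(x,z)=d(x,z)/d(\varnothing,z)\le C_x:=1/d(\varnothing,x)$ for $x,z\in\mathbb X$. With $(\varepsilon_x)_{x\in\mathbb X}$ a summable family of positive numbers, set $\rho(y,z)=\sum_x\varepsilon_x\frac{|K(x,y)-K(x,z)|+|\delta_{x,y}-\delta_{x,z}|+|\delta_{n_x,n_y}-\delta_{n_x,n_z}|}{C_x+1}$ (Kronecker symbols). $\overline{\mathbb X}$ and $\overline{\mathbb X}_n$ are the completions of $\mathbb X$ and $\mathbb X_n$ for $\rho$, and $\partial\mathbb X=\overline{\mathbb X}\setminus\bigsqcup_n\overline{\mathbb X}_n$. For each $x$, $K(x,\cdot)$ extends continuously to $\partial\mathbb X$; the extension is denoted $K(x,\zeta)$. The space $\mathbb X\sqcup\partial\mathbb X$ carries the metric $\rho$, and limit points of probability measures on it are understood for weak convergence. Finally $m_n$ is the probability measure on $\mathbb X_n$ with $m_n(y)=d(\varnothing,y)/d(\varnothing,\mathbb X_n)$.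
   Formalization: Limits φ* can fail to be harmonic (infinite levels) and distinct limit points m* can give the same integral of K, so the bijection is between MERWs and the limit points with harmonic integral, identified when their integrals agree; it is literal when none coincide. *)

theory Defs
  imports "HOL-Probability.Probability"
begin

record 'a wbd =
  verts :: "'a set"
  lev :: "'a \<Rightarrow> nat"
  edges :: "('a \<times> 'a) set"
  root :: 'a
  wt :: "'a \<Rightarrow> 'a \<Rightarrow> real"

definition level :: "'a wbd \<Rightarrow> nat \<Rightarrow> 'a set" where
  "level G n = {x \<in> verts G. lev G x = n}"

definition weighted_bratteli :: "'a wbd \<Rightarrow> bool" where
  "weighted_bratteli G \<longleftrightarrow>
     root G \<in> verts G \<and> lev G (root G) = 0 \<and>
     edges G \<subseteq> verts G \<times> verts G \<and>
     (\<forall>(x, y) \<in> edges G. lev G y = Suc (lev G x) \<and> wt G x y > 0) \<and>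
     (\<forall>x \<in> verts G. (\<forall>y. (y, x) \<notin> edges G) \<longleftrightarrow> x = root G) \<and>
     (\<forall>x \<in> verts G. \<exists>y. (x, y) \<in> edges G) \<and>
     (\<forall>n. countable (level G n))"

text \<open>A finite path is the nonempty list of its vertices; its length as a path is the length of
  the list minus one. In particular \<open>fin_paths G x x\<close> is \<open>{[x]}\<close>, with weight \<open>1\<close>, so that the
  convention \<open>d(x,x) = 1\<close> holds automatically.\<close>

definition fin_paths :: "'a wbd \<Rightarrow> 'a \<Rightarrow> 'a \<Rightarrow> 'a list set" where
  "fin_paths G x y = {s. s \<noteq> [] \<and> hd s = x \<and> last s = y \<and> set s \<subseteq> verts G \<and>
                         successively (\<lambda>a b. (a, b) \<in> edges G) s}"

definition path_wt :: "'a wbd \<Rightarrow> 'a list \<Rightarrow> real" where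
  "path_wt G s = (\<Prod>i<length s - 1. wt G (s ! i) (s ! Suc i))"

definition dim :: "'a wbd \<Rightarrow> 'a \<Rightarrow> 'a \<Rightarrow> ennreal" where
  "dim G x y = (\<Sum>\<^sub>\<infinity>s\<in>fin_paths G x y. ennreal (path_wt G s))"

definition dim_level :: "'a wbd \<Rightarrow> 'a \<Rightarrow> nat \<Rightarrow> ennreal" where
  "dim_level G x n = (\<Sum>\<^sub>\<infinity>y\<in>level G n. dim G x y)"

definition inf_paths :: "'a wbd \<Rightarrow> (nat \<Rightarrow> 'a) set" where
  "inf_paths G = {t. t 0 = root G \<and> (\<forall>i. (t i, t (Suc i)) \<in> edges G)}"

definition cylinder :: "'a wbd \<Rightarrow> 'a list \<Rightarrow> (nat \<Rightarrow> 'a) set" where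
  "cylinder G s = {t \<in> inf_paths G. \<forall>i<length s. t i = s ! i}"

definition path_space :: "'a wbd \<Rightarrow> (nat \<Rightarrow> 'a) measure" where
  "path_space G = sigma (inf_paths G) {cylinder G s | s y. y \<in> verts G \<and> s \<in> fin_paths G (root G) y}"

definition ssbd :: "'a wbd \<Rightarrow> 'a wbd \<Rightarrow> bool" where
  "ssbd H G \<longleftrightarrow> weighted_bratteli H \<and>
     verts H \<subseteq> verts G \<and> edges H \<subseteq> edges G \<and>
     (\<forall>x \<in> verts H. lev H x = lev G x) \<and> (\<forall>(x, y) \<in> edges H. wt H x y = wt G x y) \<and>
     (\<forall>y \<in> verts H. \<forall>x. (x, y) \<in> edges G \<longrightarrow> x \<in> verts H)"


text \<open>A Markov chain with state space \<open>S\<close>, transition kernel \<open>p\<close> and unspecified initial law. The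
  Markov property is written in product form, to avoid conditioning on null events.\<close>

definition markov_chain :: "'b measure \<Rightarrow> 'a set \<Rightarrow> ('a \<Rightarrow> 'a \<Rightarrow> real) \<Rightarrow> (nat \<Rightarrow> 'b \<Rightarrow> 'a) \<Rightarrow> bool" where
  "markov_chain P S p X \<longleftrightarrow> prob_space P \<and>
     (\<forall>n. X n \<in> P \<rightarrow>\<^sub>M count_space UNIV) \<and>
     (\<forall>n. AE \<omega> in P. X n \<omega> \<in> S) \<and>
     (\<forall>n s y. length s = Suc n \<and> set s \<subseteq> S \<and> y \<in> S \<longrightarrow>
        \<P>(\<omega> in P. (\<forall>i\<le>n. X i \<omega> = s ! i) \<and> X (Suc n) \<omega> = y)
          = \<P>(\<omega> in P. \<forall>i\<le>n. X i \<omega> = s ! i) * p (s ! n) y)"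

text \<open>The law of the trajectory. A chain is only almost surely an infinite path of \<open>G\<close>; \<open>distr\<close> gives
  a set \<open>A\<close> of paths the probability that the trajectory belongs to \<open>A\<close>, and ignores the
  other trajectories.\<close>

definition path_law :: "'a wbd \<Rightarrow> 'b measure \<Rightarrow> (nat \<Rightarrow> 'b \<Rightarrow> 'a) \<Rightarrow> (nat \<Rightarrow> 'a) measure" where
  "path_law G P X = distr P (path_space G) (\<lambda>\<omega> n. X n \<omega>)"

definition central_measure :: "'a wbd \<Rightarrow> (nat \<Rightarrow> 'a) measure \<Rightarrow> bool" where
  "central_measure G \<mu> \<longleftrightarrow> prob_space \<mu> \<and> sets \<mu> = sets (path_space G) \<and>
     (\<forall>y \<in> verts G. measure \<mu> {t \<in> inf_paths G. t (lev G y) = y} > 0) \<and>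
     (\<forall>y \<in> verts G. \<forall>s \<in> fin_paths G (root G) y. \<forall>t \<in> fin_paths G (root G) y.
        path_wt G s * measure \<mu> (cylinder G t) = path_wt G t * measure \<mu> (cylinder G s))"

definition central_chain :: "'a wbd \<Rightarrow> (nat \<Rightarrow> 'a) measure \<Rightarrow> 'b measure \<Rightarrow> (nat \<Rightarrow> 'b \<Rightarrow> 'a) \<Rightarrow> bool" where
  "central_chain G \<mu> P X \<longleftrightarrow> central_measure G \<mu> \<and>
     (\<exists>p. markov_chain P (verts G) p X) \<and> (AE \<omega> in P. X 0 \<omega> = root G) \<and>
     path_law G P X = \<mu>"


definition nnhf :: "'a wbd \<Rightarrow> ('a \<Rightarrow> real) \<Rightarrow> bool" where
  "nnhf G \<phi> \<longleftrightarrow> (\<forall>x \<in> verts G. \<phi> x \<ge> 0) \<and> \<phi> (root G) = 1 \<and>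
     (\<forall>x \<in> verts G. ((\<lambda>y. wt G x y * \<phi> y) has_sum \<phi> x) {y. (x, y) \<in> edges G})"

definition phi_level :: "'a wbd \<Rightarrow> nat \<Rightarrow> 'a \<Rightarrow> real" where
  "phi_level G n x = enn2real (dim_level G x n) / enn2real (dim_level G (root G) n)"

definition phi_limit :: "'a wbd \<Rightarrow> (nat \<Rightarrow> nat) \<Rightarrow> ('a \<Rightarrow> real) \<Rightarrow> bool" where
  "phi_limit G r \<phi> \<longleftrightarrow> strict_mono r \<and> (\<forall>x \<in> verts G. (\<lambda>k. phi_level G (r k) x) \<longlonglongrightarrow> \<phi> x)"

text \<open>If every vertex has finitely many outgoing edges, harmonicity is automatic for a limit of a
  subsequence of \<open>phi_level\<close>. With infinite levels mass may escape along a level, so it has to be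
  required for the kernel below to be Markov.\<close>

definition merw_function :: "'a wbd \<Rightarrow> ('a \<Rightarrow> real) \<Rightarrow> bool" where
  "merw_function G \<phi> \<longleftrightarrow> (\<exists>r. phi_limit G r \<phi>) \<and> nnhf G \<phi>"

definition support_bd :: "'a wbd \<Rightarrow> ('a \<Rightarrow> real) \<Rightarrow> 'a wbd" where
  "support_bd G \<phi> = (let S = {x \<in> verts G. \<phi> x > 0} in
     G\<lparr>verts := S, edges := edges G \<inter> S \<times> S\<rparr>)"

definition merw_kernel :: "'a wbd \<Rightarrow> ('a \<Rightarrow> real) \<Rightarrow> 'a \<Rightarrow> 'a \<Rightarrow> real" where
  "merw_kernel G \<phi> x y = (if (x, y) \<in> edges G then wt G x y * \<phi> y / \<phi> x else 0)"

text \<open>A MERW with harmonic function \<open>\<phi>\<close> and arbitrary initial law.\<close>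

definition merw :: "'a wbd \<Rightarrow> ('a \<Rightarrow> real) \<Rightarrow> 'b measure \<Rightarrow> (nat \<Rightarrow> 'b \<Rightarrow> 'a) \<Rightarrow> bool" where
  "merw G \<phi> P X \<longleftrightarrow> merw_function G \<phi> \<and>
     markov_chain P (verts (support_bd G \<phi>)) (merw_kernel G \<phi>) X"

text \<open>\<open>\<mu>\<close> is the law, started from the root, of the MERW with harmonic function \<open>\<phi>\<close>: under \<open>\<mu>\<close> the
  coordinate process is this MERW (all paths in \<open>inf_paths G\<close> start at the root).\<close>

definition merw_law :: "'a wbd \<Rightarrow> ('a \<Rightarrow> real) \<Rightarrow> (nat \<Rightarrow> 'a) measure \<Rightarrow> bool" where
  "merw_law G \<phi> \<mu> \<longleftrightarrow> sets \<mu> = sets (path_space G) \<and> merw G \<phi> \<mu> (\<lambda>n t. t n)"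

definition merw_laws :: "'a wbd \<Rightarrow> (nat \<Rightarrow> 'a) measure set" where
  "merw_laws G = {\<mu>. \<exists>\<phi>. merw_law G \<phi> \<mu>}"


definition martin_kernel :: "'a wbd \<Rightarrow> 'a \<Rightarrow> 'a \<Rightarrow> real" where
  "martin_kernel G x z = enn2real (dim G x z) / enn2real (dim G (root G) z)"

definition martin_bound :: "'a wbd \<Rightarrow> 'a \<Rightarrow> real" where
  "martin_bound G x = 1 / enn2real (dim G (root G) x)"

definition martin_dist :: "'a wbd \<Rightarrow> ('a \<Rightarrow> real) \<Rightarrow> 'a \<Rightarrow> 'a \<Rightarrow> real" where
  "martin_dist G \<epsilon> y z = (\<Sum>\<^sub>\<infinity>x\<in>verts G. \<epsilon> x *
     (\<bar>martin_kernel G x y - martin_kernel G x z\<bar>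
      + \<bar>of_bool (x = y) - of_bool (x = z)\<bar>
      + \<bar>of_bool (lev G x = lev G y) - of_bool (lev G x = lev G z)\<bar>) / (martin_bound G x + 1))"

text \<open>The completion of the vertex set for \<open>martin_dist\<close> is given by an isometric embedding \<open>\<iota>\<close> into a
  complete metric space: the closure of the image of \<open>verts G\<close> is a completion, the closure of the
  image of a level is the completion of this level, and completions are unique up to isometry.\<close>

definition martin_embedding :: "'a wbd \<Rightarrow> ('a \<Rightarrow> real) \<Rightarrow> ('a \<Rightarrow> 'c::complete_space) \<Rightarrow> bool" where
  "martin_embedding G \<epsilon> \<iota> \<longleftrightarrow>
     (\<forall>y \<in> verts G. \<forall>z \<in> verts G. dist (\<iota> y) (\<iota> z) = martin_dist G \<epsilon> y z)"

definition martin_boundary :: "'a wbd \<Rightarrow> ('a \<Rightarrow> 'c::complete_space) \<Rightarrow> 'c set" where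
  "martin_boundary G \<iota> = closure (\<iota> ` verts G) - (\<Union>n. closure (\<iota> ` level G n))"

text \<open>The space \<open>\<X> \<squnion> \<partial>\<X>\<close> with its Borel sets, the vertex \<open>x\<close> being identified with \<open>\<iota> x\<close>.\<close>

definition martin_points :: "'a wbd \<Rightarrow> ('a \<Rightarrow> 'c::complete_space) \<Rightarrow> 'c set" where
  "martin_points G \<iota> = \<iota> ` verts G \<union> martin_boundary G \<iota>"

definition martin_borel :: "'a wbd \<Rightarrow> ('a \<Rightarrow> 'c::complete_space) \<Rightarrow> 'c measure" where
  "martin_borel G \<iota> = restrict_space borel (martin_points G \<iota>)"

definition martin_kernel_ext :: "'a wbd \<Rightarrow> ('a \<Rightarrow> 'c::complete_space) \<Rightarrow> 'a \<Rightarrow> 'c \<Rightarrow> real" where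
  "martin_kernel_ext G \<iota> x \<zeta> =
     Lim (at \<zeta> within \<iota> ` verts G) (\<lambda>z. martin_kernel G x (the_inv_into (verts G) \<iota> z))"

definition level_measure :: "'a wbd \<Rightarrow> ('a \<Rightarrow> 'c::complete_space) \<Rightarrow> nat \<Rightarrow> 'c measure" where
  "level_measure G \<iota> n =
     distr (point_measure (level G n) (\<lambda>y. dim G (root G) y / dim_level G (root G) n))
           (martin_borel G \<iota>) \<iota>"

definition weak_limit :: "'c::topological_space set \<Rightarrow> (nat \<Rightarrow> 'c measure) \<Rightarrow> 'c measure \<Rightarrow> bool" where
  "weak_limit B M m \<longleftrightarrow> (\<forall>f :: 'c \<Rightarrow> real. continuous_on B f \<and> bounded (f ` B) \<longrightarrow>
     (\<lambda>k. \<integral>z. f z \<partial>M k) \<longlonglongrightarrow> (\<integral>z. f z \<partial>m))"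

text \<open>\<open>m\<close> is the limit of \<open>level_measure G \<iota>\<close> along \<open>r\<close>. As \<open>martin_points G \<iota>\<close> is separable and
  metric, the weak topology is metrizable and limit points are the limits of subsequences.\<close>

definition level_limit ::
  "'a wbd \<Rightarrow> ('a \<Rightarrow> 'c::complete_space) \<Rightarrow> (nat \<Rightarrow> nat) \<Rightarrow> 'c measure \<Rightarrow> bool" where
  "level_limit G \<iota> r m \<longleftrightarrow> strict_mono r \<and> prob_space m \<and> sets m = sets (martin_borel G \<iota>) \<and>
     weak_limit (martin_points G \<iota>) (\<lambda>k. level_measure G \<iota> (r k)) m"

definition limit_points :: "'a wbd \<Rightarrow> ('a \<Rightarrow> 'c::complete_space) \<Rightarrow> 'c measure set" where
  "limit_points G \<iota> = {m. \<exists>r. level_limit G \<iota> r m}"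

definition martin_integral :: "'a wbd \<Rightarrow> ('a \<Rightarrow> 'c::complete_space) \<Rightarrow> 'c measure \<Rightarrow> 'a \<Rightarrow> real" where
  "martin_integral G \<iota> m x = (LINT \<zeta>:martin_boundary G \<iota>|m. martin_kernel_ext G \<iota> x \<zeta>)"

text \<open>Distinct limit points may have the same Martin integral, when one of them charges
  points of the boundary that are not minimal; they then define the same MERW.\<close>

definition same_martin_integral ::
  "'a wbd \<Rightarrow> ('a \<Rightarrow> 'c::complete_space) \<Rightarrow> ('c measure \<times> 'c measure) set" where
  "same_martin_integral G \<iota> =
     {(m, m'). \<forall>x \<in> verts G. martin_integral G \<iota> m x = martin_integral G \<iota> m' x}"

text \<open>The limit points whose Martin integral is harmonic; these are all limit points if every vertex
  has finitely many outgoing edges.\<close>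

definition harmonic_limit_points :: "'a wbd \<Rightarrow> ('a \<Rightarrow> 'c::complete_space) \<Rightarrow> 'c measure set" where
  "harmonic_limit_points G \<iota> = {m \<in> limit_points G \<iota>. nnhf G (martin_integral G \<iota> m)}"

end

theory Submission
  imports Defs "HOL-Complex_Analysis.Great_Picard"
begin

text \<open>Under the law of a MERW started from the root, the Doob transform makes the factors
  \<open>\<phi> y / \<phi> x\<close> telescope along a path, so a cylinder has probability \<open>w\<^sub>s \<phi> (last s)\<close>; centrality and
  the bridge formula follow, because all paths with the same endpoints carry the same factor.
  For the Martin part, \<open>\<phi>\<^sub>n x\<close> is the integral of \<open>K x\<close> with respect to \<open>m\<^sub>n\<close>. The metric makes the
  vertex set totally bounded and \<open>K x\<close> Lipschitz, so the \<open>m\<^sub>n\<close> have limit points on the compact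
  completion; since distinct levels stay at positive distance, no mass remains near any fixed
  level, and the limit lives on the boundary. Hence limits of \<open>\<phi>\<^sub>n\<close> and limit points of \<open>m\<^sub>n\<close>
  correspond along common subsequences. Both the Markov chain and the weak limits are realised
  as random variables on the unit interval, by cutting it into nested subintervals whose lengths
  are the prescribed cylinder probabilities.\<close>

section \<open>Random sequences with prescribed cylinder probabilities\<close>

text \<open>The obstacle is that levels may be infinite. A level need not be closed in the
  completion, and the points added by closing it are neither vertices nor boundary points, so the
  space on which weak convergence is tested can fail to be compact. Compactness is therefore used
  only on the closure of the vertex set and against Lipschitz functions; the limit is then shown to
  avoid the closure of every level, which brings it back into the right space. Subsequences enter
  asymmetrically: a limit point forces \<open>phi_level\<close> to converge along the same
  subsequence, while convergence of \<open>phi_level\<close> gives a limit point only after a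
  further extraction, since limit points with equal Martin integrals cannot be told apart by
  \<open>phi_level\<close>. This is why the bijection starts from classes of limit points. It rests
  on the fact that function and law determine each other: every vertex ends a path of positive
  weight from the root, so cylinder probabilities recover \<phi>. The interval construction needs
  consistent masses. For the chain, consistency is harmonicity; for weak limits, it survives passage
  to the limit because there are finitely many colours per scale.\<close>

primrec left_end :: "(nat list \<Rightarrow> real) \<Rightarrow> nat list \<Rightarrow> real" where
  "left_end a [] = 0"
| "left_end a (i # s) = left_end a s + (\<Sum>j<i. a (rev s @ [j]))"

text \<open>Words are stored in reverse, the newest digit at the head, which is why \<open>a\<close>
  is applied to \<open>rev\<close>. The interval of a word starts at \<open>left_end\<close> and is
  cut from left to right into the intervals of its one-digit extensions; \<open>digits a u n\<close>
  records which interval of each generation contains \<open>u\<close>.\<close>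

primrec digits :: "(nat list \<Rightarrow> real) \<Rightarrow> real \<Rightarrow> nat \<Rightarrow> nat list" where
  "digits a u 0 = []"
| "digits a u (Suc n) =
     (LEAST i. u < left_end a (digits a u n) + (\<Sum>j<Suc i. a (rev (digits a u n) @ [j]))) # digits a u n"

lemma length_digits [simp]: "length (digits a u n) = n"
  by (induction n) auto

text \<open>Consecutive partial sums cut [0, A) into half-open slices. Convergence to
  \<open>A\<close> ensures that some partial sum exceeds \<open>v\<close>, so that
  \<open>LEAST\<close> is attained; a slice of length 0 is never selected.\<close>

lemma Least_partial_sum_iff:
  fixes f :: "nat \<Rightarrow> real"
  assumes nonneg: "\<And>j. 0 \<le> f j" and sums: "f sums A" and v: "0 \<le> v" "v < A"
  shows "(LEAST i. v < sum f {..<Suc i}) = i \<longleftrightarrow> sum f {..<i} \<le> v \<and> v < sum f {..<Suc i}"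
proof
  have "eventually (\<lambda>n. v < sum f {..<n}) sequentially"
    using sums v(2) unfolding sums_def by (rule order_tendstoD)
  then obtain n where "v < sum f {..<Suc n}"
    unfolding eventually_sequentially by (metis le_SucI order_refl)
  then have ex: "v < sum f {..<Suc (LEAST i. v < sum f {..<Suc i})}"
    by (rule LeastI)
  assume L: "(LEAST i. v < sum f {..<Suc i}) = i"
  have "sum f {..<i} \<le> v"
  proof (cases i)
    case (Suc k)
    then show ?thesis using not_less_Least[of k "\<lambda>i. v < sum f {..<Suc i}"] L by auto
  qed (use v in simp)
  with ex L show "sum f {..<i} \<le> v \<and> v < sum f {..<Suc i}" by simp
next
  assume i: "sum f {..<i} \<le> v \<and> v < sum f {..<Suc i}"
  show "(LEAST i. v < sum f {..<Suc i}) = i"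
  proof (rule Least_equality)
    fix k assume k: "v < sum f {..<Suc k}"
    show "i \<le> k"
    proof (rule ccontr)
      assume "\<not> i \<le> k"
      then have "sum f {..<Suc k} \<le> sum f {..<i}"
        by (intro sum_mono2) (auto simp: nonneg)
      with i k show False by simp
    qed
  qed (use i in simp)
qed

context
  fixes a :: "nat list \<Rightarrow> real"
  assumes nonneg: "\<And>s. 0 \<le> a s" and a_Nil: "a [] = 1"
    and sums: "\<And>s. (\<lambda>i. a (s @ [i])) sums a s"
begin

lemma partial_sum_le: "(\<Sum>j<k. a (s @ [j])) \<le> a s"
proof -
  have "(\<Sum>j<k. a (s @ [j])) \<le> (\<Sum>j. a (s @ [j]))"
    by (rule sum_le_suminf) (use sums_summable[OF sums] nonneg in auto)
  then show ?thesis
    by (simp only: sums_unique[OF sums, symmetric])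
qed

text \<open>By induction on the word: once \<open>u\<close> lies in the parent interval, the next
  digit is \<open>i\<close> exactly when the offset of \<open>u\<close> from the left end falls into
  the \<open>i\<close>-th slice.\<close>

lemma digits_eq_iff:
  assumes u: "0 \<le> u" "u < 1"
  shows "digits a u (length s) = s \<longleftrightarrow> left_end a s \<le> u \<and> u < left_end a s + a (rev s)"
proof (induction s)
  case Nil
  then show ?case using u a_Nil by simp
next
  case (Cons i s)
  let ?f = "\<lambda>j. a (rev s @ [j])"
  have le: "sum ?f {..<k} \<le> a (rev s)" for k
    by (rule partial_sum_le)
  have ge: "0 \<le> sum ?f {..<k}" for k
    by (intro sum_nonneg nonneg)
  show ?case
  proof (cases "left_end a s \<le> u \<and> u < left_end a s + a (rev s)")
    case True
    then have "digits a u (length s) = s" using Cons.IH by simp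
    moreover have "(LEAST i. u < left_end a s + sum ?f {..<Suc i}) = (LEAST i. u - left_end a s < sum ?f {..<Suc i})"
      by (rule arg_cong[where f = Least]) (auto simp: fun_eq_iff)
    moreover have "(LEAST i. u - left_end a s < sum ?f {..<Suc i}) = i \<longleftrightarrow>
        sum ?f {..<i} \<le> u - left_end a s \<and> u - left_end a s < sum ?f {..<Suc i}"
      by (rule Least_partial_sum_iff[OF _ sums]) (use True nonneg in auto)
    ultimately show ?thesis by (auto simp: algebra_simps)
  next
    case False
    \<comment> \<open>Child intervals lie inside the parent interval, so a point outside the parent
      is outside every child.\<close>
    moreover have "\<not> (left_end a (i # s) \<le> u \<and> u < left_end a (i # s) + a (rev (i # s)))"
      using False le[of "Suc i"] ge[of i] by auto
    ultimately show ?thesis using Cons.IH by auto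
  qed
qed

text \<open>Under Lebesgue measure on [0, 1), the event that the digits start with \<open>s\<close>
  is the interval of \<open>s\<close>, whose length is \<open>a s\<close>.\<close>

lemma random_digits:
  obtains M :: "real measure" and D :: "nat \<Rightarrow> real \<Rightarrow> nat"
  where "prob_space M" "\<And>n. D n \<in> M \<rightarrow>\<^sub>M count_space UNIV"
    "\<And>s. measure M {u \<in> space M. \<forall>i<length s. D i u = s ! i} = a s"
proof
  define M where "M = restrict_space lborel {0..<1::real}"
  have space: "space M = {0..<1}" by (simp add: M_def space_restrict_space)
  show "prob_space M"
    by (rule prob_spaceI) (simp add: M_def space_restrict_space emeasure_restrict_space)
  \<comment> \<open>Keeps every interval inside [0, 1]; otherwise its trace on
    \<open>space M\<close> could be shorter than \<open>a s\<close>.\<close>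
  have sub: "left_end a s \<ge> 0 \<and> left_end a s + a (rev s) \<le> 1" for s
  proof (induction s)
    case Nil
    then show ?case using a_Nil by simp
  next
    case (Cons i s)
    have "(\<Sum>j<Suc i. a (rev s @ [j])) \<le> a (rev s)"
      by (rule partial_sum_le)
    moreover have "0 \<le> (\<Sum>j<i. a (rev s @ [j]))" by (intro sum_nonneg nonneg)
    ultimately show ?case using Cons by simp
  qed
  have ev: "{u \<in> space M. digits a u n = s} =
      (if length s = n then {left_end a s ..< left_end a s + a (rev s)} else {})" for s n
    apply (cases "length s = n")
    subgoal using digits_eq_iff[of _ s] sub[of s] unfolding space by fastforce
    subgoal by auto
    done
  have meas [measurable]: "(\<lambda>u. digits a u n) \<in> M \<rightarrow>\<^sub>M count_space UNIV" for n
  proof (subst measurable_count_space_eq_countable, safe)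
    fix s
    have "(\<lambda>u. digits a u n) -` {s} \<inter> space M = {u \<in> space M. digits a u n = s}" by auto
    also have "\<dots> \<in> sets M"
      unfolding ev using sub[of s] by (auto simp: M_def sets_restrict_space_iff)
    finally show "(\<lambda>u. digits a u n) -` {s} \<inter> space M \<in> sets M" .
  qed auto
  define D where "D n u = hd (digits a u (Suc n))" for n u
  show "D n \<in> M \<rightarrow>\<^sub>M count_space UNIV" for n
    unfolding D_def by (rule measurable_compose[OF meas]) simp
  have dig: "digits a u n = rev (map (\<lambda>i. D i u) [0..<n])" for u n
    by (induction n) (auto simp: D_def)
  show "measure M {u \<in> space M. \<forall>i<length s. D i u = s ! i} = a s" for s
  proof -
    have "map (\<lambda>i. D i u) [0..<length s] = s \<longleftrightarrow> (\<forall>i<length s. D i u = s ! i)" for u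
      by (subst list_eq_iff_nth_eq) simp
    then have "(\<forall>i<length s. D i u = s ! i) \<longleftrightarrow> digits a u (length s) = rev s" for u
      by (simp only: dig rev_is_rev_conv)
    then have "{u \<in> space M. \<forall>i<length s. D i u = s ! i} =
        {left_end a (rev s) ..< left_end a (rev s) + a s}"
      by (simp only: ev length_rev rev_rev_ident refl if_True)
    moreover have "measure M {left_end a (rev s) ..< left_end a (rev s) + a s} = a s"
      using sub[of "rev s"] nonneg[of s] unfolding M_def
      by (subst measure_restrict_space) auto
    ultimately show ?thesis by simp
  qed
qed

end

section \<open>Weak limits of discrete measures\<close>

lemma measurable_discrete:
  assumes "sets M = Pow (space M)" "f \<in> space M \<rightarrow> space N"
  shows "f \<in> M \<rightarrow>\<^sub>M N"
  using assms by (auto simp: measurable_def)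

lemma integral_finite_range:
  fixes h :: "'b \<Rightarrow> real"
  assumes M: "prob_space M" and T [measurable]: "T \<in> M \<rightarrow>\<^sub>M count_space UNIV"
    and R: "finite R" "AE u in M. T u \<in> R"
  shows "(\<integral>u. h (T u) \<partial>M) = (\<Sum>s\<in>R. h s * measure M {u \<in> space M. T u = s})"
proof -
  interpret prob_space M by fact
  have meas: "{u \<in> space M. T u = s} \<in> sets M" for s by measurable
  have "(\<integral>u. h (T u) \<partial>M) = (\<integral>u. (\<Sum>s\<in>R. h s * indicator {u \<in> space M. T u = s} u) \<partial>M)"
  proof (rule integral_cong_AE)
    show "(\<lambda>u. h (T u)) \<in> borel_measurable M"
      by (rule measurable_compose[OF T]) simp
    show "AE u in M. h (T u) = (\<Sum>s\<in>R. h s * indicator {u \<in> space M. T u = s} u)"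
      using R(2) AE_space
    proof eventually_elim
      case (elim u)
      have "(\<Sum>s\<in>R. h s * indicator {u \<in> space M. T u = s} u) = (\<Sum>s\<in>R. if T u = s then h s else 0)"
        using elim by (intro sum.cong) auto
      then show ?case using elim R(1) by simp
    qed
  qed (use meas in measurable)
  also have "\<dots> = (\<Sum>s\<in>R. h s * measure M {u \<in> space M. T u = s})"
    using meas by (subst Bochner_Integration.integral_sum) (auto simp: emeasure_eq_measure)
  finally show ?thesis .
qed

lemma lipschitz_minus_bound:
  fixes f :: "'c::metric_space \<Rightarrow> real"
  assumes "L-lipschitz_on UNIV f" "dist x y \<le> d"
  shows "\<bar>f x - f y\<bar> \<le> L * d"
  using lipschitz_onD[OF assms(1), of x y] lipschitz_on_nonneg[OF assms(1)]
    mult_left_mono[OF assms(2), of L] by (simp add: dist_real_def)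

lemma integral_diff_bound:
  fixes f g :: "'b \<Rightarrow> real"
  assumes M: "prob_space M" and meas: "f \<in> borel_measurable M" "g \<in> borel_measurable M"
    and bound: "\<And>x. x \<in> space M \<Longrightarrow> \<bar>f x\<bar> \<le> C" "\<And>x. x \<in> space M \<Longrightarrow> \<bar>g x\<bar> \<le> C"
    and close: "AE x in M. \<bar>f x - g x\<bar> \<le> e"
  shows "\<bar>(\<integral>x. f x \<partial>M) - (\<integral>x. g x \<partial>M)\<bar> \<le> e"
proof -
  interpret prob_space M by fact
  have int: "integrable M f" "integrable M g"
    using meas bound by (auto intro!: integrable_const_bound[where B = C])
  have "\<bar>\<integral>x. f x - g x \<partial>M\<bar> \<le> (\<integral>x. \<bar>f x - g x\<bar> \<partial>M)"
    using integral_norm_bound[of M "\<lambda>x. f x - g x"] by simp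
  also have "\<dots> \<le> (\<integral>x. e \<partial>M)"
    using int close by (intro integral_mono_AE) auto
  also have "\<dots> = e" by (simp add: prob_space)
  finally show ?thesis using int by simp
qed

text \<open>Total boundedness is given as a colouring: at scale 1 / (j + 1) finitely many colours
  suffice, and vertices of the same colour are close. A vertex is thus described by its sequence of
  colours. The probabilities of all finite colour words converge along one subsequence, the limits
  are realised as a random colour sequence \<open>D\<close>, and representatives of its prefixes
  form a Cauchy sequence whose limit is \<open>Y\<close>.\<close>

lemma weak_compactness_discrete:
  fixes \<iota> :: "'a \<Rightarrow> 'c::complete_space" and Q :: "nat \<Rightarrow> 'a measure"
  assumes prob: "\<And>k. prob_space (Q k)"
    and sets: "\<And>k. sets (Q k) = Pow (space (Q k))"
    and sub: "\<And>k. space (Q k) \<subseteq> V"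
    and totally_bounded: "\<And>e. e > 0 \<Longrightarrow> \<exists>c N. (\<forall>z\<in>V. c z < (N::nat)) \<and>
      (\<forall>y\<in>V. \<forall>z\<in>V. c y = c z \<longrightarrow> dist (\<iota> y) (\<iota> z) < e)"
  obtains s :: "nat \<Rightarrow> nat" and M :: "real measure" and Y :: "real \<Rightarrow> 'c"
  where "strict_mono s" "prob_space M" "Y \<in> borel_measurable M"
    "\<And>u. Y u \<in> closure (\<iota> ` V)"
    "\<And>(f :: 'c \<Rightarrow> real) L C. L-lipschitz_on UNIV f \<Longrightarrow> (\<And>x. \<bar>f x\<bar> \<le> C) \<Longrightarrow>
       (\<lambda>k. \<integral>z. f (\<iota> z) \<partial>Q (s k)) \<longlonglongrightarrow> (\<integral>u. f (Y u) \<partial>M)"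
proof -
  have "\<exists>c N. (\<forall>z\<in>V. c z < (N::nat)) \<and>
      (\<forall>y\<in>V. \<forall>z\<in>V. c y = c z \<longrightarrow> dist (\<iota> y) (\<iota> z) < 1 / real (Suc j))" for j
    by (rule totally_bounded) simp
  then obtain c N where cN: "\<And>j z. z \<in> V \<Longrightarrow> c j z < (N j :: nat)"
    and c_close: "\<And>j y z. y \<in> V \<Longrightarrow> z \<in> V \<Longrightarrow> c j y = c j z \<Longrightarrow> dist (\<iota> y) (\<iota> z) < 1 / real (Suc j)"
    by metis
  define code where "code j z = map (\<lambda>i. c i z) [0..<j]" for j z
  have code_nth: "code j z ! i = c i z" if "i < j" for i j z
    using that by (simp add: code_def)
  define a where "a k s = measure (Q k) {z \<in> space (Q k). code (length s) z = s}" for k s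
  have a_le: "norm (a k s) \<le> 1" for k s
    using prob_space.prob_le_1[OF prob] by (simp add: a_def)
  \<comment> \<open>Diagonal extraction over the countable set of colour words.\<close>
  obtain r where r: "strict_mono (r :: nat \<Rightarrow> nat)" "\<And>s. \<exists>l. (\<lambda>k. a (r k) s) \<longlonglongrightarrow> l"
    using function_convergent_subsequence[of "UNIV :: nat list set" a 1] a_le by auto
  define b where "b s = lim (\<lambda>k. a (r k) s)" for s
  have b: "(\<lambda>k. a (r k) s) \<longlonglongrightarrow> b s" for s
    using r(2)[of s] by (auto simp: b_def lim_def intro: theI2 LIMSEQ_unique)
  have b_nonneg: "0 \<le> b s" for s
    by (rule LIMSEQ_le_const[OF b]) (auto simp: a_def)
  have a_Nil: "a k [] = 1" for k
    using prob_space.prob_space[OF prob] by (simp add: a_def code_def)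
  have b_Nil: "b [] = 1"
    by (rule LIMSEQ_unique[OF b]) (simp add: a_Nil)
  have a_zero: "a k (s @ [i]) = 0" if "i \<ge> N (length s)" for k s i
  proof -
    have "{z \<in> space (Q k). code (length (s @ [i])) z = s @ [i]} = {}"
      using that cN[of _ "length s"] sub[of k] by (fastforce simp: code_def)
    then show ?thesis by (simp only: a_def measure_empty)
  qed
  have a_sum: "(\<Sum>i<N (length s). a k (s @ [i])) = a k s" for k s
  proof -
    interpret prob_space "Q k" by (rule prob)
    let ?A = "\<lambda>i. {z \<in> space (Q k). code (length (s @ [i])) z = s @ [i]}"
    have "{z \<in> space (Q k). code (length s) z = s} = (\<Union>i<N (length s). ?A i)"
      using cN[of _ "length s"] sub[of k] by (fastforce simp: code_def)
    moreover have "measure (Q k) (\<Union>i<N (length s). ?A i) = (\<Sum>i<N (length s). measure (Q k) (?A i))"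
      by (rule finite_measure_finite_Union) (auto simp: sets disjoint_family_on_def)
    ultimately show ?thesis by (simp only: a_def)
  qed
  have "(\<lambda>k. \<Sum>i<N (length s). a (r k) (s @ [i])) \<longlonglongrightarrow> (\<Sum>i<N (length s). b (s @ [i]))" for s
    by (intro tendsto_sum b)
  \<comment> \<open>Only \<open>N (length s)\<close> colours can follow \<open>s\<close>, so the
    limit goes through a finite sum and no mass is lost.\<close>
  then have b_sum: "(\<Sum>i<N (length s). b (s @ [i])) = b s" for s
    unfolding a_sum using b LIMSEQ_unique by blast
  have b_zero: "b (s @ [i]) = 0" if "i \<ge> N (length s)" for s i
    using b[of "s @ [i]"] a_zero[OF that] by (simp add: LIMSEQ_const_iff)
  have b_sums: "(\<lambda>i. b (s @ [i])) sums b s" for s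
    unfolding b_sum[symmetric, of s] by (rule sums_finite) (auto simp: b_zero not_less)
  obtain M :: "real measure" and D :: "nat \<Rightarrow> real \<Rightarrow> nat" where M: "prob_space M" and D [measurable]: "\<And>n. D n \<in> M \<rightarrow>\<^sub>M count_space UNIV"
    and MD: "\<And>s. measure M {u \<in> space M. \<forall>i<length s. D i u = s ! i} = b s"
    by (rule random_digits[OF b_nonneg b_Nil b_sums]) (rule that)
  interpret M: prob_space M by (rule M)
  define pre where "pre j u = map (\<lambda>i. D i u) [0..<j]" for j u
  have len_pre [simp]: "length (pre j u) = j" for j u by (simp add: pre_def)
  have pre_iff: "pre j u = s \<longleftrightarrow> length s = j \<and> (\<forall>i<length s. D i u = s ! i)" for j u s
    unfolding pre_def by (subst list_eq_iff_nth_eq) auto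
  have pre_meas [measurable]: "pre j \<in> M \<rightarrow>\<^sub>M count_space UNIV" for j
  proof (subst measurable_count_space_eq_countable, safe)
    fix s
    have "pre j -` {s} \<inter> space M = (if length s = j then {u \<in> space M. \<forall>i<length s. D i u = s ! i} else {})"
      by (cases "length s = j") (auto simp: pre_iff)
    moreover have "{u \<in> space M. \<forall>i<length s. D i u = s ! i} \<in> sets M" by measurable
    ultimately show "pre j -` {s} \<inter> space M \<in> sets M" by simp
  qed auto
  have pre_measure: "measure M {u \<in> space M. pre (length s) u = s} = b s" for s
    by (simp add: pre_iff MD)
  obtain v0 where v0: "v0 \<in> V"
    using prob_space.not_empty[OF prob] sub by blast
  \<comment> \<open>Words that are the code of no vertex get the dummy value \<open>v0\<close>; they
    have limit probability 0.\<close>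
  define rep where "rep s = (if \<exists>z\<in>V. code (length s) z = s then SOME z. z \<in> V \<and> code (length s) z = s else v0)" for s
  have rep: "rep s \<in> V" "\<exists>z\<in>V. code (length s) z = s \<Longrightarrow> code (length s) (rep s) = s" for s
    unfolding rep_def using v0 someI_ex[of "\<lambda>z. z \<in> V \<and> code (length s) z = s"] by auto
  have ex_code: "\<exists>z\<in>V. code (length s) z = s" if "b s \<noteq> 0" for s
  proof (rule ccontr)
    assume "\<not> ?thesis"
    then have "{z \<in> space (Q k). code (length s) z = s} = {}" for k
      using sub[of k] by blast
    then have "a k s = 0" for k by (simp only: a_def measure_empty)
    then show False using b[of s] that by (simp add: LIMSEQ_const_iff)
  qed
  \<comment> \<open>Every prefix of the colour sequence has positive limit probability, hence is the
    code of an actual vertex. There are countably many words, so almost every \<open>u\<close> is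
    good.\<close>
  define good where "good u \<longleftrightarrow> (\<forall>s. b s = 0 \<longrightarrow> pre (length s) u \<noteq> s)" for u
  have good_meas [measurable]: "Measurable.pred M good"
    unfolding good_def by measurable
  have good_AE: "AE u in M. good u"
    unfolding good_def AE_all_countable
  proof
    fix s
    show "AE u in M. b s = 0 \<longrightarrow> pre (length s) u \<noteq> s"
    proof (cases "b s = 0")
      case True
      have "AE u in M. \<not> pre (length s) u = s"
        by (subst M.prob_Collect_eq_0[symmetric]) (use pre_measure[of s] True in auto)
      then show ?thesis by simp
    qed simp
  qed
  have code_rep: "code j (rep (pre j u)) = pre j u" if "good u" for j u
    using ex_code[of "pre j u"] rep(2)[of "pre j u"] that unfolding good_def by (metis len_pre)
  have c_rep: "c n (rep (pre j u)) = D n u" if "good u" "n < j" for n j u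
    using arg_cong[OF code_rep[OF that(1), of j], of "\<lambda>l. l ! n"] that(2)
    by (simp add: code_def pre_def)
  \<comment> \<open>Prefixes longer than \<open>n\<close> agree at position \<open>n\<close>, so
    their representatives share colour \<open>n\<close>.\<close>
  have near: "dist (\<iota> (rep (pre j u))) (\<iota> (rep (pre k u))) < 1 / real (Suc n)"
    if "good u" "n < j" "n < k" for n j k u
    using c_rep that rep(1) by (intro c_close) auto
  have Cauchy: "Cauchy (\<lambda>j. \<iota> (rep (pre j u)))" if "good u" for u
  proof (rule metric_CauchyI)
    fix e :: real assume "0 < e"
    then obtain n where n: "1 / real (Suc n) < e"
      using nat_approx_posE by blast
    then show "\<exists>M. \<forall>m\<ge>M. \<forall>n\<ge>M. dist (\<iota> (rep (pre m u))) (\<iota> (rep (pre n u))) < e"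
      using near[OF that, of n] by (intro exI[of _ "Suc n"]) (meson less_trans Suc_le_lessD)
  qed
  define Y where "Y u = (if good u then lim (\<lambda>j. \<iota> (rep (pre j u))) else \<iota> v0)" for u
  have Y_lim: "(\<lambda>j. \<iota> (rep (pre j u))) \<longlonglongrightarrow> Y u" if "good u" for u
    using Cauchy_convergent[OF Cauchy[OF that]] that by (simp add: Y_def convergent_LIMSEQ_iff)
  have Y_near: "dist (Y u) (\<iota> (rep (pre j u))) \<le> 1 / real (Suc n)" if "good u" "n < j" for u n j
  proof (rule tendsto_upperbound[OF tendsto_dist[OF Y_lim[OF that(1)] tendsto_const]])
    show "\<forall>\<^sub>F x in sequentially. dist (\<iota> (rep (pre x u))) (\<iota> (rep (pre j u))) \<le> 1 / real (Suc n)"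
      unfolding eventually_sequentially using near[OF that(1)] that(2)
      by (intro exI[of _ "Suc n"]) (meson less_imp_le Suc_le_lessD)
  qed simp
  have Y_meas [measurable]: "Y \<in> borel_measurable M"
  proof (rule borel_measurable_LIMSEQ_metric)
    show "(\<lambda>u. if good u then \<iota> (rep (pre j u)) else \<iota> v0) \<in> borel_measurable M" for j
    proof (rule measurable_If)
      show "(\<lambda>u. \<iota> (rep (pre j u))) \<in> borel_measurable M"
        by (rule measurable_compose[OF pre_meas]) simp
    qed (use good_meas in \<open>auto simp: pred_def\<close>)
    show "(\<lambda>j. if good u then \<iota> (rep (pre j u)) else \<iota> v0) \<longlonglongrightarrow> Y u" for u
      using Y_lim[of u] by (cases "good u") (auto simp: Y_def)
  qed
  have Y_closure: "Y u \<in> closure (\<iota> ` V)" for u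
  proof (cases "good u")
    case True
    then show ?thesis
      unfolding closure_sequential using Y_lim[OF True] rep(1)
      by (intro exI[of _ "\<lambda>j. \<iota> (rep (pre j u))"]) auto
  next
    case False
    then show ?thesis using v0 by (auto simp: Y_def intro!: closure_subset[THEN subsetD])
  qed
  show thesis
  proof (rule that[OF r(1) M Y_meas Y_closure])
    fix f :: "'c \<Rightarrow> real" and L C
    assume L: "L-lipschitz_on UNIV f" and C: "\<And>x. \<bar>f x\<bar> \<le> C"
    have f_meas [measurable]: "f \<in> borel_measurable borel"
      by (intro borel_measurable_continuous_onI lipschitz_on_continuous_on[OF L])
    have L0: "0 \<le> L" by (rule lipschitz_on_nonneg[OF L])
    show "(\<lambda>k. \<integral>z. f (\<iota> z) \<partial>Q (r k)) \<longlonglongrightarrow> (\<integral>u. f (Y u) \<partial>M)"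
    proof (rule metric_LIMSEQ_I)
      fix e :: real assume e: "0 < e"
      \<comment> \<open>Chosen so that \<open>L * e'\<close> stays below \<open>e / 3\<close>; the
        summand 1 covers the case L = 0.\<close>
      define e' where "e' = e / (3 * (L + 1))"
      have "e' > 0" using e L0 by (simp add: e'_def)
      then obtain n where n: "1 / real (Suc n) < e'"
        using nat_approx_posE by blast
      have "L * (1 / real (Suc n)) \<le> L * e'" using n L0 by (intro mult_left_mono) auto
      also have "\<dots> < (L + 1) * e'" using \<open>e' > 0\<close> by (simp add: algebra_simps)
      also have "\<dots> = e / 3" using L0 by (simp add: e'_def divide_simps)
      finally have small: "L * (1 / real (Suc n)) < e / 3" .
      \<comment> \<open>Words of length \<open>Suc n\<close> are the shortest ones that contain the
        colour at scale \<open>n\<close>. Replacing points by representatives of such words costs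
        less than \<open>e / 3\<close> on each side and leaves a finite sum, where convergence of
        word probabilities applies.\<close>
      define j where "j = Suc n"
      define R where "R = {s. set s \<subseteq> (\<Union>i<j. {..<N i}) \<and> length s = j}"
      have finR: "finite R"
        unfolding R_def by (intro finite_lists_length_eq) auto
      have codeR: "code j z \<in> R" if "z \<in> V" for z
        using cN[OF that] by (auto simp: R_def code_def)
      have preR: "AE u in M. pre j u \<in> R"
        using good_AE by eventually_elim (metis code_rep codeR rep(1))
      have lenR: "length s = j" if "s \<in> R" for s using that by (simp add: R_def)
      have Qk: "\<bar>(\<integral>z. f (\<iota> z) \<partial>Q k) - (\<Sum>s\<in>R. f (\<iota> (rep s)) * a k s)\<bar> < e / 3" for k
      proof -
        have "(\<integral>z. f (\<iota> (rep (code j z))) \<partial>Q k) =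
            (\<Sum>s\<in>R. f (\<iota> (rep s)) * measure (Q k) {z \<in> space (Q k). code j z = s})"
          by (rule integral_finite_range[OF prob _ finR]) (use codeR sub in \<open>auto intro!: measurable_discrete sets\<close>)
        also have "\<dots> = (\<Sum>s\<in>R. f (\<iota> (rep s)) * a k s)"
          by (intro sum.cong) (auto simp: a_def lenR)
        finally have "(\<integral>z. f (\<iota> (rep (code j z))) \<partial>Q k) = (\<Sum>s\<in>R. f (\<iota> (rep s)) * a k s)" .
        moreover have "\<bar>(\<integral>z. f (\<iota> z) \<partial>Q k) - (\<integral>z. f (\<iota> (rep (code j z))) \<partial>Q k)\<bar> \<le> L * (1 / real (Suc n))"
        proof (rule integral_diff_bound[OF prob, where C = C])
          show "AE z in Q k. \<bar>f (\<iota> z) - f (\<iota> (rep (code j z)))\<bar> \<le> L * (1 / real (Suc n))"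
          proof (rule AE_I2)
            fix z assume "z \<in> space (Q k)"
            then have z: "z \<in> V" using sub by blast
            have "length (code j z) = j" by (simp add: code_def)
            then have "code j (rep (code j z)) = code j z"
              using rep(2)[of "code j z"] z by auto
            then have "c n (rep (code j z)) = c n z"
              using code_nth[of n j] by (metis j_def lessI)
            then have "dist (\<iota> z) (\<iota> (rep (code j z))) \<le> 1 / real (Suc n)"
              using c_close[OF z rep(1)] less_imp_le by metis
            then show "\<bar>f (\<iota> z) - f (\<iota> (rep (code j z)))\<bar> \<le> L * (1 / real (Suc n))"
              by (rule lipschitz_minus_bound[OF L])
          qed
        qed (use C in \<open>auto intro!: measurable_discrete sets\<close>)
        ultimately show ?thesis using small by linarith
      qed
      have MY: "\<bar>(\<integral>u. f (Y u) \<partial>M) - (\<Sum>s\<in>R. f (\<iota> (rep s)) * b s)\<bar> < e / 3"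
      proof -
        have "(\<integral>u. f (\<iota> (rep (pre j u))) \<partial>M) =
            (\<Sum>s\<in>R. f (\<iota> (rep s)) * measure M {u \<in> space M. pre j u = s})"
          by (rule integral_finite_range[OF M pre_meas finR preR])
        also have "\<dots> = (\<Sum>s\<in>R. f (\<iota> (rep s)) * b s)"
          by (intro sum.cong) (auto simp: lenR simp flip: pre_measure)
        finally have "(\<integral>u. f (\<iota> (rep (pre j u))) \<partial>M) = (\<Sum>s\<in>R. f (\<iota> (rep s)) * b s)" .
        moreover have "\<bar>(\<integral>u. f (Y u) \<partial>M) - (\<integral>u. f (\<iota> (rep (pre j u))) \<partial>M)\<bar> \<le> L * (1 / real (Suc n))"
        proof (rule integral_diff_bound[OF M, where C = C])
          show "(\<lambda>u. f (\<iota> (rep (pre j u)))) \<in> borel_measurable M"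
            by (rule measurable_compose[OF pre_meas]) simp
          show "AE u in M. \<bar>f (Y u) - f (\<iota> (rep (pre j u)))\<bar> \<le> L * (1 / real (Suc n))"
            using good_AE
            by eventually_elim (rule lipschitz_minus_bound[OF L], rule Y_near, auto simp: j_def)
        qed (use C in auto)
        ultimately show ?thesis using small by linarith
      qed
      have lim_sum: "(\<lambda>k. \<Sum>s\<in>R. f (\<iota> (rep s)) * a (r k) s) \<longlonglongrightarrow> (\<Sum>s\<in>R. f (\<iota> (rep s)) * b s)"
        by (intro tendsto_intros b)
      obtain K where K: "\<And>k. k \<ge> K \<Longrightarrow>
          \<bar>(\<Sum>s\<in>R. f (\<iota> (rep s)) * a (r k) s) - (\<Sum>s\<in>R. f (\<iota> (rep s)) * b s)\<bar> < e / 3"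
        using LIMSEQ_D[OF lim_sum, of "e / 3"] e unfolding real_norm_def by auto
      show "\<exists>no. \<forall>k\<ge>no. dist (\<integral>z. f (\<iota> z) \<partial>Q (r k)) (\<integral>u. f (Y u) \<partial>M) < e"
      proof (intro exI[of _ K] allI impI)
        fix k assume "k \<ge> K"
        from K[OF this] MY Qk[of "r k"] show "dist (\<integral>z. f (\<iota> z) \<partial>Q (r k)) (\<integral>u. f (Y u) \<partial>M) < e"
          unfolding dist_real_def by arith
      qed
    qed
  qed
qed

text \<open>A bounded continuous function on \<open>B\<close> need not extend continuously to the closure of \<open>B\<close>; its
  infimal convolutions with \<open>j * dist\<close> are Lipschitz on the whole space and increase to it on \<open>B\<close>.\<close>

definition lipschitz_regularization :: "real \<Rightarrow> 'c::metric_space set \<Rightarrow> ('c \<Rightarrow> real) \<Rightarrow> nat \<Rightarrow> 'c \<Rightarrow> real" where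
  "lipschitz_regularization C B f j z = min C (INF w\<in>B. f w + real j * dist z w)"

text \<open>Each function f w + j * dist z w is j-Lipschitz in z, and so is the infimum. The
  truncation by \<open>C\<close> is needed away from \<open>B\<close>, where the infimum may be
  large. As \<open>j\<close> grows, far points become too expensive to compete in the infimum and
  near points have almost the value of \<open>f\<close> at z.\<close>

lemma lipschitz_regularization:
  fixes f :: "'c::metric_space \<Rightarrow> real"
  assumes "z0 \<in> B" and bound: "\<forall>w\<in>B. \<bar>f w\<bar> \<le> C" and cont: "continuous_on B f"
  defines "g \<equiv> lipschitz_regularization C B f"
  shows "(real j)-lipschitz_on UNIV (g j)" "\<bar>g j z\<bar> \<le> C"
    "z \<in> B \<Longrightarrow> g j z \<le> f z" "z \<in> B \<Longrightarrow> (\<lambda>j. g j z) \<longlonglongrightarrow> f z"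
proof -
  note C = bound[rule_format]
  have C0: "0 \<le> C" using C[OF assms(1)] by simp
  have lower: "- C \<le> f w + real j * dist z w" if "w \<in> B" for w j z
    using C[OF that] mult_nonneg_nonneg[OF of_nat_0_le_iff[of j] zero_le_dist[of z w]] by linarith
  then have bdd: "bdd_below ((\<lambda>w. f w + real j * dist z w) ` B)" for j z
    by (intro bdd_belowI2) auto
  have ge: "- C \<le> (INF w\<in>B. f w + real j * dist z w)" for j z
    using assms(1) lower by (intro cINF_greatest) auto
  show "\<bar>g j z\<bar> \<le> C"
    using ge[where j = j and z = z] C0 by (auto simp: g_def lipschitz_regularization_def min_def)
  have step: "(INF w\<in>B. f w + real j * dist x w) - real j * dist x y \<le> (INF w\<in>B. f w + real j * dist y w)" for x y
  proof (rule cINF_greatest)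
    fix w assume "w \<in> B"
    then have "(INF w\<in>B. f w + real j * dist x w) \<le> f w + real j * dist x w"
      by (intro cINF_lower bdd)
    also have "\<dots> \<le> f w + real j * dist y w + real j * dist x y"
      using dist_triangle[of x w y] by (simp add: mult_left_mono flip: distrib_left)
    finally show "(INF w\<in>B. f w + real j * dist x w) - real j * dist x y \<le> f w + real j * dist y w" by simp
  qed (use assms(1) in auto)
  have min_close: "\<bar>min C p - min C q\<bar> \<le> d" if "p - d \<le> q" "q - d \<le> p" for p q d :: real
    using that by (auto simp: min_def abs_if)
  show "(real j)-lipschitz_on UNIV (g j)"
  proof (rule lipschitz_onI)
    fix x y :: 'c
    show "dist (g j x) (g j y) \<le> real j * dist x y"
      using min_close[OF step[of x y] step[of y x, folded dist_commute[of x y]]]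
      by (simp add: g_def lipschitz_regularization_def dist_real_def)
  qed simp
  show g_le: "g j z \<le> f z" if "z \<in> B" for j z
    using cINF_lower[OF bdd that, of j z] by (simp add: g_def lipschitz_regularization_def min_def)
  show "(\<lambda>j. g j z) \<longlonglongrightarrow> f z" if z: "z \<in> B"
  proof (rule metric_LIMSEQ_I)
    fix e :: real assume e: "0 < e"
    obtain d where d: "d > 0" "\<And>w. w \<in> B \<Longrightarrow> dist w z < d \<Longrightarrow> dist (f w) (f z) < e / 2"
      using cont z e unfolding continuous_on_iff by (metis half_gt_zero)
    \<comment> \<open>From \<open>J\<close> on, a point at distance at least \<open>d\<close> is
      penalised by 2 * C, which lifts its value to at least C and hence above f z.\<close>
    obtain J :: nat where J: "2 * C / d < real J" using reals_Archimedean2 by blast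
    show "\<exists>no. \<forall>j\<ge>no. dist (g j z) (f z) < e"
    proof (intro exI[of _ J] allI impI)
      fix j assume "j \<ge> J"
      then have j: "2 * C \<le> real j * d"
        using J d(1) by (simp add: divide_simps) (smt (verit, best) mult_right_mono of_nat_mono)
      have "f z - e / 2 \<le> (INF w\<in>B. f w + real j * dist z w)"
      proof (rule cINF_greatest)
        fix w assume w: "w \<in> B"
        show "f z - e / 2 \<le> f w + real j * dist z w"
        proof (cases "dist w z < d")
          case True
          then have "f z - e / 2 \<le> f w"
            using d(2)[OF w True] unfolding dist_real_def by linarith
          then show ?thesis
            using mult_nonneg_nonneg[OF of_nat_0_le_iff[of j] zero_le_dist[of z w]] by linarith
        next
          case False
          then have "2 * C \<le> real j * dist z w"
            using j mult_left_mono[of d "dist z w" "real j"] by (simp add: dist_commute)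
          then show ?thesis using C[OF w] C[OF z] e by linarith
        qed
      qed (use z in auto)
      then have "f z - e / 2 \<le> g j z"
        using C[OF z] e by (simp add: g_def lipschitz_regularization_def)
      then show "dist (g j z) (f z) < e"
        using g_le[OF z, of j] e by (simp add: dist_real_def)
    qed
  qed
qed

lemma weak_limit_if_lipschitz:
  fixes B :: "'c::metric_space set"
  assumes N: "\<And>k. prob_space (N k)" "\<And>k. sets (N k) = sets (restrict_space borel B)"
    and m: "prob_space m" "sets m = sets (restrict_space borel B)"
    and lim: "\<And>(f :: 'c \<Rightarrow> real) L C. L-lipschitz_on UNIV f \<Longrightarrow> (\<And>x. \<bar>f x\<bar> \<le> C) \<Longrightarrow>
       (\<lambda>k. \<integral>z. f z \<partial>N k) \<longlonglongrightarrow> (\<integral>z. f z \<partial>m)"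
  shows "weak_limit B N m"
  unfolding weak_limit_def
proof (intro allI impI, elim conjE)
  fix f :: "'c \<Rightarrow> real"
  assume f: "continuous_on B f" "bounded (f ` B)"
  have space: "space (N k) = B" "space m = B" for k
    using sets_eq_imp_space_eq[OF N(2)] sets_eq_imp_space_eq[OF m(2)] by (simp_all add: space_restrict_space)
  obtain C where C: "\<And>w. w \<in> B \<Longrightarrow> \<bar>f w\<bar> \<le> C"
    using f(2) by (auto simp: bounded_iff)
  obtain z0 where z0: "z0 \<in> B"
    using prob_space.not_empty[OF m(1)] space by blast
  \<comment> \<open>Half of the weak convergence: the regularisations lie below \<open>h\<close>,
    and by dominated convergence one of them has an \<open>m\<close>-integral within
    \<open>e / 2\<close> of that of \<open>h\<close>.\<close>
  have lower: "\<forall>\<^sub>F k in sequentially. (\<integral>z. h z \<partial>m) - e < (\<integral>z. h z \<partial>N k)"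
    if h: "continuous_on B h" "\<forall>w\<in>B. \<bar>h w\<bar> \<le> C" and e: "e > 0" for h :: "'c \<Rightarrow> real" and e
  proof -
    define g where "g = lipschitz_regularization C B h"
    note g = lipschitz_regularization[OF z0 h(2,1), folded g_def]
    have g_borel: "g j \<in> borel_measurable borel" for j
      by (intro borel_measurable_continuous_onI lipschitz_on_continuous_on[OF g(1)])
    have meas: "g j \<in> borel_measurable M" "h \<in> borel_measurable M"
      if "sets M = sets (restrict_space borel B)" for j M
      unfolding measurable_cong_sets[OF that refl]
      using measurable_restrict_space1[OF g_borel] borel_measurable_continuous_on_restrict[OF h(1)] by auto
    have int: "integrable M (g j)" "integrable M h"
      if "prob_space M" "sets M = sets (restrict_space borel B)" "space M = B" for j M
    proof -
      interpret prob_space M by fact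
      show "integrable M (g j)" "integrable M h"
        using meas[OF that(2)] g(2) h(2) that(3) by (auto intro!: integrable_const_bound[where B = C])
    qed
    have "(\<lambda>j. \<integral>z. g j z \<partial>m) \<longlonglongrightarrow> (\<integral>z. h z \<partial>m)"
    proof (rule integral_dominated_convergence[where w = "\<lambda>_. C"])
      show "integrable m (\<lambda>_. C)"
        by (rule finite_measure.integrable_const[OF prob_space.finite_measure[OF m(1)]])
      show "AE x in m. (\<lambda>i. g i x) \<longlonglongrightarrow> h x"
        using g(4) by (intro AE_I2) (simp add: space)
    qed (use meas[OF m(2)] g(2) in auto)
    then have "\<forall>\<^sub>F j in sequentially. (\<integral>z. h z \<partial>m) - e / 2 < (\<integral>z. g j z \<partial>m)"
      using e by (intro order_tendstoD) auto
    then obtain j where j: "(\<integral>z. h z \<partial>m) - e / 2 < (\<integral>z. g j z \<partial>m)"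
      by (auto simp: eventually_sequentially)
    have "\<forall>\<^sub>F k in sequentially. (\<integral>z. g j z \<partial>m) - e / 2 < (\<integral>z. g j z \<partial>N k)"
    proof (rule order_tendstoD)
      show "(\<lambda>k. \<integral>z. g j z \<partial>N k) \<longlonglongrightarrow> (\<integral>z. g j z \<partial>m)"
        by (rule lim[OF g(1)]) (rule g(2))
    qed (use e in simp)
    then show ?thesis
    proof eventually_elim
      case (elim k)
      have "(\<integral>z. g j z \<partial>N k) \<le> (\<integral>z. h z \<partial>N k)"
        using int[OF N(1,2) space(1)] g(3) by (intro integral_mono) (auto simp: space)
      with elim j show ?case by simp
    qed
  qed
  show "(\<lambda>k. \<integral>z. f z \<partial>N k) \<longlonglongrightarrow> (\<integral>z. f z \<partial>m)"
  proof (rule metric_LIMSEQ_I)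
    fix e :: real assume e: "0 < e"
    have "\<forall>\<^sub>F k in sequentially. dist (\<integral>z. f z \<partial>N k) (\<integral>z. f z \<partial>m) < e"
    proof -
      have "\<forall>w\<in>B. \<bar>f w\<bar> \<le> C" "\<forall>w\<in>B. \<bar>- f w\<bar> \<le> C"
        using C by auto
      \<comment> \<open>The bound for the negated function is the missing upper estimate.\<close>
      from lower[OF f(1) this(1) e] lower[OF continuous_on_minus[OF f(1)] this(2) e]
      show ?thesis by eventually_elim (simp add: dist_real_def abs_less_iff)
    qed
    then show "\<exists>no. \<forall>k\<ge>no. dist (\<integral>z. f z \<partial>N k) (\<integral>z. f z \<partial>m) < e"
      by (simp add: eventually_sequentially)
  qed
qed

section \<open>Paths and dimensions\<close>

text \<open>Turns the sums defining \<open>dim\<close> and \<open>dim_level\<close> into integrals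
  for counting measure, for which Tonelli and reindexing are available. Both sides are suprema of
  finite sums.\<close>

lemma infsum_ennreal_eq_nn_integral:
  fixes f :: "'b \<Rightarrow> ennreal"
  assumes A: "countable A"
  shows "(\<Sum>\<^sub>\<infinity>x\<in>A. f x) = (\<integral>\<^sup>+x. f x \<partial>count_space A)"
proof (rule antisym)
  have infsum: "(\<Sum>\<^sub>\<infinity>x\<in>A. f x) = (SUP F\<in>{F. finite F \<and> F \<subseteq> A}. sum f F)"
    by (rule nonneg_infsum_complete) simp
  show "(\<Sum>\<^sub>\<infinity>x\<in>A. f x) \<le> (\<integral>\<^sup>+x. f x \<partial>count_space A)"
    unfolding infsum
  proof (rule SUP_least)
    fix F assume F: "F \<in> {F. finite F \<and> F \<subseteq> A}"
    then have "sum f F = (\<integral>\<^sup>+x. f x * indicator F x \<partial>count_space A)"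
      by (subst nn_integral_count_space'[of F]) (auto intro!: sum.cong)
    also have "\<dots> \<le> (\<integral>\<^sup>+x. f x \<partial>count_space A)"
      by (intro nn_integral_mono) (auto split: split_indicator)
    finally show "sum f F \<le> (\<integral>\<^sup>+x. f x \<partial>count_space A)" .
  qed
  show "(\<integral>\<^sup>+x. f x \<partial>count_space A) \<le> (\<Sum>\<^sub>\<infinity>x\<in>A. f x)"
  proof (cases "finite A")
    case True
    then show ?thesis by (simp add: nn_integral_count_space_finite)
  next
    case False
    have bij: "bij_betw (from_nat_into A) UNIV A"
      using A False by (rule bij_betw_from_nat_into)
    have "(\<integral>\<^sup>+x. f x \<partial>count_space A) = (\<Sum>n. f (from_nat_into A n))"
      by (simp add: nn_integral_bij_count_space[OF bij, symmetric] nn_integral_count_space_nat)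
    also have "\<dots> = (SUP n. \<Sum>i<n. f (from_nat_into A i))"
      by (rule suminf_eq_SUP)
    also have "\<dots> \<le> (\<Sum>\<^sub>\<infinity>x\<in>A. f x)"
      unfolding infsum
    proof (rule SUP_mono)
      fix n
      have "(\<Sum>i<n. f (from_nat_into A i)) = sum f (from_nat_into A ` {..<n})"
        using bij by (subst sum.reindex) (auto simp: bij_betw_def intro: inj_on_subset)
      then show "\<exists>F\<in>{F. finite F \<and> F \<subseteq> A}. (\<Sum>i<n. f (from_nat_into A i)) \<le> sum f F"
        using bij by (intro bexI[of _ "from_nat_into A ` {..<n}"]) (auto simp: bij_betw_def)
    qed
    finally show ?thesis .
  qed
qed

lemma nn_integral_count_space_subset:
  assumes "B \<subseteq> A"
  shows "(\<integral>\<^sup>+x. f x * indicator B x \<partial>count_space A) = (\<integral>\<^sup>+x. f x \<partial>count_space B)"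
proof -
  have "(\<integral>\<^sup>+x. f x * indicator B x \<partial>count_space A) = (\<integral>\<^sup>+x. f x * indicator B x \<partial>count_space B)"
    by (rule nn_integral_count_space_eq) (use assms in auto)
  also have "\<dots> = (\<integral>\<^sup>+x. f x \<partial>count_space B)"
    by (intro nn_integral_cong) simp
  finally show ?thesis .
qed

lemma path_wt_single [simp]: "path_wt G [x] = 1"
  by (simp add: path_wt_def)

lemma path_wt_snoc:
  assumes "s \<noteq> []"
  shows "path_wt G (s @ [z]) = path_wt G s * wt G (last s) z"
proof -
  obtain k where k: "length s = Suc k" using assms by (cases s) auto
  show ?thesis
    unfolding path_wt_def using k
    by (simp add: nth_append last_conv_nth[OF assms])
qed

lemma path_wt_Cons:
  assumes "s \<noteq> []"
  shows "path_wt G (x # s) = wt G x (hd s) * path_wt G s"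
proof -
  obtain k where k: "length s = Suc k" using assms by (cases s) auto
  show ?thesis
    unfolding path_wt_def using k
    by (simp add: prod.lessThan_Suc_shift hd_conv_nth[OF assms] del: prod.lessThan_Suc)
qed

text \<open>Repeating \<open>last s\<close> in front of \<open>t\<close> assigns the weight of the
  connecting edge to the second factor.\<close>

lemma path_wt_append:
  assumes "s \<noteq> []"
  shows "path_wt G (s @ t) = path_wt G s * path_wt G (last s # t)"
proof (induction t rule: rev_induct)
  case (snoc z t)
  have "last (s @ t) = last (last s # t)" using assms by (cases t) auto
  with snoc assms path_wt_snoc[of "s @ t" G z] path_wt_snoc[of "last s # t" G z] show ?case
    by simp
qed simp

lemma fin_paths_snoc_iff:
  assumes "s \<noteq> []"
  shows "s @ [z] \<in> fin_paths G x y \<longleftrightarrow>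
    y = z \<and> z \<in> verts G \<and> s \<in> fin_paths G x (last s) \<and> (last s, z) \<in> edges G"
  using assms by (auto simp: fin_paths_def successively_append_iff)

lemma fin_paths_Cons_iff:
  assumes "s \<noteq> []"
  shows "z # s \<in> fin_paths G x y \<longleftrightarrow>
    x = z \<and> z \<in> verts G \<and> s \<in> fin_paths G (hd s) y \<and> (z, hd s) \<in> edges G"
  using assms by (auto simp: fin_paths_def successively_Cons)

lemma fin_paths_single_iff: "[z] \<in> fin_paths G x y \<longleftrightarrow> x = z \<and> y = z \<and> z \<in> verts G"
  by (auto simp: fin_paths_def)

lemma fin_pathsD:
  assumes "s \<in> fin_paths G x y"
  shows "s \<noteq> []" "hd s = x" "last s = y" "set s \<subseteq> verts G" "x \<in> verts G" "y \<in> verts G"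
  using assms by (auto simp: fin_paths_def dest: last_in_set hd_in_set)

locale bratteli =
  fixes G :: "'a wbd"
  assumes bd: "weighted_bratteli G"
begin

lemma root_verts: "root G \<in> verts G" and lev_root: "lev G (root G) = 0"
  using bd by (auto simp: weighted_bratteli_def)

lemma edge_verts: "(x, y) \<in> edges G \<Longrightarrow> x \<in> verts G" "(x, y) \<in> edges G \<Longrightarrow> y \<in> verts G"
  using bd by (auto simp: weighted_bratteli_def)

lemma edge_lev: "(x, y) \<in> edges G \<Longrightarrow> lev G y = Suc (lev G x)"
  and edge_wt: "(x, y) \<in> edges G \<Longrightarrow> wt G x y > 0"
  using bd by (auto simp: weighted_bratteli_def)

lemma no_edge_to_root: "(x, root G) \<notin> edges G"
  using edge_lev lev_root by fastforce

lemma in_edge: "x \<in> verts G \<Longrightarrow> x \<noteq> root G \<Longrightarrow> \<exists>y. (y, x) \<in> edges G"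
  using bd by (auto simp: weighted_bratteli_def)

lemma out_edge: "x \<in> verts G \<Longrightarrow> \<exists>y. (x, y) \<in> edges G"
  using bd by (auto simp: weighted_bratteli_def)

lemma countable_level: "countable (level G n)"
  using bd by (auto simp: weighted_bratteli_def)

lemma countable_verts: "countable (verts G)"
proof -
  have "verts G = (\<Union>n. level G n)" by (auto simp: level_def)
  then show ?thesis using countable_level by auto
qed

lemma countable_edges: "countable (edges G)"
  by (rule countable_subset[of _ "verts G \<times> verts G"]) (use edge_verts countable_verts in auto)

lemma countable_fin_paths: "countable (fin_paths G x y)"
  by (rule countable_subset[of _ "lists (verts G)"])
    (auto simp: countable_verts fin_paths_def)

lemma path_wt_pos: "s \<in> fin_paths G x y \<Longrightarrow> path_wt G s > 0"
proof (induction s arbitrary: y rule: rev_induct)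
  case (snoc z s)
  then show ?case
    by (cases "s = []") (auto simp: fin_paths_snoc_iff path_wt_snoc edge_wt)
qed (auto simp: fin_paths_def)

lemma fin_paths_lev: "s \<in> fin_paths G x y \<Longrightarrow> lev G y + 1 = lev G x + length s"
proof (induction s arbitrary: y rule: rev_induct)
  case (snoc z s)
  show ?case
  proof (cases "s = []")
    case True
    then show ?thesis using snoc.prems by (simp add: fin_paths_single_iff)
  next
    case False
    with snoc.prems have z: "y = z" "s \<in> fin_paths G x (last s)" "(last s, z) \<in> edges G"
      by (auto simp: fin_paths_snoc_iff)
    from snoc.IH[OF z(2)] edge_lev[OF z(3)] z(1) show ?thesis by simp
  qed
qed (auto simp: fin_paths_def)

lemma fin_paths_length:
  assumes "s \<in> fin_paths G x y"
  shows "length s = Suc (lev G y - lev G x)" "lev G x \<le> lev G y"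
  using fin_paths_lev[OF assms] fin_pathsD(1)[OF assms] by (cases s; simp)+

lemma path_from_root: "x \<in> verts G \<Longrightarrow> \<exists>s. s \<in> fin_paths G (root G) x"
proof (induction "lev G x" arbitrary: x rule: less_induct)
  case less
  show ?case
  proof (cases "x = root G")
    case True
    then show ?thesis using less.prems fin_paths_single_iff by metis
  next
    case False
    then obtain y where y: "(y, x) \<in> edges G" using in_edge less.prems by blast
    then obtain s where s: "s \<in> fin_paths G (root G) y"
      using less.hyps[of y] edge_lev edge_verts by fastforce
    then have "s @ [x] \<in> fin_paths G (root G) x"
      using y fin_pathsD[OF s] edge_verts by (subst fin_paths_snoc_iff) auto
    then show ?thesis by blast
  qed
qed

lemma level_nonempty: "level G n \<noteq> {}"
proof (induction n)
  case 0
  then show ?case using root_verts lev_root by (auto simp: level_def)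
next
  case (Suc n)
  then obtain x where x: "x \<in> verts G" "lev G x = n"
    by (auto simp: level_def)
  with out_edge obtain y where "(x, y) \<in> edges G" by blast
  then have "y \<in> level G (Suc n)" using x edge_lev edge_verts by (auto simp: level_def)
  then show ?case by blast
qed

text \<open>Needed to number the vertices by all natural numbers, so that random digits can be read
  as vertices.\<close>

lemma infinite_verts: "infinite (verts G)"
proof
  assume "finite (verts G)"
  then have "finite (lev G ` verts G)" by simp
  moreover have "n \<in> lev G ` verts G" for n
    using level_nonempty[of n] by (auto simp: level_def)
  then have "lev G ` verts G = UNIV" by auto
  ultimately show False by simp
qed

section \<open>Weighted path counts: concatenation and first-step decomposition\<close>

lemma dim_eq: "dim G x y = (\<integral>\<^sup>+s. ennreal (path_wt G s) \<partial>count_space (fin_paths G x y))"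
  unfolding dim_def by (rule infsum_ennreal_eq_nn_integral[OF countable_fin_paths])

lemma dim_level_eq: "dim_level G x n = (\<integral>\<^sup>+y. dim G x y \<partial>count_space (level G n))"
  unfolding dim_level_def by (rule infsum_ennreal_eq_nn_integral[OF countable_level])

lemma path_wt_le_dim:
  assumes "s \<in> fin_paths G x y"
  shows "ennreal (path_wt G s) \<le> dim G x y"
proof -
  have "ennreal (path_wt G s) = (\<integral>\<^sup>+t. ennreal (path_wt G t) * indicator {s} t \<partial>count_space (fin_paths G x y))"
    using assms by (subst nn_integral_count_space'[of "{s}"]) auto
  also have "\<dots> \<le> dim G x y"
    unfolding dim_eq by (intro nn_integral_mono) (auto split: split_indicator)
  finally show ?thesis .
qed

text \<open>Gluing a path from x to y to one from y to z is injective and multiplies weights;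
  \<open>tl\<close> removes the doubled vertex y. This inequality is the source of the bound on the
  Martin kernel and of all finiteness away from the root.\<close>

lemma dim_mult_le: "dim G x y * dim G y z \<le> dim G x z"
proof -
  let ?A = "fin_paths G x y" and ?B = "fin_paths G y z"
  let ?c = "\<lambda>(s, t). s @ tl t :: 'a list"
  have mem: "?c p \<in> fin_paths G x z" if p: "p \<in> ?A \<times> ?B" for p
  proof -
    obtain s t where st: "p = (s, t)" "s \<in> ?A" "t \<in> ?B" using p by auto
    then obtain h t' where t: "t = h # t'" by (cases t) (auto simp: fin_paths_def)
    show ?thesis
      using st(2,3) t unfolding st(1) fin_paths_def
      by (cases t') (auto simp: successively_append_iff successively_Cons)
  qed
  have wt: "path_wt G (?c p) = path_wt G (fst p) * path_wt G (snd p)" if p: "p \<in> ?A \<times> ?B" for p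
  proof -
    obtain s t where st: "p = (s, t)" "s \<in> ?A" "t \<in> ?B" using p by auto
    then have "last s # tl t = t" using fin_pathsD[OF st(2)] fin_pathsD[OF st(3)] by (cases t) auto
    then show ?thesis using path_wt_append[of s G "tl t"] fin_pathsD(1)[OF st(2)] st(1) by simp
  qed
  have inj: "inj_on ?c (?A \<times> ?B)"
  proof (rule inj_onI)
    fix p q assume p: "p \<in> ?A \<times> ?B" and q: "q \<in> ?A \<times> ?B" and eq: "?c p = ?c q"
    obtain s t s' t' where st: "p = (s, t)" "s \<in> ?A" "t \<in> ?B" "q = (s', t')" "s' \<in> ?A" "t' \<in> ?B"
      using p q by auto
    \<comment> \<open>The length of a path is fixed by the levels of its ends, so the place where
      the glued path is to be cut is known.\<close>
    have "length s = length s'" using fin_paths_length(1) st by metis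
    then have "s = s'" "tl t = tl t'" using eq st by auto
    moreover have "t = y # tl t" "t' = y # tl t'"
      using fin_pathsD[OF st(3)] fin_pathsD[OF st(6)] by (cases t; cases t'; simp)+
    ultimately show "p = q" using st by metis
  qed
  have "dim G x y * dim G y z =
      (\<integral>\<^sup>+s. \<integral>\<^sup>+t. ennreal (path_wt G s) * ennreal (path_wt G t) \<partial>count_space ?B \<partial>count_space ?A)"
    by (simp add: dim_eq nn_integral_cmult nn_integral_multc)
  also have "\<dots> = (\<integral>\<^sup>+p. ennreal (path_wt G (fst p)) * ennreal (path_wt G (snd p)) \<partial>count_space (?A \<times> ?B))"
    using sigma_finite_measure.nn_integral_fst[OF sigma_finite_measure_count_space_countable[OF countable_fin_paths[of y z]],
        of "\<lambda>p. ennreal (path_wt G (fst p)) * ennreal (path_wt G (snd p))" "count_space ?A"]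
    by (simp add: pair_measure_countable[OF countable_fin_paths countable_fin_paths])
  also have "\<dots> = (\<integral>\<^sup>+p. ennreal (path_wt G (?c p)) \<partial>count_space (?A \<times> ?B))"
  proof (rule nn_integral_cong)
    fix p assume "p \<in> space (count_space (?A \<times> ?B))"
    then have p: "p \<in> ?A \<times> ?B" by simp
    then have "path_wt G (fst p) \<ge> 0"
      using path_wt_pos[of "fst p" x y] by (auto simp: mem_Times_iff)
    then show "ennreal (path_wt G (fst p)) * ennreal (path_wt G (snd p)) = ennreal (path_wt G (?c p))"
      unfolding wt[OF p] by (rule ennreal_mult'[symmetric])
  qed
  also have "\<dots> = (\<integral>\<^sup>+s. ennreal (path_wt G s) \<partial>count_space (?c ` (?A \<times> ?B)))"
    by (rule nn_integral_bij_count_space[OF inj_on_imp_bij_betw[OF inj]])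
  also have "\<dots> = (\<integral>\<^sup>+s. ennreal (path_wt G s) * indicator (?c ` (?A \<times> ?B)) s \<partial>count_space (fin_paths G x z))"
    by (rule nn_integral_count_space_subset[symmetric]) (use mem in blast)
  also have "\<dots> \<le> dim G x z"
    unfolding dim_eq by (intro nn_integral_mono) (auto split: split_indicator)
  finally show ?thesis .
qed

lemma dim_level_mult_le: "dim G x y * dim_level G y n \<le> dim_level G x n"
  unfolding dim_level_eq
  by (subst nn_integral_cmult[symmetric]) (auto intro!: nn_integral_mono dim_mult_le)

text \<open>Paths are sorted by their second vertex, which exists because z differs from x.\<close>

lemma dim_first_step:
  assumes fin: "finite {y. (x, y) \<in> edges G}" and "z \<noteq> x" "x \<in> verts G"
  shows "dim G x z = (\<Sum>y | (x, y) \<in> edges G. ennreal (wt G x y) * dim G y z)"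
proof -
  let ?E = "{y. (x, y) \<in> edges G}"
  have split: "ennreal (path_wt G s) = (\<Sum>y\<in>?E. ennreal (path_wt G s) * indicator (Cons x ` fin_paths G y z) s)"
    if s: "s \<in> fin_paths G x z" for s
  proof -
    obtain t where t: "s = x # t" using fin_pathsD[OF s] by (cases s) auto
    with s assms have "t \<noteq> []" by (auto simp: fin_paths_single_iff)
    with s t have t': "t \<in> fin_paths G (hd t) z" "(x, hd t) \<in> edges G"
      by (auto simp: fin_paths_Cons_iff)
    have "(\<Sum>y\<in>?E. ennreal (path_wt G s) * indicator (Cons x ` fin_paths G y z) s) =
        (\<Sum>y\<in>?E. if hd t = y then ennreal (path_wt G s) else 0)"
      using t t' by (intro sum.cong) (auto split: split_indicator dest: fin_pathsD(2))
    then show ?thesis using t' fin by simp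
  qed
  have "dim G x z = (\<integral>\<^sup>+s. (\<Sum>y\<in>?E. ennreal (path_wt G s) * indicator (Cons x ` fin_paths G y z) s) \<partial>count_space (fin_paths G x z))"
    unfolding dim_eq using split by (intro nn_integral_cong) simp
  also have "\<dots> = (\<Sum>y\<in>?E. \<integral>\<^sup>+s. ennreal (path_wt G s) * indicator (Cons x ` fin_paths G y z) s \<partial>count_space (fin_paths G x z))"
    by (rule nn_integral_sum) simp
  also have "\<dots> = (\<Sum>y\<in>?E. ennreal (wt G x y) * dim G y z)"
  proof (rule sum.cong[OF refl])
    fix y assume "y \<in> ?E"
    then have y: "(x, y) \<in> edges G" by simp
    have sub: "Cons x ` fin_paths G y z \<subseteq> fin_paths G x z"
      using y assms by (auto simp: fin_paths_Cons_iff fin_pathsD dest: fin_pathsD)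
    have "(\<integral>\<^sup>+s. ennreal (path_wt G s) * indicator (Cons x ` fin_paths G y z) s \<partial>count_space (fin_paths G x z)) =
        (\<integral>\<^sup>+s. ennreal (path_wt G s) \<partial>count_space (Cons x ` fin_paths G y z))"
      by (rule nn_integral_count_space_subset[OF sub])
    also have "\<dots> = (\<integral>\<^sup>+s. ennreal (path_wt G (x # s)) \<partial>count_space (fin_paths G y z))"
      by (rule nn_integral_bij_count_space[symmetric]) (auto simp: bij_betw_def inj_on_def)
    also have "\<dots> = (\<integral>\<^sup>+s. ennreal (wt G x y) * ennreal (path_wt G s) \<partial>count_space (fin_paths G y z))"
    proof (rule nn_integral_cong)
      fix s assume "s \<in> space (count_space (fin_paths G y z))"
      then have "s \<noteq> []" "hd s = y" using fin_pathsD[of s G y z] by auto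
      then show "ennreal (path_wt G (x # s)) = ennreal (wt G x y) * ennreal (path_wt G s)"
        using edge_wt[OF y] by (simp add: path_wt_Cons ennreal_mult')
    qed
    also have "\<dots> = ennreal (wt G x y) * dim G y z"
      by (simp add: dim_eq nn_integral_cmult)
    finally show "(\<integral>\<^sup>+s. ennreal (path_wt G s) * indicator (Cons x ` fin_paths G y z) s \<partial>count_space (fin_paths G x z)) =
      ennreal (wt G x y) * dim G y z" .
  qed
  finally show ?thesis .
qed

lemma dim_level_first_step:
  assumes fin: "finite {y. (x, y) \<in> edges G}" and x: "x \<in> verts G" "lev G x < n"
  shows "dim_level G x n = (\<Sum>y | (x, y) \<in> edges G. ennreal (wt G x y) * dim_level G y n)"
proof -
  have "dim_level G x n = (\<integral>\<^sup>+z. (\<Sum>y | (x, y) \<in> edges G. ennreal (wt G x y) * dim G y z) \<partial>count_space (level G n))"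
    unfolding dim_level_eq by (intro nn_integral_cong dim_first_step fin) (use x in \<open>auto simp: level_def\<close>)
  also have "\<dots> = (\<Sum>y | (x, y) \<in> edges G. ennreal (wt G x y) * dim_level G y n)"
    unfolding dim_level_eq by (subst nn_integral_sum) (simp_all add: nn_integral_cmult)
  finally show ?thesis .
qed

end

section \<open>Consequences of finite total weight on each level\<close>

locale finite_bratteli = bratteli +
  assumes fin: "dim_level G (root G) n < \<infinity>"
begin

lemma dim_root_le: "x \<in> verts G \<Longrightarrow> dim G (root G) x \<le> dim_level G (root G) (lev G x)"
proof -
  assume x: "x \<in> verts G"
  have "dim G (root G) x = (\<integral>\<^sup>+y. dim G (root G) y * indicator {x} y \<partial>count_space (level G (lev G x)))"
    using x by (subst nn_integral_count_space'[of "{x}"]) (auto simp: level_def)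
  also have "\<dots> \<le> dim_level G (root G) (lev G x)"
    unfolding dim_level_eq by (intro nn_integral_mono) (auto split: split_indicator)
  finally show ?thesis .
qed

lemma dim_root_finite: "x \<in> verts G \<Longrightarrow> dim G (root G) x < \<infinity>"
  using dim_root_le fin le_less_trans by blast

lemma dim_root_pos: "x \<in> verts G \<Longrightarrow> 0 < dim G (root G) x"
  using path_from_root[of x] path_wt_pos path_wt_le_dim
  by (metis ennreal_less_zero_iff less_le_trans)

lemma dim_level_root_pos: "0 < dim_level G (root G) n"
proof -
  obtain x where "x \<in> verts G" "lev G x = n" using level_nonempty[of n] by (auto simp: level_def)
  then show ?thesis using dim_root_le dim_root_pos less_le_trans by blast
qed

text \<open>The root reaches \<open>x\<close> with positive weight, so an infinite value at
  \<open>x\<close> would propagate to the root by \<open>dim_mult_le\<close>.\<close>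

lemma dim_finite:
  assumes "x \<in> verts G" "z \<in> verts G"
  shows "dim G x z < \<infinity>"
proof (rule ccontr)
  assume "\<not> ?thesis"
  then have "dim G x z = \<infinity>" by (metis top.not_eq_extremum infinity_ennreal_def)
  then have "dim G (root G) x * dim G x z = \<infinity>"
    using dim_root_pos[OF assms(1)] by (simp add: ennreal_mult_top)
  then show False using dim_mult_le[of "root G" x z] dim_root_finite[OF assms(2)] by simp
qed

lemma dim_level_finite:
  assumes "x \<in> verts G"
  shows "dim_level G x n < \<infinity>"
proof (rule ccontr)
  assume "\<not> ?thesis"
  then have "dim_level G x n = \<infinity>" by (metis top.not_eq_extremum infinity_ennreal_def)
  then have "dim G (root G) x * dim_level G x n = \<infinity>"
    using dim_root_pos[OF assms] by (simp add: ennreal_mult_top)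
  then show False using dim_level_mult_le[of "root G" x n] fin[of n] by simp
qed

lemma enn2real_dim_root_pos: "x \<in> verts G \<Longrightarrow> 0 < enn2real (dim G (root G) x)"
  using dim_root_pos dim_root_finite by (simp add: enn2real_positive_iff)

lemma enn2real_dim_level_root_pos: "0 < enn2real (dim_level G (root G) n)"
  using dim_level_root_pos fin by (simp add: enn2real_positive_iff)

lemma martin_kernel_nonneg: "0 \<le> martin_kernel G x z"
  by (simp add: martin_kernel_def)

lemma martin_bound_pos: "x \<in> verts G \<Longrightarrow> 0 < martin_bound G x"
  using enn2real_dim_root_pos by (simp add: martin_bound_def)

text \<open>This is \<open>dim_mult_le\<close> started at the root, divided by the two root
  dimensions.\<close>

lemma martin_kernel_le:
  assumes "x \<in> verts G" "z \<in> verts G"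
  shows "martin_kernel G x z \<le> martin_bound G x"
proof -
  have "enn2real (dim G (root G) x) * enn2real (dim G x z) \<le> enn2real (dim G (root G) z)"
    unfolding enn2real_mult[symmetric] using dim_mult_le dim_root_finite[OF assms(2)]
    by (intro enn2real_mono) auto
  then show ?thesis
    using enn2real_dim_root_pos assms unfolding martin_kernel_def martin_bound_def
    by (simp add: divide_simps mult.commute)
qed

text \<open>The denominator of the bridge formula is a real \<open>infsum\<close>, which is
  meaningful only for summable weights; summability comes from finiteness of
  \<open>dim\<close>.\<close>

lemma infsum_path_wt:
  assumes "x \<in> verts G" "y \<in> verts G"
  shows "(\<Sum>\<^sub>\<infinity>s\<in>fin_paths G x y. path_wt G s) = enn2real (dim G x y)"
proof -
  have nonneg: "0 \<le> path_wt G s" if "s \<in> fin_paths G x y" for s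
    using path_wt_pos[OF that] by simp
  have "path_wt G summable_on fin_paths G x y"
  proof (rule nonneg_bounded_partial_sums_imp_summable_on)
    show "\<forall>\<^sub>F F in finite_subsets_at_top (fin_paths G x y). sum (path_wt G) F \<le> enn2real (dim G x y)"
    proof (rule eventually_finite_subsets_at_top_weakI)
      fix F assume F: "finite F" "F \<subseteq> fin_paths G x y"
      have "ennreal (sum (path_wt G) F) = (\<Sum>s\<in>F. ennreal (path_wt G s))"
        using F nonneg by (intro sum_ennreal[symmetric]) auto
      also have "\<dots> \<le> dim G x y"
        unfolding dim_def
        by (subst nonneg_infsum_complete) (use F in \<open>auto intro: SUP_upper\<close>)
      finally show "sum (path_wt G) F \<le> enn2real (dim G x y)"
        using dim_finite[OF assms] F nonneg
        by (metis enn2real_ennreal enn2real_mono infinity_ennreal_def subset_eq sum_nonneg)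
    qed
  qed (use nonneg in auto)
  then have "ennreal (\<Sum>\<^sub>\<infinity>s\<in>fin_paths G x y. path_wt G s) = dim G x y"
    unfolding dim_def
    by (subst infsum_nonneg_is_SUPREMUM_ennreal)
      (use nonneg in \<open>auto simp: nonneg_infsum_complete sum_ennreal subset_eq intro!: SUP_cong\<close>)
  then show ?thesis
    by (metis enn2real_ennreal infsum_nonneg nonneg)
qed

lemma phi_level_nonneg: "0 \<le> phi_level G n x"
  by (simp add: phi_level_def)

lemma phi_level_root: "phi_level G n (root G) = 1"
  using enn2real_dim_level_root_pos[of n] by (simp add: phi_level_def)

lemma phi_level_first_step:
  assumes fin_out: "finite {y. (x, y) \<in> edges G}" and x: "x \<in> verts G" "lev G x < n"
  shows "phi_level G n x = (\<Sum>y | (x, y) \<in> edges G. wt G x y * phi_level G n y)"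
proof -
  have "enn2real (dim_level G x n) = (\<Sum>y | (x, y) \<in> edges G. wt G x y * enn2real (dim_level G y n))"
    unfolding dim_level_first_step[OF assms] using dim_level_finite edge_verts edge_wt
    by (subst enn2real_sum) (auto simp: enn2real_mult less_imp_le ennreal_mult_less_top intro!: sum.cong)
  then show ?thesis
    by (simp add: phi_level_def sum_divide_distrib)
qed

text \<open>The one-step recursion for \<open>phi_level\<close> is a finite sum, so it passes to the
  limit without loss of mass.\<close>

lemma phi_limit_nnhf:
  assumes fin_out: "\<forall>x\<in>verts G. finite {y. (x, y) \<in> edges G}" and lim: "phi_limit G r \<phi>"
  shows "nnhf G \<phi>"
proof -
  have r: "strict_mono r" and \<phi>: "\<And>x. x \<in> verts G \<Longrightarrow> (\<lambda>k. phi_level G (r k) x) \<longlonglongrightarrow> \<phi> x"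
    using lim by (auto simp: phi_limit_def)
  have "\<phi> (root G) = 1"
    using LIMSEQ_unique[OF \<phi>[OF root_verts]] by (simp add: phi_level_root)
  moreover have "0 \<le> \<phi> x" if "x \<in> verts G" for x
    by (rule LIMSEQ_le_const[OF \<phi>[OF that]]) (simp add: phi_level_nonneg)
  moreover have "((\<lambda>y. wt G x y * \<phi> y) has_sum \<phi> x) {y. (x, y) \<in> edges G}" if x: "x \<in> verts G" for x
  proof -
    have "(\<lambda>k. \<Sum>y | (x, y) \<in> edges G. wt G x y * phi_level G (r k) y) \<longlonglongrightarrow>
        (\<Sum>y | (x, y) \<in> edges G. wt G x y * \<phi> y)"
      by (intro tendsto_intros \<phi>) (auto dest: edge_verts)
    moreover have "\<forall>\<^sub>F k in sequentially. (\<Sum>y | (x, y) \<in> edges G. wt G x y * phi_level G (r k) y) = phi_level G (r k) x"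
      using eventually_gt_at_top[of "lev G x"]
    proof eventually_elim
      case (elim k)
      \<comment> \<open>The recursion at \<open>x\<close> is available only for target levels
        strictly beyond that of \<open>x\<close>; a strictly increasing \<open>r\<close> satisfies r
        k \<ge> k.\<close>
      then have "lev G x < r k" using seq_suble[OF r, of k] by simp
      then show ?case using phi_level_first_step[of x "r k"] fin_out x by simp
    qed
    ultimately have "(\<lambda>k. phi_level G (r k) x) \<longlonglongrightarrow> (\<Sum>y | (x, y) \<in> edges G. wt G x y * \<phi> y)"
      by (rule Lim_transform_eventually)
    with \<phi>[OF x] have "\<phi> x = (\<Sum>y | (x, y) \<in> edges G. wt G x y * \<phi> y)"
      by (rule LIMSEQ_unique)
    then show ?thesis using fin_out x has_sum_finite by metis
  qed
  ultimately show ?thesis by (simp add: nnhf_def)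
qed

end

section \<open>Path space and the support of a harmonic function\<close>

context bratteli
begin

lemma cylinder_subset: "cylinder G s \<subseteq> inf_paths G"
  by (auto simp: cylinder_def)

lemma space_path_space [simp]: "space (path_space G) = inf_paths G"
  and sets_path_space: "sets (path_space G) =
    sigma_sets (inf_paths G) {cylinder G s | s y. y \<in> verts G \<and> s \<in> fin_paths G (root G) y}"
proof -
  have "{cylinder G s | s y. y \<in> verts G \<and> s \<in> fin_paths G (root G) y} \<subseteq> Pow (inf_paths G)"
    by (auto simp: cylinder_def)
  then show "space (path_space G) = inf_paths G" "sets (path_space G) =
    sigma_sets (inf_paths G) {cylinder G s | s y. y \<in> verts G \<and> s \<in> fin_paths G (root G) y}"
    unfolding path_space_def by (rule space_measure_of, rule sets_measure_of)
qed

lemma cylinder_sets: "s \<in> fin_paths G (root G) y \<Longrightarrow> cylinder G s \<in> sets (path_space G)"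
  unfolding sets_path_space by (rule sigma_sets.Basic) (use fin_pathsD(6)[of s G] in blast)

lemma inf_paths_edge: "t \<in> inf_paths G \<Longrightarrow> (t i, t (Suc i)) \<in> edges G"
  by (simp add: inf_paths_def)

lemma inf_paths_verts: "t \<in> inf_paths G \<Longrightarrow> t i \<in> verts G"
  using inf_paths_edge edge_verts by blast

lemma segment_fin_path:
  assumes "\<And>i. i < n \<Longrightarrow> (t i, t (Suc i)) \<in> edges G" "t 0 \<in> verts G"
  shows "map t [0..<Suc n] \<in> fin_paths G (t 0) (t n)"
  using assms
proof (induction n)
  case 0
  then show ?case by (simp add: fin_paths_single_iff)
next
  case (Suc n)
  then have "map t [0..<Suc n] \<in> fin_paths G (t 0) (t n)" "(t n, t (Suc n)) \<in> edges G" by auto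
  moreover have "t (Suc n) \<in> verts G" using edge_verts calculation by blast
  ultimately have "map t [0..<Suc n] @ [t (Suc n)] \<in> fin_paths G (t 0) (t (Suc n))"
    by (subst fin_paths_snoc_iff) auto
  then show ?case by simp
qed

text \<open>A condition on the n-th coordinate is a countable union of cylinders over paths with
  \<open>Suc n\<close> vertices.\<close>

lemma coordinate_measurable [measurable]: "(\<lambda>t. t n) \<in> path_space G \<rightarrow>\<^sub>M count_space UNIV"
proof (rule measurableI)
  fix A :: "'a set"
  let ?I = "{s. \<exists>y\<in>verts G \<inter> A. s \<in> fin_paths G (root G) y \<and> length s = Suc n}"
  have "countable (\<Union>y\<in>verts G. fin_paths G (root G) y)"
    using countable_verts countable_fin_paths by auto
  then have I: "countable ?I" by (rule countable_subset[rotated]) auto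
  have "(\<lambda>t. t n) -` A \<inter> space (path_space G) = (\<Union>s\<in>?I. cylinder G s)"
  proof (intro equalityI subsetI)
    fix t assume "t \<in> (\<lambda>t. t n) -` A \<inter> space (path_space G)"
    then have t: "t n \<in> A" "t \<in> inf_paths G" by auto
    then have "t 0 = root G" by (simp add: inf_paths_def)
    have "map t [0..<Suc n] \<in> fin_paths G (t 0) (t n)"
      using t inf_paths_edge inf_paths_verts by (intro segment_fin_path) auto
    moreover have "t \<in> cylinder G (map t [0..<Suc n])"
      using t by (auto simp: cylinder_def simp del: upt_Suc)
    ultimately show "t \<in> (\<Union>s\<in>?I. cylinder G s)"
      using t inf_paths_verts[OF t(2)] \<open>t 0 = root G\<close>
      by (intro UN_I[of "map t [0..<Suc n]"]) (auto simp del: upt_Suc)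
  next
    fix t assume "t \<in> (\<Union>s\<in>?I. cylinder G s)"
    then obtain s y where *: "t \<in> cylinder G s" "s \<in> fin_paths G (root G) y" "length s = Suc n" "y \<in> A"
      by blast
    then have "t n = last s" by (auto simp: cylinder_def last_conv_nth fin_pathsD(1))
    then show "t \<in> (\<lambda>t. t n) -` A \<inter> space (path_space G)"
      using fin_pathsD(3)[OF *(2)] *(1,4) by (simp add: cylinder_def)
  qed
  also have "\<dots> \<in> sets (path_space G)"
    using I cylinder_sets by (intro sets.countable_UN') auto
  finally show "(\<lambda>t. t n) -` A \<inter> space (path_space G) \<in> sets (path_space G)" .
qed simp

text \<open>Being an edge is rewritten as a search through the countable set \<open>edges G\<close>,
  so that each test concerns single coordinates.\<close>

lemma measurable_inf_path:
  assumes [measurable]: "\<And>n. X n \<in> M \<rightarrow>\<^sub>M count_space UNIV"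
  shows "{\<omega> \<in> space M. (\<lambda>n. X n \<omega>) \<in> inf_paths G} \<in> sets M"
proof -
  have eq: "(\<lambda>n. X n \<omega>) \<in> inf_paths G \<longleftrightarrow>
      X 0 \<omega> = root G \<and> (\<forall>i. \<exists>e\<in>edges G. X i \<omega> = fst e \<and> X (Suc i) \<omega> = snd e)" for \<omega>
  proof -
    have "(\<exists>e\<in>edges G. a = fst e \<and> b = snd e) \<longleftrightarrow> (a, b) \<in> edges G" for a b by force
    then show ?thesis by (simp add: inf_paths_def)
  qed
  have [measurable]: "countable (edges G)" by (rule countable_edges)
  show ?thesis
    unfolding eq by measurable
qed

text \<open>The trajectory may leave \<open>inf_paths G\<close> on a null set, so it need not be a
  measurable map into the path space, although \<open>path_law\<close> is a \<open>distr\<close>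
  along it. Redirecting it there gives a measurable map with the same probabilities.\<close>

lemma
  assumes M: "prob_space M" and X [measurable]: "\<And>n. X n \<in> M \<rightarrow>\<^sub>M count_space UNIV"
    and path: "AE \<omega> in M. (\<lambda>n. X n \<omega>) \<in> inf_paths G"
  shows prob_space_path_law: "prob_space (path_law G M X)"
    and emeasure_path_law: "A \<in> sets (path_space G) \<Longrightarrow>
      emeasure (path_law G M X) A = emeasure M {\<omega> \<in> space M. (\<lambda>n. X n \<omega>) \<in> A}"
    and trajectory_measurable: "A \<in> sets (path_space G) \<Longrightarrow> {\<omega> \<in> space M. (\<lambda>n. X n \<omega>) \<in> A} \<in> sets M"
proof -
  interpret prob_space M by (rule M)
  obtain t0 where t0: "t0 \<in> inf_paths G"
  proof (rule ccontr)
    assume "\<not> thesis"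
    then have "inf_paths G = {}" using that by blast
    then show False using path by simp
  qed
  \<comment> \<open>The trajectory redirected off the null set where it is not a path of the diagram.\<close>
  define X' where "X' \<omega> = (if (\<lambda>n. X n \<omega>) \<in> inf_paths G then (\<lambda>n. X n \<omega>) else t0)" for \<omega>
  have good: "{\<omega> \<in> space M. (\<lambda>n. X n \<omega>) \<in> inf_paths G} \<in> sets M"
    by (rule measurable_inf_path[OF X])
  have X': "X' \<in> M \<rightarrow>\<^sub>M path_space G"
  proof (rule measurable_sigma_sets[OF sets_path_space])
    fix C assume "C \<in> {cylinder G s | s y. y \<in> verts G \<and> s \<in> fin_paths G (root G) y}"
    then obtain s where s: "C = cylinder G s" by blast
    have "X' -` C \<inter> space M =
        ({\<omega> \<in> space M. \<forall>i<length s. X i \<omega> = s ! i} \<inter> {\<omega> \<in> space M. (\<lambda>n. X n \<omega>) \<in> inf_paths G}) \<union>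
        (if t0 \<in> C then space M - {\<omega> \<in> space M. (\<lambda>n. X n \<omega>) \<in> inf_paths G} else {})"
      using t0 by (auto simp: s X'_def cylinder_def split: if_splits)
    also have "\<dots> \<in> sets M"
      using good by (intro sets.Un sets.Int) auto
    finally show "X' -` C \<inter> space M \<in> sets M" .
  qed (use t0 in \<open>auto simp: X'_def cylinder_def\<close>)
  have meas: "{\<omega> \<in> space M. (\<lambda>n. X n \<omega>) \<in> A} \<in> sets M" if A: "A \<in> sets (path_space G)" for A
  proof -
    have "{\<omega> \<in> space M. (\<lambda>n. X n \<omega>) \<in> A} = (X' -` A \<inter> space M) \<inter> {\<omega> \<in> space M. (\<lambda>n. X n \<omega>) \<in> inf_paths G}"
      using sets.sets_into_space[OF A] by (auto simp: X'_def)
    then show ?thesis using measurable_sets[OF X' A] good by auto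
  qed
  then show "A \<in> sets (path_space G) \<Longrightarrow> {\<omega> \<in> space M. (\<lambda>n. X n \<omega>) \<in> A} \<in> sets M" .
  have eq: "emeasure M {\<omega> \<in> space M. (\<lambda>n. X n \<omega>) \<in> A} = emeasure M (X' -` A \<inter> space M)"
    if A: "A \<in> sets (path_space G)" for A
  proof (rule emeasure_eq_AE)
    show "AE \<omega> in M. \<omega> \<in> {\<omega> \<in> space M. (\<lambda>n. X n \<omega>) \<in> A} \<longleftrightarrow> \<omega> \<in> X' -` A \<inter> space M"
      using path by eventually_elim (auto simp: X'_def)
  qed (use meas[OF A] measurable_sets[OF X' A] in auto)
  \<comment> \<open>A \<open>distr\<close> is determined by the masses of preimages, and these agree
    for both maps on every measurable set.\<close>
  have law: "path_law G M X = distr M (path_space G) X'"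
    unfolding path_law_def distr_def
  proof (rule measure_of_eq)
    fix A assume "A \<in> sigma_sets (space (path_space G)) (sets (path_space G))"
    then have A: "A \<in> sets (path_space G)" by (simp only: sets.sigma_sets_eq)
    show "emeasure M ((\<lambda>\<omega> n. X n \<omega>) -` A \<inter> space M) = emeasure M (X' -` A \<inter> space M)"
      using eq[OF A] by (simp add: vimage_def Collect_conj_eq Int_commute)
  qed (rule sets.space_closed)
  show "prob_space (path_law G M X)"
    unfolding law by (rule prob_space_distr[OF X'])
  show "A \<in> sets (path_space G) \<Longrightarrow>
      emeasure (path_law G M X) A = emeasure M {\<omega> \<in> space M. (\<lambda>n. X n \<omega>) \<in> A}"
    unfolding law by (simp add: emeasure_distr[OF X'] eq)
qed

lemma sets_path_law [simp]: "sets (path_law G M X) = sets (path_space G)"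
  by (simp add: path_law_def)

end

section \<open>The support of a harmonic function as a saturated subdiagram\<close>

locale harmonic_bratteli = finite_bratteli +
  fixes \<phi> :: "'a \<Rightarrow> real"
  assumes nnhf: "nnhf G \<phi>"
begin

abbreviation "H \<equiv> support_bd G \<phi>"

lemma harmonic_nonneg: "x \<in> verts G \<Longrightarrow> 0 \<le> \<phi> x"
  and harmonic_root: "\<phi> (root G) = 1"
  and harmonic_sum: "x \<in> verts G \<Longrightarrow> ((\<lambda>y. wt G x y * \<phi> y) has_sum \<phi> x) {y. (x, y) \<in> edges G}"
  using nnhf by (auto simp: nnhf_def)

lemma support_simps [simp]: "lev H = lev G" "wt H = wt G" "root H = root G"
  by (simp_all add: support_bd_def Let_def)

lemma verts_support: "x \<in> verts H \<longleftrightarrow> x \<in> verts G \<and> 0 < \<phi> x"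
  and edges_support: "e \<in> edges H \<longleftrightarrow> e \<in> edges G \<and> fst e \<in> verts H \<and> snd e \<in> verts H"
  by (auto simp: support_bd_def Let_def mem_Times_iff)

lemma path_wt_support [simp]: "path_wt H = path_wt G"
  by (simp add: path_wt_def fun_eq_iff)

text \<open>The harmonic sum at \<open>x\<close> contains the positive term of the edge to
  \<open>y\<close>, and its other terms are nonnegative.\<close>

lemma support_saturated:
  assumes e: "(x, y) \<in> edges G" and y: "y \<in> verts H"
  shows "x \<in> verts H"
proof -
  have x: "x \<in> verts G" using e by (rule edge_verts)
  have "sum (\<lambda>y. wt G x y * \<phi> y) {y} \<le> \<phi> x"
  proof (rule finite_sum_le_has_sum[OF harmonic_sum[OF x]])
    fix z assume "z \<in> {y. (x, y) \<in> edges G} - {y}"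
    then have "(x, z) \<in> edges G" by simp
    then show "0 \<le> wt G x z * \<phi> z"
      using edge_wt[of x z] edge_verts(2)[of x z] harmonic_nonneg[of z] by simp
  qed (use e in auto)
  moreover have "0 < wt G x y * \<phi> y" using y edge_wt[OF e] by (simp add: verts_support)
  ultimately show ?thesis using x by (simp add: verts_support)
qed

lemma support_out_edge:
  assumes "x \<in> verts H"
  shows "\<exists>y\<in>verts H. (x, y) \<in> edges G"
proof (rule ccontr)
  assume none: "\<not> (\<exists>y\<in>verts H. (x, y) \<in> edges G)"
  have "((\<lambda>y. wt G x y * \<phi> y) has_sum 0) {y. (x, y) \<in> edges G}"
  proof (rule has_sum_0)
    fix y assume "y \<in> {y. (x, y) \<in> edges G}"
    then have "y \<in> verts G" "y \<notin> verts H" using edge_verts(2) none by blast+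
    then have "\<phi> y = 0" using harmonic_nonneg[of y] by (simp add: verts_support)
    then show "wt G x y * \<phi> y = 0" by simp
  qed
  moreover have "x \<in> verts G" using assms by (simp add: verts_support)
  ultimately have "\<phi> x = 0" using has_sum_unique harmonic_sum by blast
  then show False using assms by (simp add: verts_support)
qed

lemma root_support: "root G \<in> verts H"
  by (simp add: verts_support root_verts harmonic_root)

lemma support_bratteli: "weighted_bratteli H"
  unfolding weighted_bratteli_def
proof (intro conjI ballI allI)
  show "root H \<in> verts H" by (simp add: root_support)
  show "edges H \<subseteq> verts H \<times> verts H" by (auto simp: edges_support)
  fix e assume "e \<in> edges H"
  then obtain x y where "e = (x, y)" "(x, y) \<in> edges G" by (cases e) (auto simp: edges_support)
  then show "case e of (x, y) \<Rightarrow> lev H y = Suc (lev H x) \<and> 0 < wt H x y"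
    using edge_lev[of x y] edge_wt[of x y] by simp
next
  fix x assume x: "x \<in> verts H"
  then have "x \<in> verts G" by (simp add: verts_support)
  show "(\<forall>y. (y, x) \<notin> edges H) \<longleftrightarrow> x = root H"
  proof (cases "x = root G")
    case True
    then show ?thesis using no_edge_to_root by (simp add: edges_support)
  next
    case False
    then obtain y where "(y, x) \<in> edges G" using in_edge \<open>x \<in> verts G\<close> by blast
    then have "(y, x) \<in> edges H" using support_saturated x by (simp add: edges_support)
    then show ?thesis using False by auto
  qed
  obtain y where "y \<in> verts H" "(x, y) \<in> edges G" using support_out_edge[OF x] by blast
  then show "\<exists>y. (x, y) \<in> edges H" using x by (auto simp: edges_support)
next
  show "countable (level H n)" for n
    by (rule countable_subset[OF _ countable_level[of n]]) (auto simp: level_def verts_support)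
qed (simp add: lev_root)

lemma support_ssbd: "ssbd H G"
  unfolding ssbd_def
proof (intro conjI)
  show "\<forall>y\<in>verts H. \<forall>x. (x, y) \<in> edges G \<longrightarrow> x \<in> verts H"
    using support_saturated by blast
qed (auto simp: support_bratteli verts_support edges_support)

sublocale H: bratteli H
  by unfold_locales (rule support_bratteli)

lemma fin_path_in_support:
  assumes "s \<in> fin_paths G x y" "y \<in> verts H"
  shows "set s \<subseteq> verts H"
  using assms
proof (induction s arbitrary: y rule: rev_induct)
  case (snoc z s)
  show ?case
  proof (cases "s = []")
    case False
    with snoc.prems have "s \<in> fin_paths G x (last s)" "(last s, z) \<in> edges G" "z \<in> verts H"
      by (auto simp: fin_paths_snoc_iff)
    then show ?thesis using snoc.IH support_saturated by auto
  qed (use snoc.prems in \<open>auto simp: fin_paths_single_iff\<close>)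
qed simp

text \<open>A condition on the endpoint suffices, because saturation carries positivity backwards
  along the path.\<close>

lemma fin_paths_support:
  assumes "y \<in> verts H"
  shows "fin_paths H x y = fin_paths G x y"
proof (intro equalityI subsetI)
  fix s assume s: "s \<in> fin_paths H x y"
  then have "successively (\<lambda>a b. (a, b) \<in> edges G) s"
    unfolding fin_paths_def by (auto simp: edges_support elim!: successively_mono)
  then show "s \<in> fin_paths G x y"
    using s by (auto simp: fin_paths_def verts_support)
next
  fix s assume s: "s \<in> fin_paths G x y"
  have set: "set s \<subseteq> verts H" by (rule fin_path_in_support[OF s assms])
  then have "successively (\<lambda>a b. (a, b) \<in> edges H) s"
    using s unfolding fin_paths_def by (auto simp: edges_support elim!: successively_mono)
  then show "s \<in> fin_paths H x y" using s set by (simp add: fin_paths_def)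
qed

lemma inf_paths_support_subset: "inf_paths H \<subseteq> inf_paths G"
  by (auto simp: inf_paths_def edges_support)

lemma inf_paths_support_sets: "inf_paths H \<in> sets (path_space G)"
proof -
  have "inf_paths H = {t \<in> space (path_space G). (\<lambda>n. t n) \<in> inf_paths H}"
    using inf_paths_support_subset by auto
  also have "\<dots> \<in> sets (path_space G)"
    by (rule H.measurable_inf_path) (rule coordinate_measurable)
  finally show ?thesis .
qed

text \<open>Allows the law on paths of \<open>G\<close> to be restricted to paths of the support.
  The trace of a cylinder of \<open>G\<close> on \<open>inf_paths H\<close> is the cylinder of
  \<open>H\<close> with the same prefix.\<close>

lemma sets_path_space_support:
  "sets (path_space H) = sets (restrict_space (path_space G) (inf_paths H))"
proof -
  let ?G = "{cylinder G s | s y. y \<in> verts G \<and> s \<in> fin_paths G (root G) y}"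
  let ?H = "{cylinder H s | s y. y \<in> verts H \<and> s \<in> fin_paths H (root H) y}"
  have cyl: "inf_paths H \<inter> cylinder G s = cylinder H s" for s
    using inf_paths_support_subset by (auto simp: cylinder_def)
  have "sets (restrict_space (path_space G) (inf_paths H)) = sigma_sets (inf_paths H) ((\<inter>) (inf_paths H) ` ?G)"
    unfolding sets_restrict_space sets_path_space
    by (rule sigma_sets_Int) (use inf_paths_support_sets inf_paths_support_subset in \<open>auto simp: sets_path_space\<close>)
  also have "\<dots> = sigma_sets (inf_paths H) ?H"
  proof (rule sigma_sets_eqI)
    fix C assume "C \<in> (\<inter>) (inf_paths H) ` ?G"
    then obtain s y where s: "C = cylinder H s" "y \<in> verts G" "s \<in> fin_paths G (root G) y"
      using cyl by auto
    show "C \<in> sigma_sets (inf_paths H) ?H"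
    proof (cases "y \<in> verts H")
      case True
      then show ?thesis using s fin_paths_support[OF True] by (intro sigma_sets.Basic) auto
    next
      case False
      \<comment> \<open>A path of \<open>H\<close> never visits the endpoint \<open>y\<close>, which
        lies outside the support.\<close>
      have "C = {}"
      proof (rule ccontr)
        assume "C \<noteq> {}"
        then obtain t where t: "t \<in> inf_paths H" "\<forall>i<length s. t i = s ! i"
          using s(1) by (auto simp: cylinder_def)
        then have "t (length s - 1) = y"
          using fin_pathsD(1,3)[OF s(3)] by (simp add: last_conv_nth)
        then show False using H.inf_paths_verts[OF t(1)] False by auto
      qed
      then show ?thesis by (simp add: sigma_sets.Empty)
    qed
  next
    fix C assume "C \<in> ?H"
    then obtain s y where s: "C = cylinder H s" "y \<in> verts H" "s \<in> fin_paths H (root H) y" by blast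
    then have "C = inf_paths H \<inter> cylinder G s" "s \<in> fin_paths G (root G) y" "y \<in> verts G"
      using cyl fin_paths_support by (auto simp: verts_support)
    then show "C \<in> sigma_sets (inf_paths H) ((\<inter>) (inf_paths H) ` ?G)"
      by (intro sigma_sets.Basic) blast
  qed
  finally show ?thesis by (simp add: H.sets_path_space)
qed

end

section \<open>Maximal entropy random walks\<close>

lemma (in bratteli) nth_lev_root_path:
  assumes "s \<in> fin_paths G (root G) x"
  shows "s ! lev G x = x" "lev G x < length s"
proof -
  have "length s - 1 = lev G x" using fin_paths_lev[OF assms] by (simp add: lev_root)
  moreover have "s \<noteq> []" "last s = x" using fin_pathsD[OF assms] by auto
  ultimately show "s ! lev G x = x" "lev G x < length s"
    using last_conv_nth[of s] fin_paths_lev[OF assms] by (auto simp: lev_root)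
qed

locale merw_chain = harmonic_bratteli G \<phi> for G :: "'a wbd" and \<phi> +
  fixes P :: "'b measure" and X :: "nat \<Rightarrow> 'b \<Rightarrow> 'a"
  assumes chain: "markov_chain P (verts H) (merw_kernel G \<phi>) X"
begin

sublocale P: prob_space P
  using chain by (simp add: markov_chain_def)

lemma X_measurable [measurable]: "X n \<in> P \<rightarrow>\<^sub>M count_space UNIV"
  using chain by (simp add: markov_chain_def)

lemma X_support: "AE \<omega> in P. \<forall>n. X n \<omega> \<in> verts H"
  using chain by (simp add: markov_chain_def AE_all_countable)

lemma history_step:
  assumes "length s = Suc n" "set s \<subseteq> verts H" "y \<in> verts H"
  shows "measure P {\<omega> \<in> space P. (\<forall>i\<le>n. X i \<omega> = s ! i) \<and> X (Suc n) \<omega> = y} =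
    measure P {\<omega> \<in> space P. \<forall>i\<le>n. X i \<omega> = s ! i} * merw_kernel G \<phi> (s ! n) y"
  using chain assms by (auto simp: markov_chain_def)

text \<open>The Markov property in \<open>markov_chain\<close> speaks of complete histories from
  time 0. Summing over the countably many histories of length \<open>m\<close> gives access to
  events that begin at time \<open>m\<close>.\<close>

lemma emeasure_by_history:
  assumes E: "E \<in> sets P"
  shows "emeasure P E = (\<integral>\<^sup>+h. emeasure P {\<omega> \<in> E. \<forall>i<m. X i \<omega> = h ! i}
    \<partial>count_space {h. set h \<subseteq> verts H \<and> length h = m})"
proof -
  let ?I = "{h. set h \<subseteq> verts H \<and> length h = m}"
  let ?A = "\<lambda>h. {\<omega> \<in> E. \<forall>i<m. X i \<omega> = h ! i}"
  have "countable (lists (verts H))" using H.countable_verts by (rule countable_lists)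
  then have I: "countable ?I" by (rule countable_subset[rotated]) auto
  have A: "?A h \<in> sets P" for h
  proof -
    have "?A h = E \<inter> {\<omega> \<in> space P. \<forall>i<m. X i \<omega> = h ! i}"
      using sets.sets_into_space[OF E] by auto
    also have "\<dots> \<in> sets P" using E by (intro sets.Int) auto
    finally show ?thesis .
  qed
  have "emeasure P E = emeasure P (\<Union>h\<in>?I. ?A h)"
  proof (rule emeasure_eq_AE)
    show "AE \<omega> in P. \<omega> \<in> E \<longleftrightarrow> \<omega> \<in> (\<Union>h\<in>?I. ?A h)"
      using X_support
    proof eventually_elim
      case (elim \<omega>)
      have "map (\<lambda>i. X i \<omega>) [0..<m] \<in> ?I" using elim by auto
      moreover have "\<forall>i<m. X i \<omega> = map (\<lambda>i. X i \<omega>) [0..<m] ! i" by simp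
      ultimately show ?case by blast
    qed
    show "(\<Union>h\<in>?I. ?A h) \<in> sets P" by (rule sets.countable_UN'[OF I]) (use A in blast)
  qed (rule E)
  also have "\<dots> = (\<integral>\<^sup>+h. emeasure P (?A h) \<partial>count_space ?I)"
  proof (rule emeasure_UN_countable[OF A I])
    show "disjoint_family_on ?A ?I"
      unfolding disjoint_family_on_def
    proof (intro ballI impI)
      fix h h' assume h: "h \<in> ?I" "h' \<in> ?I" "h \<noteq> h'"
      then obtain i where "i < m" "h ! i \<noteq> h' ! i" using nth_equalityI[of h h'] by auto
      show "?A h \<inter> ?A h' = {}"
      proof (rule equals0I)
        fix \<omega> assume "\<omega> \<in> ?A h \<inter> ?A h'"
        then have "X i \<omega> = h ! i" "X i \<omega> = h' ! i" using \<open>i < m\<close> by blast+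
        then show False using \<open>h ! i \<noteq> h' ! i\<close> by simp
      qed
    qed
  qed
  finally show ?thesis .
qed

text \<open>The transition factor depends only on the last state, so it is the same for all
  histories before time \<open>m\<close> and comes out of the sum over them.\<close>

lemma markov_step:
  assumes s: "length s = Suc n" "set s \<subseteq> verts H" and y: "y \<in> verts H"
  shows "measure P {\<omega> \<in> space P. (\<forall>i\<le>n. X (m + i) \<omega> = s ! i) \<and> X (m + Suc n) \<omega> = y} =
    measure P {\<omega> \<in> space P. \<forall>i\<le>n. X (m + i) \<omega> = s ! i} * merw_kernel G \<phi> (s ! n) y"
    (is "measure P ?E' = measure P ?E * ?p")
proof -
  let ?I = "{h. set h \<subseteq> verts H \<and> length h = m}"
  have split_le: "(\<forall>i\<le>m + n. X i \<omega> = (h @ s) ! i) \<longleftrightarrow>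
      (\<forall>i<m. X i \<omega> = h ! i) \<and> (\<forall>i\<le>n. X (m + i) \<omega> = s ! i)" if h: "length h = m" for h \<omega>
  proof safe
    fix i assume *: "\<forall>i\<le>m + n. X i \<omega> = (h @ s) ! i"
    show "X i \<omega> = h ! i" if "i < m" using *[rule_format, of i] that h by (simp add: nth_append)
    show "X (m + i) \<omega> = s ! i" if "i \<le> n" using *[rule_format, of "m + i"] that h by (simp add: nth_append)
  next
    fix i assume *: "\<forall>i<m. X i \<omega> = h ! i" "\<forall>i\<le>n. X (m + i) \<omega> = s ! i" "i \<le> m + n"
    show "X i \<omega> = (h @ s) ! i"
    proof (cases "i < m")
      case False
      then show ?thesis using *(2)[rule_format, of "i - m"] *(3) h by (simp add: nth_append)
    qed (use *(1) h in \<open>simp add: nth_append\<close>)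
  qed
  have p: "0 \<le> ?p"
    using s y harmonic_nonneg[of y] verts_support[of y] edge_wt nth_mem[of n s]
    by (auto simp: merw_kernel_def verts_support subset_eq intro!: divide_nonneg_nonneg mult_nonneg_nonneg less_imp_le)
  have step: "emeasure P {\<omega> \<in> ?E'. \<forall>i<m. X i \<omega> = h ! i} =
      emeasure P {\<omega> \<in> ?E. \<forall>i<m. X i \<omega> = h ! i} * ennreal ?p" if h: "h \<in> ?I" for h
  proof -
    have "{\<omega> \<in> ?E'. \<forall>i<m. X i \<omega> = h ! i} =
        {\<omega> \<in> space P. (\<forall>i\<le>m + n. X i \<omega> = (h @ s) ! i) \<and> X (Suc (m + n)) \<omega> = y}"
      using h by (auto simp: split_le)
    moreover have "{\<omega> \<in> ?E. \<forall>i<m. X i \<omega> = h ! i} = {\<omega> \<in> space P. \<forall>i\<le>m + n. X i \<omega> = (h @ s) ! i}"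
      using h by (auto simp: split_le)
    moreover have "(h @ s) ! (m + n) = s ! n" using h by (simp add: nth_append)
    ultimately show ?thesis
      using history_step[of "h @ s" "m + n" y] h s y p
      by (simp add: P.emeasure_eq_measure ennreal_mult)
  qed
  have "emeasure P ?E' = (\<integral>\<^sup>+h. emeasure P {\<omega> \<in> ?E'. \<forall>i<m. X i \<omega> = h ! i} \<partial>count_space ?I)"
    by (rule emeasure_by_history) simp
  also have "\<dots> = (\<integral>\<^sup>+h. emeasure P {\<omega> \<in> ?E. \<forall>i<m. X i \<omega> = h ! i} * ennreal ?p \<partial>count_space ?I)"
    by (rule nn_integral_cong, rule step) simp
  also have "\<dots> = (\<integral>\<^sup>+h. emeasure P {\<omega> \<in> ?E. \<forall>i<m. X i \<omega> = h ! i} \<partial>count_space ?I) * ennreal ?p"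
    by (rule nn_integral_multc) simp
  also have "(\<integral>\<^sup>+h. emeasure P {\<omega> \<in> ?E. \<forall>i<m. X i \<omega> = h ! i} \<partial>count_space ?I) = emeasure P ?E"
    by (rule emeasure_by_history[symmetric]) simp
  finally have "ennreal (measure P ?E') = ennreal (measure P ?E * ?p)"
    by (simp add: P.emeasure_eq_measure ennreal_mult p)
  then show ?thesis using p by (simp add: ennreal_inj)
qed

text \<open>Time \<open>m\<close> is independent of the level of \<open>x\<close>, because the
  initial law of the chain is arbitrary.\<close>

lemma path_prob:
  assumes "s \<in> fin_paths G x y" "y \<in> verts H"
  shows "measure P {\<omega> \<in> space P. \<forall>i<length s. X (m + i) \<omega> = s ! i} =
    measure P {\<omega> \<in> space P. X m \<omega> = x} * (path_wt G s * \<phi> y / \<phi> x)"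
  using assms
proof (induction s arbitrary: y rule: rev_induct)
  case Nil
  then show ?case by (simp add: fin_paths_def)
next
  case (snoc z s)
  show ?case
  proof (cases "s = []")
    case True
    with snoc.prems have "x = z" "y = z" by (auto simp: fin_paths_single_iff)
    then show ?thesis using True snoc.prems by (simp add: verts_support)
  next
    case False
    then obtain n where n: "length s = Suc n" by (cases s) auto
    from False snoc.prems have z: "y = z" "s \<in> fin_paths G x (last s)" "(last s, z) \<in> edges G"
      by (auto simp: fin_paths_snoc_iff)
    have last: "last s \<in> verts H" using support_saturated z snoc.prems by blast
    have set: "set s \<subseteq> verts H" by (rule fin_path_in_support[OF z(2) last])
    have nth: "s ! n = last s" using n False by (simp add: last_conv_nth)
    have "{\<omega> \<in> space P. \<forall>i<length (s @ [z]). X (m + i) \<omega> = (s @ [z]) ! i} =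
        {\<omega> \<in> space P. (\<forall>i\<le>n. X (m + i) \<omega> = s ! i) \<and> X (m + Suc n) \<omega> = z}"
      using n by (auto simp: nth_append less_Suc_eq_le le_Suc_eq)
    moreover have "{\<omega> \<in> space P. \<forall>i\<le>n. X (m + i) \<omega> = s ! i} =
        {\<omega> \<in> space P. \<forall>i<length s. X (m + i) \<omega> = s ! i}"
      using n by (auto simp: less_Suc_eq_le)
    ultimately have "measure P {\<omega> \<in> space P. \<forall>i<length (s @ [z]). X (m + i) \<omega> = (s @ [z]) ! i} =
        measure P {\<omega> \<in> space P. X m \<omega> = x} * (path_wt G s * \<phi> (last s) / \<phi> x) * merw_kernel G \<phi> (last s) z"
      using markov_step[OF n set, of z m] snoc.prems z snoc.IH[OF z(2) last] nth by simp
    moreover have "\<phi> (last s) \<noteq> 0" using last by (simp add: verts_support)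
    ultimately show ?thesis
      using z False by (simp add: merw_kernel_def path_wt_snoc)
  qed
qed

text \<open>The kernel vanishes off the edges, and only countably many pairs of support vertices
  have to be excluded.\<close>

lemma X_edges: "AE \<omega> in P. \<forall>i. (X i \<omega>, X (Suc i) \<omega>) \<in> edges H"
  unfolding AE_all_countable
proof
  fix i
  let ?N = "verts H \<times> verts H - edges G"
  have "AE \<omega> in P. \<forall>e\<in>?N. \<not> (X i \<omega> = fst e \<and> X (Suc i) \<omega> = snd e)"
  proof (rule AE_ball_countable')
    fix e assume e: "e \<in> ?N"
    have "measure P {\<omega> \<in> space P. (\<forall>j\<le>0. X (i + j) \<omega> = [fst e] ! j) \<and> X (i + Suc 0) \<omega> = snd e} = 0"
      using e by (subst markov_step) (auto simp: merw_kernel_def)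
    then have "measure P {\<omega> \<in> space P. X i \<omega> = fst e \<and> X (Suc i) \<omega> = snd e} = 0" by simp
    then show "AE \<omega> in P. \<not> (X i \<omega> = fst e \<and> X (Suc i) \<omega> = snd e)"
      by (subst P.prob_Collect_eq_0[symmetric]) auto
  qed (use H.countable_verts in auto)
  with X_support show "AE \<omega> in P. (X i \<omega>, X (Suc i) \<omega>) \<in> edges H"
  proof eventually_elim
    case (elim \<omega>)
    then have "(X i \<omega>, X (Suc i) \<omega>) \<notin> ?N" by force
    then show ?case using elim(1) by (simp add: edges_support)
  qed
qed

text \<open>Up to a null set the event is the disjoint union of the events of following one of the
  paths from x to y. The level condition makes all these paths take exactly \<open>n\<close>
  steps.\<close>

lemma endpoint_prob:
  assumes x: "x \<in> verts H" and y: "y \<in> verts H" and lev: "lev G y = lev G x + n"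
  shows "measure P {\<omega> \<in> space P. X m \<omega> = x \<and> X (m + n) \<omega> = y} =
    measure P {\<omega> \<in> space P. X m \<omega> = x} * (enn2real (dim G x y) * \<phi> y / \<phi> x)"
proof -
  let ?F = "fin_paths G x y"
  let ?A = "\<lambda>s. {\<omega> \<in> space P. \<forall>i<length s. X (m + i) \<omega> = s ! i}"
  let ?c = "measure P {\<omega> \<in> space P. X m \<omega> = x} * (\<phi> y / \<phi> x)"
  have c: "0 \<le> ?c" using x y by (simp add: verts_support)
  have len: "length s = Suc n" if "s \<in> ?F" for s
    using fin_paths_length[OF that] lev by simp
  have "emeasure P {\<omega> \<in> space P. X m \<omega> = x \<and> X (m + n) \<omega> = y} = emeasure P (\<Union>s\<in>?F. ?A s)"
  proof (rule emeasure_eq_AE)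
    show "AE \<omega> in P. \<omega> \<in> {\<omega> \<in> space P. X m \<omega> = x \<and> X (m + n) \<omega> = y} \<longleftrightarrow> \<omega> \<in> (\<Union>s\<in>?F. ?A s)"
      using X_edges
    proof eventually_elim
      case (elim \<omega>)
      let ?s = "map (\<lambda>i. X (m + i) \<omega>) [0..<Suc n]"
      have e: "(X i \<omega>, X (Suc i) \<omega>) \<in> edges G" for i using elim by (simp add: edges_support)
      have path: "?s \<in> fin_paths G (X (m + 0) \<omega>) (X (m + n) \<omega>)"
      proof (rule segment_fin_path)
        show "(X (m + i) \<omega>, X (m + Suc i) \<omega>) \<in> edges G" for i using e[of "m + i"] by simp
        show "X (m + 0) \<omega> \<in> verts G" using edge_verts(1)[OF e[of m]] by simp
      qed
      have nth: "\<forall>i<length ?s. X (m + i) \<omega> = ?s ! i" by (simp del: upt_Suc)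
      show ?case
      proof
        assume *: "\<omega> \<in> {\<omega> \<in> space P. X m \<omega> = x \<and> X (m + n) \<omega> = y}"
        then have "?s \<in> ?F" using path by (simp del: upt_Suc)
        moreover have "\<omega> \<in> ?A ?s" using nth * by blast
        ultimately show "\<omega> \<in> (\<Union>s\<in>?F. ?A s)" by (rule UN_I)
      next
        assume "\<omega> \<in> (\<Union>s\<in>?F. ?A s)"
        then obtain s where s: "s \<in> ?F" "\<omega> \<in> ?A s" by (rule UN_E)
        have "s ! 0 = x" "s ! n = y"
          using fin_pathsD[OF s(1)] len[OF s(1)] by (simp_all add: hd_conv_nth last_conv_nth)
        moreover have "X (m + i) \<omega> = s ! i" if "i < Suc n" for i
          using s len[OF s(1)] that by simp
        from this[of 0] this[of n] have "X m \<omega> = s ! 0" "X (m + n) \<omega> = s ! n" by simp_all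
        ultimately show "\<omega> \<in> {\<omega> \<in> space P. X m \<omega> = x \<and> X (m + n) \<omega> = y}"
          using s(2) by simp
      qed
    qed
    show "(\<Union>s\<in>?F. ?A s) \<in> sets P"
      by (rule sets.countable_UN'[OF countable_fin_paths]) auto
  qed simp
  also have "\<dots> = (\<integral>\<^sup>+s. emeasure P (?A s) \<partial>count_space ?F)"
  proof (rule emeasure_UN_countable[OF _ countable_fin_paths])
    show "disjoint_family_on ?A ?F"
      unfolding disjoint_family_on_def
    proof (intro ballI impI)
      fix s s' assume s: "s \<in> ?F" "s' \<in> ?F" "s \<noteq> s'"
      then obtain i where "i < Suc n" "s ! i \<noteq> s' ! i" using nth_equalityI[of s s'] len by metis
      show "?A s \<inter> ?A s' = {}"
      proof (rule equals0I)
        fix \<omega> assume "\<omega> \<in> ?A s \<inter> ?A s'"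
        moreover have "i < length s" "i < length s'" using len s \<open>i < Suc n\<close> by auto
        ultimately have "X (m + i) \<omega> = s ! i" "X (m + i) \<omega> = s' ! i" by blast+
        then show False using \<open>s ! i \<noteq> s' ! i\<close> by simp
      qed
    qed
  qed auto
  also have "\<dots> = (\<integral>\<^sup>+s. ennreal ?c * ennreal (path_wt G s) \<partial>count_space ?F)"
  proof (rule nn_integral_cong)
    fix s assume "s \<in> space (count_space ?F)"
    then have s: "s \<in> ?F" by simp
    then show "emeasure P (?A s) = ennreal ?c * ennreal (path_wt G s)"
      unfolding P.emeasure_eq_measure path_prob[OF s y] using c
      by (subst ennreal_mult'[symmetric]) (auto simp: mult_ac)
  qed
  also have "\<dots> = ennreal ?c * dim G x y" by (simp add: nn_integral_cmult dim_eq)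
  finally have "measure P {\<omega> \<in> space P. X m \<omega> = x \<and> X (m + n) \<omega> = y} = ?c * enn2real (dim G x y)"
    using c by (simp add: measure_def enn2real_mult)
  then show ?thesis by (simp add: mult_ac)
qed

text \<open>Stated at a general time \<open>m\<close>: for the chain from the root, m is the level
  of x; for an arbitrary initial law it is 0.\<close>

lemma bridge:
  assumes x: "x \<in> verts H" and y: "y \<in> verts H" and t: "t \<in> fin_paths G x y" "length t = Suc n"
    and pos: "0 < measure P {\<omega> \<in> space P. X m \<omega> = x}"
  shows "\<P>(\<omega> in P. (\<forall>i\<in>{0<..<n}. X (m + i) \<omega> = t ! i) \<bar> X m \<omega> = x \<and> X (m + n) \<omega> = y) =
    path_wt G t / (\<Sum>\<^sub>\<infinity>s\<in>fin_paths G x y. path_wt G s)"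
proof -
  have lev: "lev G y = lev G x + n" using fin_paths_lev[OF t(1)] t(2) by simp
  have ends: "t ! 0 = x" "t ! n = y"
    using fin_pathsD[OF t(1)] t(2) by (simp_all add: hd_conv_nth last_conv_nth)
  have iff: "((\<forall>i\<in>{0<..<n}. X (m + i) \<omega> = t ! i) \<and> X m \<omega> = x \<and> X (m + n) \<omega> = y) \<longleftrightarrow>
      (\<forall>i<length t. X (m + i) \<omega> = t ! i)" for \<omega>
  proof
    assume *: "(\<forall>i\<in>{0<..<n}. X (m + i) \<omega> = t ! i) \<and> X m \<omega> = x \<and> X (m + n) \<omega> = y"
    show "\<forall>i<length t. X (m + i) \<omega> = t ! i"
    proof (intro allI impI)
      fix i assume "i < length t"
      then consider "i = 0" | "i = n" | "0 < i" "i < n" using t(2) by linarith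
      then show "X (m + i) \<omega> = t ! i" using * ends by cases auto
    qed
  next
    assume *: "\<forall>i<length t. X (m + i) \<omega> = t ! i"
    show "(\<forall>i\<in>{0<..<n}. X (m + i) \<omega> = t ! i) \<and> X m \<omega> = x \<and> X (m + n) \<omega> = y"
      using *[rule_format, of 0] *[rule_format, of n] * ends t(2) by auto
  qed
  have xy: "x \<in> verts G" "y \<in> verts G" "0 < \<phi> x" "0 < \<phi> y"
    using x y by (auto simp: verts_support)
  show ?thesis
    unfolding cond_prob_def iff path_prob[OF t(1) y] endpoint_prob[OF x y lev] infsum_path_wt[OF xy(1,2)]
    using pos xy by simp
qed

end

section \<open>The chain started from the root: law and centrality\<close>

locale rooted_merw_chain = merw_chain +
  assumes start: "AE \<omega> in P. X 0 \<omega> = root G"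
begin

lemma X_inf_path: "AE \<omega> in P. (\<lambda>n. X n \<omega>) \<in> inf_paths H"
  using start X_edges by eventually_elim (simp add: inf_paths_def)

lemma X_inf_path': "AE \<omega> in P. (\<lambda>n. X n \<omega>) \<in> inf_paths G"
  using X_inf_path inf_paths_support_subset by (auto elim: eventually_mono)

text \<open>Holds for every endpoint in \<open>G\<close>: outside the support \<phi> vanishes and
  the chain almost surely does not go there.\<close>

lemma cylinder_prob:
  assumes s: "s \<in> fin_paths G (root G) y"
  shows "measure P {\<omega> \<in> space P. \<forall>i<length s. X i \<omega> = s ! i} = path_wt G s * \<phi> y"
proof (cases "y \<in> verts H")
  case True
  have "measure P {\<omega> \<in> space P. X 0 \<omega> = root G} = 1"
    using start by (subst P.prob_Collect_eq_1) auto
  then show ?thesis using path_prob[OF s True, of 0] by (simp add: harmonic_root)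
next
  case False
  have "\<phi> y = 0"
    using False fin_pathsD(6)[OF s] harmonic_nonneg[of y] by (auto simp: verts_support)
  have ne: "s \<noteq> []" "last s = y" using fin_pathsD[OF s] by auto
  have "AE \<omega> in P. \<not> (\<forall>i<length s. X i \<omega> = s ! i)"
    using X_support
  proof eventually_elim
    case (elim \<omega>)
    show ?case
    proof
      assume "\<forall>i<length s. X i \<omega> = s ! i"
      then have "X (length s - 1) \<omega> = y" using ne by (simp add: last_conv_nth)
      then show False using elim False by metis
    qed
  qed
  then have "measure P {\<omega> \<in> space P. \<forall>i<length s. X i \<omega> = s ! i} = 0"
    by (subst P.prob_Collect_eq_0) auto
  then show ?thesis using \<open>\<phi> y = 0\<close> by simp
qed

lemma vertex_prob_pos:
  assumes x: "x \<in> verts H"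
  shows "0 < measure P {\<omega> \<in> space P. X (lev G x) \<omega> = x}"
proof -
  have "x \<in> verts G" "0 < \<phi> x" using x by (auto simp: verts_support)
  then obtain s where s: "s \<in> fin_paths G (root G) x" using path_from_root by blast
  have "0 < path_wt G s * \<phi> x" using path_wt_pos[OF s] \<open>0 < \<phi> x\<close> by simp
  also have "\<dots> = measure P {\<omega> \<in> space P. \<forall>i<length s. X i \<omega> = s ! i}"
    by (rule cylinder_prob[OF s, symmetric])
  also have "\<dots> \<le> measure P {\<omega> \<in> space P. X (lev G x) \<omega> = x}"
  proof (rule P.finite_measure_mono)
    have "s ! lev G x = x" "lev G x < length s"
      using nth_lev_root_path[OF s] by auto
    then show "{\<omega> \<in> space P. \<forall>i<length s. X i \<omega> = s ! i} \<subseteq> {\<omega> \<in> space P. X (lev G x) \<omega> = x}"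
      by auto
  qed simp
  finally show ?thesis .
qed

lemmas prob_space_law = prob_space_path_law[OF P.prob_space_axioms X_measurable X_inf_path']
lemmas emeasure_law = emeasure_path_law[OF P.prob_space_axioms X_measurable X_inf_path']
lemmas prob_space_law_H = H.prob_space_path_law[OF P.prob_space_axioms X_measurable X_inf_path]
lemmas emeasure_law_H = H.emeasure_path_law[OF P.prob_space_axioms X_measurable X_inf_path]

lemma space_law [simp]: "space (path_law G P X) = inf_paths G"
  using sets_eq_imp_space_eq[OF sets_path_law[of P X]] by simp

lemma measure_law:
  assumes Q: "{t \<in> inf_paths G. Q t} \<in> sets (path_space G)"
    and "{\<omega> \<in> space P. Q (\<lambda>n. X n \<omega>)} \<in> sets P"
  shows "measure (path_law G P X) {t \<in> inf_paths G. Q t} = measure P {\<omega> \<in> space P. Q (\<lambda>n. X n \<omega>)}"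
proof -
  have "emeasure (path_law G P X) {t \<in> inf_paths G. Q t} =
      emeasure P {\<omega> \<in> space P. (\<lambda>n. X n \<omega>) \<in> {t \<in> inf_paths G. Q t}}"
    by (rule emeasure_law[OF Q])
  also have "\<dots> = emeasure P {\<omega> \<in> space P. Q (\<lambda>n. X n \<omega>)}"
  proof (rule emeasure_eq_AE)
    show "AE \<omega> in P. \<omega> \<in> {\<omega> \<in> space P. (\<lambda>n. X n \<omega>) \<in> {t \<in> inf_paths G. Q t}} \<longleftrightarrow>
        \<omega> \<in> {\<omega> \<in> space P. Q (\<lambda>n. X n \<omega>)}"
      using X_inf_path' by eventually_elim auto
  qed (use assms trajectory_measurable[OF P.prob_space_axioms X_measurable X_inf_path' Q] in auto)
  finally show ?thesis by (simp add: measure_def)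
qed

text \<open>Passes from a chain on an arbitrary probability space to the coordinate process on path
  space, which is the form required by \<open>merw_law\<close>.\<close>

lemma law_chain: "markov_chain (path_law G P X) (verts H) (merw_kernel G \<phi>) (\<lambda>n t. t n)"
proof -
  interpret law: prob_space "path_law G P X" by (rule prob_space_law)
  have meas [measurable]: "(\<lambda>t. t n) \<in> path_law G P X \<rightarrow>\<^sub>M count_space UNIV" for n
    unfolding measurable_cong_sets[OF sets_path_law refl] by (rule coordinate_measurable)
  show ?thesis
    unfolding markov_chain_def
  proof (intro conjI allI impI)
    fix n
    have "(\<lambda>t. t n) -` verts H \<inter> space (path_space G) \<in> sets (path_space G)"
      by (rule measurable_sets[OF coordinate_measurable]) simp
    then have support_sets: "{t \<in> inf_paths G. t n \<in> verts H} \<in> sets (path_space G)"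
      by (simp add: vimage_def Int_def conj_commute)
    show "AE t in path_law G P X. t n \<in> verts H"
    proof (subst law.prob_Collect_eq_1[symmetric])
      have "X n -` verts H \<inter> space P \<in> sets P" by (rule measurable_sets[OF X_measurable]) simp
      then have "{\<omega> \<in> space P. X n \<omega> \<in> verts H} \<in> sets P"
        by (simp add: vimage_def Int_def conj_commute)
      moreover have "measure P {\<omega> \<in> space P. X n \<omega> \<in> verts H} = 1"
        using X_support calculation by (subst P.prob_Collect_eq_1) (auto elim: eventually_mono)
      ultimately show "measure (path_law G P X) {t \<in> space (path_law G P X). t n \<in> verts H} = 1"
        using support_sets by (simp add: measure_law)
    qed (simp add: pred_def support_sets)
  next
    fix n s y assume *: "length s = Suc n \<and> set s \<subseteq> verts H \<and> y \<in> verts H"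
    have 1: "{t \<in> space (path_space G). (\<forall>i\<le>n. t i = s ! i) \<and> t (Suc n) = y} \<in> sets (path_space G)"
      by measurable
    have 2: "{\<omega> \<in> space P. (\<forall>i\<le>n. X i \<omega> = s ! i) \<and> X (Suc n) \<omega> = y} \<in> sets P"
      by measurable
    have 3: "{t \<in> space (path_space G). \<forall>i\<le>n. t i = s ! i} \<in> sets (path_space G)"
      by measurable
    have 4: "{\<omega> \<in> space P. \<forall>i\<le>n. X i \<omega> = s ! i} \<in> sets P"
      by measurable
    show "measure (path_law G P X) {t \<in> space (path_law G P X). (\<forall>i\<le>n. t i = s ! i) \<and> t (Suc n) = y} =
        measure (path_law G P X) {t \<in> space (path_law G P X). \<forall>i\<le>n. t i = s ! i} * merw_kernel G \<phi> (s ! n) y"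
      unfolding space_law measure_law[OF 1[unfolded space_path_space] 2] measure_law[OF 3[unfolded space_path_space] 4]
      using * by (intro history_step) auto
  qed (use prob_space_law meas in auto)
qed

lemma merw_law_path_law:
  assumes "merw_function G \<phi>"
  shows "merw_law G \<phi> (path_law G P X)"
  using assms law_chain by (simp add: merw_law_def merw_def)

text \<open>The trajectory almost surely stays in the support, so restricting its law on
  \<open>G\<close> loses no mass and agrees with the law formed directly on
  \<open>H\<close>.\<close>

lemma restrict_law: "restrict_space (path_law G P X) (inf_paths H) = path_law H P X"
proof (rule measure_eqI)
  show sets: "sets (restrict_space (path_law G P X) (inf_paths H)) = sets (path_law H P X)"
    unfolding H.sets_path_law sets_path_space_support by (rule sets_restrict_space_cong) simp
  fix A assume "A \<in> sets (restrict_space (path_law G P X) (inf_paths H))"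
  then have A: "A \<in> sets (path_space H)" unfolding sets by simp
  moreover have "A \<subseteq> inf_paths H" using sets.sets_into_space[OF A] by simp
  moreover have "inf_paths H \<inter> space (path_law G P X) \<in> sets (path_law G P X)"
    using inf_paths_support_sets inf_paths_support_subset by (simp add: Int_absorb2)
  moreover have "A \<in> sets (path_space G)"
    using A inf_paths_support_sets inf_paths_support_subset unfolding sets_path_space_support
    by (subst (asm) sets_restrict_space_iff) (auto simp: Int_absorb2)
  ultimately show "emeasure (restrict_space (path_law G P X) (inf_paths H)) A = emeasure (path_law H P X) A"
    by (simp add: emeasure_restrict_space emeasure_law emeasure_law_H)
qed

lemma law_H_cylinder:
  assumes s: "s \<in> fin_paths H (root G) y"
  shows "measure (path_law H P X) (cylinder H s) = path_wt G s * \<phi> y"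
proof -
  have y: "y \<in> verts H" using fin_pathsD(6)[OF s] .
  have cyl: "cylinder H s \<in> sets (path_space H)"
    using s by (intro H.cylinder_sets) simp
  have "emeasure (path_law H P X) (cylinder H s) = emeasure P {\<omega> \<in> space P. \<forall>i<length s. X i \<omega> = s ! i}"
    unfolding emeasure_law_H[OF cyl]
  proof (rule emeasure_eq_AE)
    show "AE \<omega> in P. \<omega> \<in> {\<omega> \<in> space P. (\<lambda>n. X n \<omega>) \<in> cylinder H s} \<longleftrightarrow>
        \<omega> \<in> {\<omega> \<in> space P. \<forall>i<length s. X i \<omega> = s ! i}"
      using X_inf_path by eventually_elim (auto simp: cylinder_def)
  qed (use H.trajectory_measurable[OF P.prob_space_axioms X_measurable X_inf_path cyl] in auto)
  then show ?thesis
    using cylinder_prob[of s y] s fin_paths_support[OF y] by (simp add: measure_def)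
qed

lemma central_law: "central_measure H (path_law H P X)"
  unfolding central_measure_def
proof (intro conjI ballI)
  interpret law: prob_space "path_law H P X" by (rule prob_space_law_H)
  show "prob_space (path_law H P X)" by (rule prob_space_law_H)
  show "sets (path_law H P X) = sets (path_space H)" by simp
  fix y assume y: "y \<in> verts H"
  then obtain s where s: "s \<in> fin_paths H (root G) y" using H.path_from_root[OF y] by auto
  have "0 < path_wt G s * \<phi> y"
    using H.path_wt_pos[OF s] y by (simp add: verts_support)
  also have "\<dots> \<le> measure (path_law H P X) {t \<in> inf_paths H. t (lev H y) = y}"
    unfolding law_H_cylinder[OF s, symmetric]
  proof (rule law.finite_measure_mono)
    have "s ! lev G y = y" "lev G y < length s"
      using H.nth_lev_root_path[of s y] s by auto
    then show "cylinder H s \<subseteq> {t \<in> inf_paths H. t (lev H y) = y}"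
      by (auto simp: cylinder_def)
    have "(\<lambda>t. t (lev H y)) -` {y} \<inter> space (path_space H) \<in> sets (path_space H)"
      by (rule measurable_sets[OF H.coordinate_measurable]) simp
    also have "(\<lambda>t. t (lev H y)) -` {y} \<inter> space (path_space H) = {t \<in> inf_paths H. t (lev H y) = y}"
      by auto
    finally show "{t \<in> inf_paths H. t (lev H y) = y} \<in> sets (path_law H P X)" by simp
  qed
  finally show "0 < measure (path_law H P X) {t \<in> inf_paths H. t (lev H y) = y}" .
next
  fix y s t assume "y \<in> verts H" "s \<in> fin_paths H (root H) y" "t \<in> fin_paths H (root H) y"
  \<comment> \<open>Both sides equal \<open>path_wt G s * path_wt G t * \<phi> y\<close>.\<close>
  then show "path_wt H s * measure (path_law H P X) (cylinder H t) = path_wt H t * measure (path_law H P X) (cylinder H s)"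
    by (simp add: law_H_cylinder)
qed

lemma central_chain_law: "central_chain H (path_law H P X) P X"
  unfolding central_chain_def using central_law chain start by auto

end

section \<open>Uniqueness and existence of the law of a MERW\<close>

context harmonic_bratteli
begin

lemma merw_law_chain:
  assumes "merw_law G \<phi> \<mu>"
  shows "rooted_merw_chain G \<phi> \<mu> (\<lambda>n t. t n)" "sets \<mu> = sets (path_space G)"
proof -
  show sets: "sets \<mu> = sets (path_space G)" using assms by (simp add: merw_law_def)
  then have "space \<mu> = inf_paths G" using sets_eq_imp_space_eq[OF sets] by simp
  then show "rooted_merw_chain G \<phi> \<mu> (\<lambda>n t. t n)"
    using assms by unfold_locales (auto simp: merw_law_def merw_def inf_paths_def intro!: AE_I2)
qed

lemma merw_law_cylinder:
  assumes "merw_law G \<phi> \<mu>" "s \<in> fin_paths G (root G) y"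
  shows "measure \<mu> (cylinder G s) = path_wt G s * \<phi> y"
proof -
  interpret rooted_merw_chain G \<phi> \<mu> "\<lambda>n t. t n" by (rule merw_law_chain[OF assms(1)])
  have "space \<mu> = inf_paths G"
    using sets_eq_imp_space_eq[OF merw_law_chain(2)[OF assms(1)]] by simp
  then show ?thesis using cylinder_prob[OF assms(2)] by (simp add: cylinder_def)
qed

text \<open>Two cylinders are nested or disjoint, so together with the empty set they form an
  intersection-stable generator; the cylinder of the root alone is the whole space.\<close>

lemma merw_law_unique:
  assumes "merw_law G \<phi> \<mu>" "merw_law G \<phi> \<nu>"
  shows "\<mu> = \<nu>"
proof -
  let ?C = "{cylinder G s | s y. y \<in> verts G \<and> s \<in> fin_paths G (root G) y}"
  have sigma: "sigma_sets (inf_paths G) (insert {} ?C) = sigma_sets (inf_paths G) ?C"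
    by (rule sigma_sets_eqI) (auto intro: sigma_sets.Empty sigma_sets.Basic)
  have prob: "prob_space \<mu>" "prob_space \<nu>"
    using assms by (auto simp: merw_law_def merw_def markov_chain_def)
  have root: "cylinder G [root G] = inf_paths G"
    by (auto simp: cylinder_def inf_paths_def)
  have root_path: "[root G] \<in> fin_paths G (root G) (root G)"
    by (simp add: fin_paths_single_iff root_verts)
  show ?thesis
  proof (rule measure_eqI_generator_eq_countable[where E = "insert {} ?C" and \<Omega> = "inf_paths G" and A = "{inf_paths G}"])
    show "Int_stable (insert {} ?C)"
    proof (rule Int_stableI)
      have "cylinder G s \<inter> cylinder G t \<in> insert {} ?C"
        if s: "s \<in> fin_paths G (root G) y" and t: "t \<in> fin_paths G (root G) z" and le: "length s \<le> length t" for s t y z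
      proof (cases "\<forall>i<length s. t ! i = s ! i")
        case True
        then have "cylinder G s \<inter> cylinder G t = cylinder G t" using le by (auto simp: cylinder_def)
        then show ?thesis using t fin_pathsD(6)[OF t] by auto
      next
        case False
        then have "cylinder G s \<inter> cylinder G t = {}" using le by (auto simp: cylinder_def)
        then show ?thesis by simp
      qed
      note le_case = this
      have *: "cylinder G s \<inter> cylinder G t \<in> insert {} ?C"
        if s: "s \<in> fin_paths G (root G) y" and t: "t \<in> fin_paths G (root G) z" for s t y z
      proof (cases "length s \<le> length t")
        case True
        then show ?thesis by (rule le_case[OF s t])
      next
        case False
        then have "length t \<le> length s" by simp
        from le_case[OF t s this] show ?thesis by (subst Int_commute)
      qed
      fix A B assume "A \<in> insert {} ?C" "B \<in> insert {} ?C"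
      then consider "A = {} \<or> B = {}" | s y t z where "A = cylinder G s" "s \<in> fin_paths G (root G) y"
          "B = cylinder G t" "t \<in> fin_paths G (root G) z"
        by blast
      then show "A \<inter> B \<in> insert {} ?C"
      proof cases
        case 1
        then show ?thesis by auto
      next
        case 2
        then show ?thesis using *[OF 2(2,4)] by simp
      qed
    qed
    show "insert {} ?C \<subseteq> Pow (inf_paths G)" using cylinder_subset by auto
    show "sets \<mu> = sigma_sets (inf_paths G) (insert {} ?C)" "sets \<nu> = sigma_sets (inf_paths G) (insert {} ?C)"
      using assms unfolding sigma by (simp_all add: merw_law_def sets_path_space)
    show "emeasure \<mu> A = emeasure \<nu> A" if "A \<in> insert {} ?C" for A
    proof (cases "A = {}")
      case False
      with that obtain s y where "A = cylinder G s" "s \<in> fin_paths G (root G) y" by blast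
      then show ?thesis
        using merw_law_cylinder[OF assms(1)] merw_law_cylinder[OF assms(2)] prob
        by (simp add: prob_space.finite_measure finite_measure.emeasure_eq_measure)
    qed simp
    show "{inf_paths G} \<subseteq> insert {} ?C" using root root_path root_verts by auto
    show "emeasure \<mu> a \<noteq> \<infinity>" for a
      using prob(1) by (simp add: prob_space.finite_measure finite_measure.emeasure_finite)
  qed auto
qed

text \<open>The masses prescribed by \<open>cylinder_prob\<close> are realised by
  \<open>random_digits\<close> through a numbering of the vertices. Their consistency under
  extension by one vertex is exactly harmonicity.\<close>

lemma ex_rooted_chain: "\<exists>(P :: real measure) X. rooted_merw_chain G \<phi> P X"
proof -
  define e where "e = from_nat_into (verts G)"
  have e: "bij_betw e UNIV (verts G)"
    unfolding e_def by (rule bij_betw_from_nat_into[OF countable_verts infinite_verts])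
  have e_verts: "e i \<in> verts G" for i using e by (auto simp: bij_betw_def)
  \<comment> \<open>Lists that are not paths from the root get mass 0, so the digits may range over
    all vertices; the empty list gets total mass 1.\<close>
  define b where "b s = (if s = [] then 1 else if s \<in> fin_paths G (root G) (last s) then path_wt G s * \<phi> (last s) else 0)" for s
  define a where "a s = b (map e s)" for s
  have b_nonneg: "0 \<le> b s" for s
  proof -
    have "0 \<le> path_wt G s * \<phi> (last s)" if "s \<in> fin_paths G (root G) (last s)"
      using path_wt_pos[OF that] harmonic_nonneg[OF fin_pathsD(6)[OF that]] by simp
    then show ?thesis by (simp add: b_def)
  qed
  \<comment> \<open>The last vertex must be in the support, because the kernel divides by its value
    of \<phi>.\<close>
  have b_snoc: "b (s @ [y]) = b s * merw_kernel G \<phi> (last s) y" if "s \<noteq> []" "last s \<in> verts H" for s y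
    using that edge_verts(2) by (auto simp: b_def fin_paths_snoc_iff merw_kernel_def path_wt_snoc verts_support)
  have b_sum: "((\<lambda>y. b (s @ [y])) has_sum b s) (verts G)" for s
  proof (cases "s = []")
    case True
    have "((\<lambda>y. b [y]) has_sum b [root G]) {root G}" by (rule has_sum_finiteI) auto
    moreover have "b [root G] = 1" by (simp add: b_def fin_paths_single_iff root_verts harmonic_root)
    ultimately have "((\<lambda>y. b [y]) has_sum 1) {root G}" by simp
    also have "((\<lambda>y. b [y]) has_sum 1) {root G} \<longleftrightarrow> ((\<lambda>y. b [y]) has_sum 1) (verts G)"
      by (rule has_sum_cong_neutral) (auto simp: b_def fin_paths_single_iff root_verts)
    finally show ?thesis using True by (simp add: b_def)
  next
    case s: False
    show ?thesis
    proof (cases "s \<in> fin_paths G (root G) (last s)")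
      case True
      have "((\<lambda>y. path_wt G s * (wt G (last s) y * \<phi> y)) has_sum path_wt G s * \<phi> (last s)) {y. (last s, y) \<in> edges G}"
        by (rule has_sum_cmult_right[OF harmonic_sum[OF fin_pathsD(6)[OF True]]])
      also have "?this \<longleftrightarrow> ((\<lambda>y. b (s @ [y])) has_sum path_wt G s * \<phi> (last s)) (verts G)"
        using s True edge_verts(2)
        by (intro has_sum_cong_neutral) (auto simp: b_def fin_paths_snoc_iff path_wt_snoc)
      finally show ?thesis using s True by (simp add: b_def)
    next
      case False
      then have "b (s @ [y]) = 0" for y using s by (simp add: b_def fin_paths_snoc_iff)
      then show ?thesis using s False by (simp add: b_def)
    qed
  qed
  have a_sums: "(\<lambda>i. a (s @ [i])) sums a s" for s
  proof -
    have "((\<lambda>i. b (map e s @ [e i])) has_sum b (map e s)) UNIV"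
      using b_sum[of "map e s"] has_sum_reindex_bij_betw[OF e, of "\<lambda>y. b (map e s @ [y])"] by simp
    then show ?thesis unfolding a_def by (auto dest: has_sum_imp_sums)
  qed
  obtain P :: "real measure" and D :: "nat \<Rightarrow> real \<Rightarrow> nat"
    where P: "prob_space P" and D [measurable]: "\<And>n. D n \<in> P \<rightarrow>\<^sub>M count_space UNIV"
      and PD: "\<And>s. measure P {u \<in> space P. \<forall>i<length s. D i u = s ! i} = a s"
  proof (rule random_digits[of a])
    show "0 \<le> a s" for s by (simp add: a_def b_nonneg)
    show "a [] = 1" by (simp add: a_def b_def)
  qed (use a_sums in auto)
  interpret P: prob_space P by (rule P)
  define X where "X n u = e (D n u)" for n u
  have X [measurable]: "X n \<in> P \<rightarrow>\<^sub>M count_space UNIV" for n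
    unfolding X_def by (rule measurable_compose[OF D]) simp
  have PX: "measure P {u \<in> space P. \<forall>i<length s. X i u = s ! i} = b s" if s: "set s \<subseteq> verts G" for s
  proof -
    let ?t = "map (inv e) s"
    have inv: "e (inv e y) = y" if "y \<in> verts G" for y
      using e that by (metis bij_betw_def f_inv_into_f)
    have inj: "inj e" using e by (simp add: bij_betw_def)
    have "X i u = s ! i \<longleftrightarrow> D i u = ?t ! i" if "i < length s" for i u
    proof -
      have mem: "s ! i \<in> verts G" using s nth_mem[OF that] by blast
      have "e (D i u) = s ! i \<longleftrightarrow> D i u = inv e (s ! i)"
        using inv[OF mem] inv_f_f[OF inj] by metis
      then show ?thesis using that by (simp add: X_def)
    qed
    then have "{u \<in> space P. \<forall>i<length s. X i u = s ! i} = {u \<in> space P. \<forall>i<length ?t. D i u = ?t ! i}"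
      by auto
    moreover have "map e ?t = s" using inv s by (induction s) auto
    ultimately show ?thesis using PD[of ?t] by (simp add: a_def)
  qed
  have X_verts: "X n u \<in> verts G" for n u by (simp add: X_def e_verts)
  \<comment> \<open>Lists of mass 0 are almost surely not followed. A list of positive mass ends at
    a vertex with \<phi> nonzero, which keeps the chain in the support.\<close>
  have zero: "AE u in P. \<forall>s\<in>{s \<in> lists (verts G). b s = 0}. \<not> (\<forall>i<length s. X i u = s ! i)"
  proof (rule AE_ball_countable')
    fix s assume "s \<in> {s \<in> lists (verts G). b s = 0}"
    then have "measure P {u \<in> space P. \<forall>i<length s. X i u = s ! i} = 0" using PX[of s] by auto
    then show "AE u in P. \<not> (\<forall>i<length s. X i u = s ! i)"
      by (subst P.prob_Collect_eq_0[symmetric]) auto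
  next
    show "countable {s \<in> lists (verts G). b s = 0}"
      by (rule countable_subset[of _ "lists (verts G)"]) (auto intro: countable_lists countable_verts)
  qed
  have "markov_chain P (verts H) (merw_kernel G \<phi>) X"
    unfolding markov_chain_def
  proof (intro conjI allI impI)
    show "AE u in P. X n u \<in> verts H" for n
      using zero
    proof eventually_elim
      case (elim u)
      let ?s = "map (\<lambda>i. X i u) [0..<Suc n]"
      have "?s \<in> lists (verts G)" using X_verts by (auto simp: in_lists_conv_set)
      moreover have "\<forall>i<length ?s. X i u = ?s ! i" by (simp del: upt_Suc)
      ultimately have "b ?s \<noteq> 0" using elim by blast
      moreover have "last ?s = X n u" by simp
      ultimately have "\<phi> (X n u) \<noteq> 0" by (auto simp: b_def split: if_splits)
      then show ?case using X_verts[of n u] harmonic_nonneg[of "X n u"] by (simp add: verts_support)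
    qed
    fix n s y assume *: "length s = Suc n \<and> set s \<subseteq> verts H \<and> y \<in> verts H"
    then have "s \<noteq> []" by auto
    with * have ne: "s \<noteq> []" "last s = s ! n" by (simp_all add: last_conv_nth)
    have last: "last s \<in> verts H" using * ne(1) by auto
    have sub: "set s \<subseteq> verts G" "set (s @ [y]) \<subseteq> verts G" using * by (auto simp: verts_support)
    have "{u \<in> space P. (\<forall>i\<le>n. X i u = s ! i) \<and> X (Suc n) u = y} =
        {u \<in> space P. \<forall>i<length (s @ [y]). X i u = (s @ [y]) ! i}"
      using * by (auto simp: nth_append less_Suc_eq_le le_Suc_eq)
    moreover have "{u \<in> space P. \<forall>i\<le>n. X i u = s ! i} = {u \<in> space P. \<forall>i<length s. X i u = s ! i}"
      using * by (auto simp: less_Suc_eq_le)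
    ultimately show "measure P {u \<in> space P. (\<forall>i\<le>n. X i u = s ! i) \<and> X (Suc n) u = y} =
        measure P {u \<in> space P. \<forall>i\<le>n. X i u = s ! i} * merw_kernel G \<phi> (s ! n) y"
      using PX[OF sub(1)] PX[OF sub(2)] b_snoc[OF ne(1) last] ne(2) by simp
  qed (use P in auto)
  moreover have "AE u in P. X 0 u = root G"
  proof -
    have "measure P {u \<in> space P. X 0 u = root G} = 1"
      using PX[of "[root G]"] root_verts by (simp add: b_def fin_paths_single_iff harmonic_root)
    then show ?thesis by (subst (asm) P.prob_Collect_eq_1) auto
  qed
  ultimately have "rooted_merw_chain G \<phi> P X" by unfold_locales
  then show ?thesis by blast
qed

lemma merw_law_exists:
  assumes "merw_function G \<phi>"
  shows "\<exists>\<mu>. merw_law G \<phi> \<mu>"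
proof -
  obtain P :: "real measure" and X where "rooted_merw_chain G \<phi> P X" using ex_rooted_chain by blast
  then show ?thesis using rooted_merw_chain.merw_law_path_law[OF _ assms] by blast
qed

end

section \<open>The Martin boundary\<close>

locale martin_embedded = finite_bratteli G for G :: "'a wbd" +
  fixes \<epsilon> :: "'a \<Rightarrow> real" and \<iota> :: "'a \<Rightarrow> 'c::complete_space"
  assumes eps_pos: "x \<in> verts G \<Longrightarrow> \<epsilon> x > 0" and eps_summable: "\<epsilon> summable_on verts G"
    and emb: "martin_embedding G \<epsilon> \<iota>"
begin

definition dist_term :: "'a \<Rightarrow> 'a \<Rightarrow> 'a \<Rightarrow> real" where
  "dist_term x y z = \<epsilon> x *
     (\<bar>martin_kernel G x y - martin_kernel G x z\<bar>
      + \<bar>of_bool (x = y) - of_bool (x = z)\<bar>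
      + \<bar>of_bool (lev G x = lev G y) - of_bool (lev G x = lev G z)\<bar>) / (martin_bound G x + 1)"

lemma dist_eq: "y \<in> verts G \<Longrightarrow> z \<in> verts G \<Longrightarrow> dist (\<iota> y) (\<iota> z) = (\<Sum>\<^sub>\<infinity>x\<in>verts G. dist_term x y z)"
  using emb by (simp add: martin_embedding_def martin_dist_def dist_term_def)

lemma dist_term_nonneg: "x \<in> verts G \<Longrightarrow> 0 \<le> dist_term x y z"
  using eps_pos[of x] martin_bound_pos[of x]
  by (auto simp: dist_term_def intro!: divide_nonneg_nonneg mult_nonneg_nonneg)

lemma dist_term_le:
  assumes "x \<in> verts G" "y \<in> verts G" "z \<in> verts G"
  shows "dist_term x y z \<le> 2 * \<epsilon> x"
proof -
  let ?C = "martin_bound G x"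
  have "\<bar>martin_kernel G x y - martin_kernel G x z\<bar> \<le> ?C"
    using martin_kernel_le[OF assms(1,2)] martin_kernel_le[OF assms(1,3)]
      martin_kernel_nonneg[of x y] martin_kernel_nonneg[of x z] by linarith
  \<comment> \<open>The kernel difference is at most \<open>?C\<close> and each Kronecker difference
    at most 1, so the total is at most \<open>?C + 2\<close>.\<close>
  then have "\<bar>martin_kernel G x y - martin_kernel G x z\<bar>
      + \<bar>of_bool (x = y) - of_bool (x = z)\<bar>
      + \<bar>of_bool (lev G x = lev G y) - of_bool (lev G x = lev G z)\<bar> \<le> 2 * (?C + 1)" (is "?s \<le> _")
    using martin_bound_pos[OF assms(1)] by (auto simp: of_bool_def)
  then have "\<epsilon> x * ?s \<le> \<epsilon> x * (2 * (?C + 1))"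
    using eps_pos[OF assms(1)] by (intro mult_left_mono) auto
  then show ?thesis
    using martin_bound_pos[OF assms(1)] by (simp add: dist_term_def field_simps)
qed

lemma dist_term_summable:
  assumes "y \<in> verts G" "z \<in> verts G" "A \<subseteq> verts G"
  shows "(\<lambda>x. dist_term x y z) summable_on A"
proof (rule summable_on_comparison_test)
  show "(\<lambda>x. 2 * \<epsilon> x) summable_on A"
    by (intro summable_on_cmult_right summable_on_subset_banach[OF eps_summable assms(3)])
qed (use assms dist_term_le dist_term_nonneg in auto)

lemma dist_term_le_dist:
  assumes "x \<in> verts G" "y \<in> verts G" "z \<in> verts G"
  shows "dist_term x y z \<le> dist (\<iota> y) (\<iota> z)"
proof -
  have "sum (\<lambda>x. dist_term x y z) {x} \<le> dist (\<iota> y) (\<iota> z)"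
    unfolding dist_eq[OF assms(2,3)]
    by (rule finite_sum_le_infsum) (use assms dist_term_summable dist_term_nonneg in auto)
  then show ?thesis by simp
qed

lemma kernel_lipschitz:
  assumes "x \<in> verts G" "y \<in> verts G" "z \<in> verts G"
  shows "\<bar>martin_kernel G x y - martin_kernel G x z\<bar> \<le> (martin_bound G x + 1) / \<epsilon> x * dist (\<iota> y) (\<iota> z)"
proof -
  have "\<epsilon> x * \<bar>martin_kernel G x y - martin_kernel G x z\<bar> / (martin_bound G x + 1) \<le> dist_term x y z"
    unfolding dist_term_def using eps_pos[OF assms(1)] martin_bound_pos[OF assms(1)]
    by (intro divide_right_mono mult_left_mono) auto
  also have "\<dots> \<le> dist (\<iota> y) (\<iota> z)" by (rule dist_term_le_dist[OF assms])
  finally show ?thesis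
    using eps_pos[OF assms(1)] martin_bound_pos[OF assms(1)] by (simp add: field_simps)
qed

text \<open>The Kronecker part of the summand with x = y already separates y from any other
  vertex.\<close>

lemma inj_embedding: "inj_on \<iota> (verts G)"
proof (rule inj_onI, rule ccontr)
  fix y z assume yz: "y \<in> verts G" "z \<in> verts G" "\<iota> y = \<iota> z" "y \<noteq> z"
  have "0 < dist_term y y z"
    unfolding dist_term_def using eps_pos[OF yz(1)] martin_bound_pos[OF yz(1)] yz(4)
    by (intro divide_pos_pos mult_pos_pos) (auto intro: add_nonneg_pos add_pos_nonneg)
  then show False using dist_term_le_dist[of y y z] yz by simp
qed

text \<open>For any fixed vertex \<open>x\<close> of level \<open>n\<close>, the level part of its
  summand contributes \<epsilon> x / (C_x + 1) to the distance, uniformly in both points.\<close>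

lemma level_separated: "\<exists>\<delta>>0. \<forall>y\<in>level G n. \<forall>z\<in>verts G - level G n. \<delta> \<le> dist (\<iota> y) (\<iota> z)"
proof -
  obtain x where x: "x \<in> verts G" "lev G x = n" using level_nonempty[of n] by (auto simp: level_def)
  let ?d = "\<epsilon> x / (martin_bound G x + 1)"
  have "?d \<le> dist (\<iota> y) (\<iota> z)" if "y \<in> level G n" "z \<in> verts G - level G n" for y z
  proof -
    have yz: "y \<in> verts G" "z \<in> verts G" "lev G y = n" "lev G z \<noteq> n" using that by (auto simp: level_def)
    have "?d = \<epsilon> x * 1 / (martin_bound G x + 1)" by simp
    also have "\<dots> \<le> dist_term x y z"
      unfolding dist_term_def using eps_pos[OF x(1)] martin_bound_pos[OF x(1)] yz x(2)
      by (intro divide_right_mono mult_left_mono) auto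
    also have "\<dots> \<le> dist (\<iota> y) (\<iota> z)" by (rule dist_term_le_dist) (use x yz in auto)
    finally show ?thesis .
  qed
  then show ?thesis
    using eps_pos[OF x(1)] martin_bound_pos[OF x(1)] by (intro exI[of _ ?d]) auto
qed

text \<open>A finite set \<open>F\<close> carries all but less than \<open>e / 4\<close> of the mass
  of \<epsilon>. The colour of a vertex records, for each x in \<open>F\<close>, the kernel rounded
  to mesh \<eta> and the two Kronecker bits; boundedness of the kernel leaves finitely many
  colours.\<close>

lemma martin_totally_bounded:
  assumes e: "0 < (e :: real)"
  shows "\<exists>c N. (\<forall>z\<in>verts G. c z < (N::nat)) \<and>
    (\<forall>y\<in>verts G. \<forall>z\<in>verts G. c y = c z \<longrightarrow> dist (\<iota> y) (\<iota> z) < e)"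
proof -
  let ?V = "verts G"
  define S where "S = (\<Sum>\<^sub>\<infinity>x\<in>?V. \<epsilon> x)"
  have S: "(\<epsilon> has_sum S) ?V" unfolding S_def by (rule has_sum_infsum[OF eps_summable])
  then have "\<forall>\<^sub>F F in finite_subsets_at_top ?V. dist (sum \<epsilon> F) S < e / 4"
    unfolding has_sum_def by (rule tendstoD) (use e in simp)
  then obtain F where F: "finite F" "F \<subseteq> ?V" "dist (sum \<epsilon> F) S < e / 4"
    unfolding eventually_finite_subsets_at_top by blast
  have S0: "0 \<le> S" unfolding S_def using eps_pos by (intro infsum_nonneg less_imp_le) auto
  have F_le: "sum \<epsilon> F \<le> S"
    by (rule finite_sum_le_has_sum[OF S]) (use F eps_pos in \<open>auto intro: less_imp_le\<close>)
  have tail: "(\<Sum>\<^sub>\<infinity>x\<in>?V - F. \<epsilon> x) = S - sum \<epsilon> F"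
    unfolding S_def using F eps_summable by (subst infsum_Diff) auto
  \<comment> \<open>Makes the part over \<open>F\<close> at most \<open>S * \<eta>\<close>, hence at
    most \<open>e / 2\<close>. The rest is below \<open>e / 2\<close>, because each summand is at
    most 2 * \<epsilon> x.\<close>
  define \<eta> where "\<eta> = e / (2 * (S + 1))"
  have \<eta>: "0 < \<eta>" using e S0 by (simp add: \<eta>_def)
  define c' where "c' z = (\<lambda>x\<in>F. (\<lfloor>martin_kernel G x z / \<eta>\<rfloor>, x = z, lev G x = lev G z))" for z
  let ?R = "PiE F (\<lambda>x. {0..\<lfloor>martin_bound G x / \<eta>\<rfloor>} \<times> (UNIV :: (bool \<times> bool) set))"
  have fin_R: "finite ?R" using F(1) by (intro finite_PiE) auto
  have c'_R: "c' z \<in> ?R" if "z \<in> ?V" for z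
    unfolding c'_def using that F(2) martin_kernel_nonneg martin_kernel_le \<eta>
    by (intro restrict_PiE_iff[THEN iffD2] ballI) (auto intro!: floor_mono divide_right_mono)
  obtain f :: "('a \<Rightarrow> int \<times> bool \<times> bool) \<Rightarrow> nat" and N where f: "f ` ?R = {i. i < N}" "inj_on f ?R"
    using finite_imp_inj_to_nat_seg[OF fin_R] by blast
  have close: "dist (\<iota> y) (\<iota> z) < e" if yz: "y \<in> ?V" "z \<in> ?V" "f (c' y) = f (c' z)" for y z
  proof -
    have "c' y = c' z" using f(2) c'_R yz by (auto dest: inj_onD)
    then have same: "\<lfloor>martin_kernel G x y / \<eta>\<rfloor> = \<lfloor>martin_kernel G x z / \<eta>\<rfloor>" "(x = y) = (x = z)"
        "(lev G x = lev G y) = (lev G x = lev G z)" if "x \<in> F" for x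
      using that by (auto simp: c'_def fun_eq_iff split: if_splits dest!: spec[of _ x])
    have term_F: "dist_term x y z \<le> \<epsilon> x * \<eta>" if x: "x \<in> F" for x
    proof -
      have xV: "x \<in> ?V" using x F(2) by blast
      have "\<bar>martin_kernel G x y / \<eta> - martin_kernel G x z / \<eta>\<bar> \<le> 1"
        using same(1)[OF x] by linarith
      then have "\<bar>martin_kernel G x y - martin_kernel G x z\<bar> \<le> \<eta>"
        using \<eta> by (simp add: field_simps abs_le_iff)
      then have "dist_term x y z \<le> \<epsilon> x * \<eta> / (martin_bound G x + 1)"
        unfolding dist_term_def same(2,3)[OF x]
        using eps_pos[OF xV] martin_bound_pos[OF xV]
        by (intro divide_right_mono mult_left_mono) auto
      also have "\<dots> \<le> \<epsilon> x * \<eta> / 1"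
        using eps_pos[OF xV] martin_bound_pos[OF xV] \<eta> by (intro divide_left_mono) auto
      finally show ?thesis by simp
    qed
    have "dist (\<iota> y) (\<iota> z) = (\<Sum>\<^sub>\<infinity>x\<in>F \<union> (?V - F). dist_term x y z)"
      using F(2) by (simp add: dist_eq[OF yz(1,2)] Un_absorb1)
    also have "\<dots> = (\<Sum>\<^sub>\<infinity>x\<in>F. dist_term x y z) + (\<Sum>\<^sub>\<infinity>x\<in>?V - F. dist_term x y z)"
      using F(2) by (intro infsum_Un_disjoint dist_term_summable yz) auto
    also have "(\<Sum>\<^sub>\<infinity>x\<in>F. dist_term x y z) = (\<Sum>x\<in>F. dist_term x y z)"
      using F(1) by simp
    also have "(\<Sum>x\<in>F. dist_term x y z) \<le> (\<Sum>x\<in>F. \<epsilon> x * \<eta>)" by (intro sum_mono term_F)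
    also have "\<dots> = sum \<epsilon> F * \<eta>" by (simp add: sum_distrib_right)
    also have "\<dots> \<le> S * \<eta>" using F_le \<eta> by (intro mult_right_mono) auto
    also have "S * \<eta> \<le> e / 2" using S0 e by (simp add: \<eta>_def field_simps)
    also have "(\<Sum>\<^sub>\<infinity>x\<in>?V - F. dist_term x y z) \<le> (\<Sum>\<^sub>\<infinity>x\<in>?V - F. 2 * \<epsilon> x)"
      using yz dist_term_le
      by (intro infsum_mono dist_term_summable summable_on_cmult_right summable_on_subset_banach[OF eps_summable]) auto
    also have "\<dots> = 2 * (S - sum \<epsilon> F)"
      using tail by (subst infsum_cmult_right') auto
    also have "\<dots> < e / 2"
    proof -
      have "\<bar>sum \<epsilon> F - S\<bar> = S - sum \<epsilon> F" using F_le by (subst abs_of_nonpos) auto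
      then show ?thesis using F(3) by (simp add: dist_real_def)
    qed
    finally show ?thesis by simp
  qed
  show ?thesis
  proof (intro exI conjI ballI impI)
    show "f (c' z) < N" if "z \<in> ?V" for z using f(1) c'_R[OF that] by blast
  qed (use close in auto)
qed

text \<open>\<open>martin_kernel_ext\<close> is a limit along vertices. It is replaced by one
  continuous bounded function on the whole closure, so that it can serve as a test function.\<close>

lemma kernel_extension:
  assumes x: "x \<in> verts G"
  obtains g where "continuous_on (closure (\<iota> ` verts G)) g"
    "\<And>z. z \<in> verts G \<Longrightarrow> g (\<iota> z) = martin_kernel G x z"
    "\<And>w. w \<in> closure (\<iota> ` verts G) \<Longrightarrow> \<bar>g w\<bar> \<le> martin_bound G x"
    "\<And>\<zeta>. \<zeta> \<in> martin_boundary G \<iota> \<Longrightarrow> martin_kernel_ext G \<iota> x \<zeta> = g \<zeta>"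
proof -
  let ?V = "verts G"
  let ?k = "\<lambda>w. martin_kernel G x (the_inv_into ?V \<iota> w)"
  have inv: "the_inv_into ?V \<iota> (\<iota> z) = z" if "z \<in> ?V" for z
    by (rule the_inv_into_f_f[OF inj_embedding that])
  have "((martin_bound G x + 1) / \<epsilon> x)-lipschitz_on (\<iota> ` ?V) ?k"
  proof (rule lipschitz_onI)
    fix v w assume "v \<in> \<iota> ` ?V" "w \<in> \<iota> ` ?V"
    then show "dist (?k v) (?k w) \<le> (martin_bound G x + 1) / \<epsilon> x * dist v w"
      using kernel_lipschitz[OF x] by (auto simp: inv dist_real_def)
  qed (use eps_pos[OF x] martin_bound_pos[OF x] in simp)
  then obtain g where g: "((martin_bound G x + 1) / \<epsilon> x)-lipschitz_on (closure (\<iota> ` ?V)) g" "\<forall>w\<in>\<iota> ` ?V. g w = ?k w"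
    using lipschitz_extend_closure by blast
  have cont: "continuous_on (closure (\<iota> ` ?V)) g" by (rule lipschitz_on_continuous_on[OF g(1)])
  have gK: "g (\<iota> z) = martin_kernel G x z" if "z \<in> ?V" for z using g(2) that inv by simp
  show thesis
  proof (rule that[OF cont gK])
    fix w assume "w \<in> closure (\<iota> ` ?V)"
    moreover have "norm (g v) \<le> martin_bound G x" if "v \<in> \<iota> ` ?V" for v
      using that gK martin_kernel_le[OF x] martin_kernel_nonneg by auto
    ultimately show "\<bar>g w\<bar> \<le> martin_bound G x"
      using continuous_on_closure_norm_le[OF cont] by (simp add: real_norm_def)
  next
    fix \<zeta> assume \<zeta>: "\<zeta> \<in> martin_boundary G \<iota>"
    \<comment> \<open>Each vertex image lies in the closure of its own level. A boundary point is
      thus in the closure of the vertices but not a vertex, hence a limit point, which makes the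
      limit well determined.\<close>
    have notin: "\<zeta> \<notin> \<iota> ` ?V"
    proof
      assume "\<zeta> \<in> \<iota> ` ?V"
      then obtain z where "z \<in> ?V" "\<zeta> = \<iota> z" by blast
      then have "\<zeta> \<in> closure (\<iota> ` level G (lev G z))"
        using closure_subset[of "\<iota> ` level G (lev G z)"] by (auto simp: level_def)
      then show False using \<zeta> by (auto simp: martin_boundary_def)
    qed
    have cl: "\<zeta> \<in> closure (\<iota> ` ?V)" using \<zeta> by (simp add: martin_boundary_def)
    then have "\<zeta> islimpt \<iota> ` ?V" using notin by (simp add: closure_def)
    then have nontriv: "at \<zeta> within \<iota> ` ?V \<noteq> bot" by (simp add: trivial_limit_within)
    have "(g \<longlongrightarrow> g \<zeta>) (at \<zeta> within closure (\<iota> ` ?V))"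
      using cont cl by (auto simp: continuous_on_def)
    then have "(g \<longlongrightarrow> g \<zeta>) (at \<zeta> within \<iota> ` ?V)"
      by (rule tendsto_within_subset) (rule closure_subset)
    moreover have "\<forall>\<^sub>F w in at \<zeta> within \<iota> ` ?V. g w = ?k w"
      using g(2) by (auto simp: eventually_at_filter intro!: always_eventually)
    ultimately have "(?k \<longlongrightarrow> g \<zeta>) (at \<zeta> within \<iota> ` ?V)"
      by (rule Lim_transform_eventually)
    then show "martin_kernel_ext G \<iota> x \<zeta> = g \<zeta>"
      unfolding martin_kernel_ext_def by (rule tendsto_Lim[OF nontriv])
  qed
qed

section \<open>Level measures and their limits on the vertices with the boundary\<close>

abbreviation "B \<equiv> martin_points G \<iota>"

lemma martin_boundary_borel: "martin_boundary G \<iota> \<in> sets borel"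
  unfolding martin_boundary_def by (intro sets.Diff sets.countable_UN) auto

lemma martin_points_borel: "B \<in> sets borel"
proof -
  have "\<iota> ` verts G \<in> sets borel"
  proof (rule sets.countable)
    show "{w} \<in> sets borel" for w :: 'c by (rule borel_closed) simp
    show "countable (\<iota> ` verts G)" by (rule countable_image[OF countable_verts])
  qed
  then show ?thesis unfolding martin_points_def using martin_boundary_borel by (rule sets.Un)
qed

lemma space_martin_borel [simp]: "space (martin_borel G \<iota>) = B"
  by (simp add: martin_borel_def space_restrict_space)

lemma martin_points_closure: "B \<subseteq> closure (\<iota> ` verts G)"
  by (auto simp: martin_points_def martin_boundary_def intro: closure_subset[THEN subsetD])

lemma martin_boundary_sets: "martin_boundary G \<iota> \<in> sets (martin_borel G \<iota>)"
  using martin_boundary_borel martin_points_borel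
  by (auto simp: martin_borel_def sets_restrict_space_iff martin_points_def)

lemma martin_boundaryI:
  assumes "z \<in> closure (\<iota> ` verts G)" "\<And>n. z \<notin> closure (\<iota> ` level G n)"
  shows "z \<in> martin_boundary G \<iota>"
  using assms by (simp add: martin_boundary_def)

definition level_prob :: "nat \<Rightarrow> 'a measure" where
  "level_prob n = point_measure (level G n) (\<lambda>y. dim G (root G) y / dim_level G (root G) n)"

lemma space_level_prob [simp]: "space (level_prob n) = level G n"
  and sets_level_prob [simp]: "sets (level_prob n) = Pow (level G n)"
  by (simp_all add: level_prob_def space_point_measure sets_point_measure)

lemma nn_integral_level_prob:
  "(\<integral>\<^sup>+y. f y \<partial>level_prob n) =
    (\<integral>\<^sup>+y. dim G (root G) y / dim_level G (root G) n * f y \<partial>count_space (level G n))"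
  unfolding level_prob_def point_measure_def by (subst nn_integral_density) auto

lemma prob_space_level_prob: "prob_space (level_prob n)"
proof (rule prob_spaceI)
  have "emeasure (level_prob n) (space (level_prob n)) = (\<integral>\<^sup>+y. 1 \<partial>level_prob n)" by simp
  also have "\<dots> = (\<integral>\<^sup>+y. dim G (root G) y / dim_level G (root G) n \<partial>count_space (level G n))"
    unfolding nn_integral_level_prob by simp
  also have "\<dots> = dim_level G (root G) n / dim_level G (root G) n"
    by (simp add: nn_integral_divide dim_level_eq)
  also have "\<dots> = 1"
    using dim_level_root_pos[of n] fin[of n] by (intro ennreal_divide_self) auto
  finally show "emeasure (level_prob n) (space (level_prob n)) = 1" .
qed

lemma embedding_measurable: "\<iota> \<in> level_prob n \<rightarrow>\<^sub>M martin_borel G \<iota>"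
  by (rule measurable_discrete) (auto simp: level_def martin_points_def)

lemma level_measure_eq: "level_measure G \<iota> n = distr (level_prob n) (martin_borel G \<iota>) \<iota>"
  by (simp add: level_measure_def level_prob_def)

lemma prob_space_level_measure: "prob_space (level_measure G \<iota> n)"
  unfolding level_measure_eq by (rule prob_space.prob_space_distr[OF prob_space_level_prob embedding_measurable])

lemma sets_level_measure [simp]: "sets (level_measure G \<iota> n) = sets (martin_borel G \<iota>)"
  by (simp add: level_measure_eq)

lemma integral_level_measure:
  fixes f :: "'c \<Rightarrow> real"
  assumes "f \<in> borel_measurable (martin_borel G \<iota>)"
  shows "(\<integral>z. f z \<partial>level_measure G \<iota> n) = (\<integral>y. f (\<iota> y) \<partial>level_prob n)"
  unfolding level_measure_eq by (rule integral_distr[OF embedding_measurable assms])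

text \<open>The weight of y under \<open>level_prob\<close> contains
  \<open>dim G (root G) y\<close>, which cancels the denominator of the kernel.\<close>

lemma phi_level_eq_integral: "phi_level G n x = (\<integral>y. martin_kernel G x y \<partial>level_prob n)" if x: "x \<in> verts G"
proof -
  have "(\<integral>\<^sup>+y. ennreal (martin_kernel G x y) \<partial>level_prob n) =
      (\<integral>\<^sup>+y. dim G x y / dim_level G (root G) n \<partial>count_space (level G n))"
    unfolding nn_integral_level_prob
  proof (rule nn_integral_cong)
    fix y assume "y \<in> space (count_space (level G n))"
    then have y: "y \<in> verts G" by (simp add: level_def)
    have "ennreal (martin_kernel G x y) = dim G x y / dim G (root G) y"
      unfolding martin_kernel_def using dim_root_pos[OF y] dim_root_finite[OF y] dim_finite[OF x y] enn2real_dim_root_pos[OF y]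
      by (subst divide_ennreal[symmetric]) auto
    then show "dim G (root G) y / dim_level G (root G) n * ennreal (martin_kernel G x y) =
        dim G x y / dim_level G (root G) n"
      using dim_root_pos[OF y] dim_root_finite[OF y]
      by (simp add: ennreal_times_divide ennreal_divide_times mult.commute ennreal_mult_divide_eq)
  qed
  also have "\<dots> = dim_level G x n / dim_level G (root G) n"
    by (simp add: nn_integral_divide dim_level_eq)
  also have "\<dots> = ennreal (phi_level G n x)"
    unfolding phi_level_def using dim_level_finite[OF x, of n] fin[of n] enn2real_dim_level_root_pos[of n]
    by (subst divide_ennreal[symmetric]) auto
  finally have nn: "(\<integral>\<^sup>+y. ennreal (martin_kernel G x y) \<partial>level_prob n) = ennreal (phi_level G n x)" .
  have "(\<integral>y. martin_kernel G x y \<partial>level_prob n) = enn2real (\<integral>\<^sup>+y. ennreal (martin_kernel G x y) \<partial>level_prob n)"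
    by (rule integral_eq_nn_integral) (auto intro!: measurable_discrete martin_kernel_nonneg)
  then show ?thesis by (simp add: nn phi_level_nonneg)
qed

text \<open>A tent function of the distance to level \<open>n\<close>, whose width is the separation
  from \<open>level_separated\<close>, vanishes at every vertex of another level while being 1 on
  the closure of level \<open>n\<close>.\<close>

lemma level_cutoff:
  obtains h :: "'c \<Rightarrow> real" and L where "L-lipschitz_on UNIV h" "\<And>z. 0 \<le> h z" "\<And>z. h z \<le> 1"
    "\<And>z. z \<in> closure (\<iota> ` level G n) \<Longrightarrow> h z = 1"
    "\<And>m. n < m \<Longrightarrow> (\<integral>y. h (\<iota> y) \<partial>level_prob m) = 0"
proof -
  obtain \<delta> where \<delta>: "\<delta> > 0" "\<And>y z. y \<in> level G n \<Longrightarrow> z \<in> verts G - level G n \<Longrightarrow> \<delta> \<le> dist (\<iota> y) (\<iota> z)"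
    using level_separated[of n] by blast
  let ?A = "\<iota> ` level G n"
  have ne: "?A \<noteq> {}" using level_nonempty by simp
  define h where "h z = max 0 (1 - infdist z ?A / \<delta>)" for z
  show thesis
  proof (rule that[of "1 / \<delta>" h])
    show "(1 / \<delta>)-lipschitz_on UNIV h"
    proof (rule lipschitz_onI)
      fix x y :: 'c
      have "\<bar>infdist x ?A - infdist y ?A\<bar> \<le> dist x y"
        using infdist_triangle_abs by blast
      then have "\<bar>infdist x ?A / \<delta> - infdist y ?A / \<delta>\<bar> \<le> dist x y / \<delta>"
        using \<delta>(1) by (simp add: diff_divide_distrib[symmetric] divide_right_mono)
      then show "dist (h x) (h y) \<le> 1 / \<delta> * dist x y"
        by (simp add: h_def dist_real_def max_def abs_if split: if_splits)
    qed (use \<delta> in simp)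
    show "0 \<le> h z" for z by (simp add: h_def)
    show "h z \<le> 1" for z using \<delta>(1) infdist_nonneg[of z ?A] by (simp add: h_def)
    show "h z = 1" if "z \<in> closure ?A" for z
      using that ne in_closure_iff_infdist_zero[of ?A z] by (simp add: h_def)
    fix m assume m: "n < m"
    have "(\<integral>y. h (\<iota> y) \<partial>level_prob m) = (\<integral>y. 0 \<partial>level_prob m)"
    proof (rule Bochner_Integration.integral_cong[OF refl])
      fix z assume "z \<in> space (level_prob m)"
      then have "z \<in> verts G - level G n" using m by (auto simp: level_def)
      then have "\<delta> \<le> infdist (\<iota> z) ?A"
        unfolding infdist_notempty[OF ne] using ne \<delta>(2)
        by (intro cINF_greatest) (auto simp: dist_commute)
      then show "h (\<iota> z) = 0" using \<delta>(1) by (simp add: h_def)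
    qed
    then show "(\<integral>y. h (\<iota> y) \<partial>level_prob m) = 0" by simp
  qed
qed

text \<open>The cutoff of level \<open>n\<close> has integral 0 under all later level measures, so
  its limit integral is 0 too. Stated for a random variable \<open>Y\<close>, in order to cover both
  a weak limit (with \<open>Y\<close> the identity) and the variable produced by
  compactness.\<close>

lemma AE_boundaryI:
  assumes M: "prob_space M" and Y: "Y \<in> borel_measurable M"
    and closure: "AE u in M. Y u \<in> closure (\<iota> ` verts G)"
    and r: "strict_mono r"
    and lim: "\<And>h L. L-lipschitz_on UNIV h \<Longrightarrow> (\<And>z. 0 \<le> h z) \<Longrightarrow> (\<And>z. h z \<le> (1::real)) \<Longrightarrow>
      (\<lambda>k. \<integral>y. h (\<iota> y) \<partial>level_prob (r k)) \<longlonglongrightarrow> (\<integral>u. h (Y u) \<partial>M)"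
  shows "AE u in M. Y u \<in> martin_boundary G \<iota>"
proof -
  interpret prob_space M by (rule M)
  have "AE u in M. \<forall>n. Y u \<notin> closure (\<iota> ` level G n)"
    unfolding AE_all_countable
  proof
    fix n
    obtain h :: "'c \<Rightarrow> real" and L where h: "L-lipschitz_on UNIV h" "\<And>z. 0 \<le> h z" "\<And>z. h z \<le> 1"
      "\<And>z. z \<in> closure (\<iota> ` level G n) \<Longrightarrow> h z = 1"
      "\<And>m. n < m \<Longrightarrow> (\<integral>y. h (\<iota> y) \<partial>level_prob m) = 0"
      by (rule level_cutoff[of n]) (rule that)
    have meas: "(\<lambda>u. h (Y u)) \<in> borel_measurable M"
      by (rule measurable_compose[OF Y borel_measurable_continuous_onI[OF lipschitz_on_continuous_on[OF h(1)]]])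
    have "\<forall>\<^sub>F k in sequentially. (\<integral>y. h (\<iota> y) \<partial>level_prob (r k)) = 0"
      using eventually_gt_at_top[of n]
    proof eventually_elim
      case (elim k)
      then have "n < r k" using seq_suble[OF r, of k] by simp
      then show ?case by (rule h(5))
    qed
    then have "(\<lambda>k. \<integral>y. h (\<iota> y) \<partial>level_prob (r k)) \<longlonglongrightarrow> 0"
      by (rule tendsto_eventually)
    then have "(\<integral>u. h (Y u) \<partial>M) = 0"
      using lim[OF h(1-3)] LIMSEQ_unique by blast
    moreover have "integrable M (\<lambda>u. h (Y u))"
      using meas h(2,3) by (intro integrable_const_bound[of _ 1]) auto
    ultimately have "AE u in M. h (Y u) = 0"
      using integral_nonneg_eq_0_iff_AE[of M "\<lambda>u. h (Y u)"] h(2) by simp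
    then show "AE u in M. Y u \<notin> closure (\<iota> ` level G n)"
      by eventually_elim (use h(4) in force)
  qed
  with closure show ?thesis
    by eventually_elim (rule martin_boundaryI, auto)
qed

text \<open>The extended kernel is a bounded continuous test function on \<open>B\<close>, whose
  integrals against the level measures are the values of \<open>phi_level\<close>.\<close>

lemma level_limit_phi_limit:
  assumes lim: "level_limit G \<iota> r m"
  shows "phi_limit G r (martin_integral G \<iota> m)"
proof -
  have r: "strict_mono r" and m: "prob_space m" and sets: "sets m = sets (martin_borel G \<iota>)"
    and weak: "\<And>f :: 'c \<Rightarrow> real. continuous_on B f \<Longrightarrow> bounded (f ` B) \<Longrightarrow>
      (\<lambda>k. \<integral>z. f z \<partial>level_measure G \<iota> (r k)) \<longlonglongrightarrow> (\<integral>z. f z \<partial>m)"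
    using lim by (auto simp: level_limit_def weak_limit_def)
  have space: "space m = B" using sets_eq_imp_space_eq[OF sets] by simp
  have meas: "f \<in> borel_measurable (martin_borel G \<iota>)" if "continuous_on B f" for f :: "'c \<Rightarrow> real"
    unfolding martin_borel_def by (rule borel_measurable_continuous_on_restrict[OF that])
  have id: "(\<lambda>z. z) \<in> borel_measurable m"
    unfolding measurable_cong_sets[OF sets refl] martin_borel_def
    by (rule measurable_restrict_space1) simp
  have boundary: "AE z in m. z \<in> martin_boundary G \<iota>"
  proof (rule AE_boundaryI[OF m id _ r])
    show "AE z in m. z \<in> closure (\<iota> ` verts G)"
      using martin_points_closure by (intro AE_I2) (auto simp: space)
    fix h :: "'c \<Rightarrow> real" and L
    assume h: "L-lipschitz_on UNIV h" "\<And>z. 0 \<le> h z" "\<And>z. h z \<le> 1"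
    have cont: "continuous_on B h"
      by (rule continuous_on_subset[OF lipschitz_on_continuous_on[OF h(1)]]) simp
    have "(\<lambda>k. \<integral>z. h z \<partial>level_measure G \<iota> (r k)) \<longlonglongrightarrow> (\<integral>z. h z \<partial>m)"
      using h by (intro weak[OF cont] boundedI[of _ 1]) auto
    then show "(\<lambda>k. \<integral>y. h (\<iota> y) \<partial>level_prob (r k)) \<longlonglongrightarrow> (\<integral>z. h z \<partial>m)"
      by (simp add: integral_level_measure[OF meas[OF cont]])
  qed
  have "(\<lambda>k. phi_level G (r k) x) \<longlonglongrightarrow> martin_integral G \<iota> m x" if x: "x \<in> verts G" for x
  proof -
    obtain g where g: "continuous_on (closure (\<iota> ` verts G)) g"
      "\<And>z. z \<in> verts G \<Longrightarrow> g (\<iota> z) = martin_kernel G x z"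
      "\<And>w. w \<in> closure (\<iota> ` verts G) \<Longrightarrow> \<bar>g w\<bar> \<le> martin_bound G x"
      "\<And>\<zeta>. \<zeta> \<in> martin_boundary G \<iota> \<Longrightarrow> martin_kernel_ext G \<iota> x \<zeta> = g \<zeta>"
      by (rule kernel_extension[OF x]) (rule that)
    have cont: "continuous_on B g" by (rule continuous_on_subset[OF g(1) martin_points_closure])
    have "(\<lambda>k. \<integral>z. g z \<partial>level_measure G \<iota> (r k)) \<longlonglongrightarrow> (\<integral>z. g z \<partial>m)"
      using g(3) martin_points_closure by (intro weak[OF cont] boundedI[of _ "martin_bound G x"]) auto
    moreover have "(\<integral>z. g z \<partial>level_measure G \<iota> n) = phi_level G n x" for n
      unfolding integral_level_measure[OF meas[OF cont]] phi_level_eq_integral[OF x]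
      by (rule Bochner_Integration.integral_cong) (auto simp: g(2) level_def)
    moreover have "(\<integral>z. g z \<partial>m) = martin_integral G \<iota> m x"
    proof -
      have gm: "g \<in> borel_measurable m"
        unfolding measurable_cong_sets[OF sets refl] by (rule meas[OF cont])
      have bd: "martin_boundary G \<iota> \<in> sets m" using martin_boundary_sets sets by simp
      \<comment> \<open>The limit measure charges only the boundary, so integrating over the
        boundary or over all of \<open>B\<close> is the same.\<close>
      have "martin_integral G \<iota> m x = (\<integral>z. indicator (martin_boundary G \<iota>) z * g z \<partial>m)"
        unfolding martin_integral_def set_lebesgue_integral_def
        by (rule Bochner_Integration.integral_cong) (auto simp: g(4) split: split_indicator)
      also have "\<dots> = (\<integral>z. g z \<partial>m)"
        using boundary gm bd by (intro integral_cong_AE) (auto elim: eventually_mono)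
      finally show ?thesis by simp
    qed
    ultimately show ?thesis by simp
  qed
  then show ?thesis using r by (simp add: phi_limit_def)
qed

text \<open>Compactness provides a limit in the closure of the vertices. Concentration on the
  boundary turns it into a probability measure on \<open>B\<close>, and Lipschitz convergence is
  upgraded to weak convergence there.\<close>

lemma level_limit_exists:
  fixes r :: "nat \<Rightarrow> nat"
  assumes r: "strict_mono r"
  shows "\<exists>s m. strict_mono s \<and> level_limit G \<iota> (r \<circ> s) m"
proof -
  obtain s :: "nat \<Rightarrow> nat" and M :: "real measure" and Y :: "real \<Rightarrow> 'c"
    where s: "strict_mono s" and M: "prob_space M" and Y: "Y \<in> borel_measurable M"
      and closure: "\<And>u. Y u \<in> closure (\<iota> ` verts G)"
      and lim: "\<And>(f :: 'c \<Rightarrow> real) L C. L-lipschitz_on UNIV f \<Longrightarrow> (\<And>x. \<bar>f x\<bar> \<le> C) \<Longrightarrow>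
        (\<lambda>k. \<integral>z. f (\<iota> z) \<partial>level_prob (r (s k))) \<longlonglongrightarrow> (\<integral>u. f (Y u) \<partial>M)"
  proof (rule weak_compactness_discrete[of "\<lambda>k. level_prob (r k)" "verts G" \<iota>])
    show "prob_space (level_prob (r k))" for k by (rule prob_space_level_prob)
    show "sets (level_prob (r k)) = Pow (space (level_prob (r k)))" for k by simp
    show "space (level_prob (r k)) \<subseteq> verts G" for k by (auto simp: level_def)
  qed (use martin_totally_bounded in auto)
  interpret M: prob_space M by (rule M)
  have rs: "strict_mono (r \<circ> s)" using r s by (rule strict_mono_o)
  have boundary: "AE u in M. Y u \<in> martin_boundary G \<iota>"
  proof (rule AE_boundaryI[OF M Y _ rs])
    fix h :: "'c \<Rightarrow> real" and L
    assume h: "L-lipschitz_on UNIV h" "\<And>z. 0 \<le> h z" "\<And>z. h z \<le> 1"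
    have "\<bar>h z\<bar> \<le> 1" for z using h(2)[of z] h(3)[of z] by simp
    from lim[OF h(1) this]
    show "(\<lambda>k. \<integral>y. h (\<iota> y) \<partial>level_prob ((r \<circ> s) k)) \<longlonglongrightarrow> (\<integral>u. h (Y u) \<partial>M)" by simp
  qed (use closure in simp)
  \<comment> \<open>Measurability into \<open>martin_borel\<close> requires values in
    \<open>B\<close> everywhere; the null set where \<open>Y\<close> misses the boundary is sent to
    the root.\<close>
  define Y' where "Y' u = (if Y u \<in> martin_boundary G \<iota> then Y u else \<iota> (root G))" for u
  have bd_sets: "{u \<in> space M. Y u \<in> martin_boundary G \<iota>} \<in> sets M"
    using measurable_sets[OF Y martin_boundary_borel] by (simp add: vimage_def Int_def conj_commute)
  have Y'_borel: "Y' \<in> borel_measurable M"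
    unfolding Y'_def by (rule measurable_If[OF Y _ bd_sets]) simp
  have Y': "Y' \<in> M \<rightarrow>\<^sub>M martin_borel G \<iota>"
    unfolding martin_borel_def
    by (rule measurable_restrict_space2[OF _ Y'_borel]) (auto simp: Y'_def martin_points_def root_verts)
  define m where "m = distr M (martin_borel G \<iota>) Y'"
  have prob: "prob_space m" unfolding m_def by (rule M.prob_space_distr[OF Y'])
  have sets: "sets m = sets (martin_borel G \<iota>)" by (simp add: m_def)
  have "weak_limit B (\<lambda>k. level_measure G \<iota> ((r \<circ> s) k)) m"
  proof (rule weak_limit_if_lipschitz)
    show "sets (level_measure G \<iota> ((r \<circ> s) k)) = sets (restrict_space borel B)" for k
      by (simp add: martin_borel_def)
    show "sets m = sets (restrict_space borel B)" by (simp add: sets martin_borel_def)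
    fix f :: "'c \<Rightarrow> real" and L C
    assume f: "L-lipschitz_on UNIV f" "\<And>x. \<bar>f x\<bar> \<le> C"
    have f_borel: "f \<in> borel_measurable borel"
      by (rule borel_measurable_continuous_onI[OF lipschitz_on_continuous_on[OF f(1)]])
    have f_meas: "f \<in> borel_measurable (martin_borel G \<iota>)"
      unfolding martin_borel_def by (rule measurable_restrict_space1[OF f_borel])
    have "(\<integral>z. f z \<partial>m) = (\<integral>u. f (Y' u) \<partial>M)"
      unfolding m_def by (rule integral_distr[OF Y' f_meas])
    also have "\<dots> = (\<integral>u. f (Y u) \<partial>M)"
    proof (rule integral_cong_AE)
      show "(\<lambda>u. f (Y' u)) \<in> borel_measurable M" by (rule measurable_compose[OF Y'_borel f_borel])
      show "(\<lambda>u. f (Y u)) \<in> borel_measurable M" by (rule measurable_compose[OF Y f_borel])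
      show "AE u in M. f (Y' u) = f (Y u)"
        using boundary by eventually_elim (simp add: Y'_def)
    qed
    finally show "(\<lambda>k. \<integral>z. f z \<partial>level_measure G \<iota> ((r \<circ> s) k)) \<longlonglongrightarrow> (\<integral>z. f z \<partial>m)"
      using lim[OF f] by (simp add: integral_level_measure[OF f_meas])
  qed (rule prob_space_level_measure, rule prob)
  then have "level_limit G \<iota> (r \<circ> s) m"
    using rs prob sets by (simp add: level_limit_def)
  then show ?thesis using s by blast
qed

text \<open>A limit point is found along a subsequence; along that subsequence
  \<open>phi_level\<close> tends both to \<phi> and to the Martin integral.\<close>

lemma phi_limit_level_limit:
  assumes lim: "phi_limit G r \<phi>"
  shows "\<exists>s m. strict_mono s \<and> level_limit G \<iota> (r \<circ> s) m \<and>
    (\<forall>x\<in>verts G. \<phi> x = martin_integral G \<iota> m x)"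
proof -
  have "strict_mono r" using lim by (simp add: phi_limit_def)
  then obtain s m where s: "strict_mono s" and m: "level_limit G \<iota> (r \<circ> s) m"
    using level_limit_exists by blast
  have "\<phi> x = martin_integral G \<iota> m x" if x: "x \<in> verts G" for x
  proof (rule LIMSEQ_unique)
    have "(\<lambda>k. phi_level G (r k) x) \<longlonglongrightarrow> \<phi> x" using lim x by (simp add: phi_limit_def)
    from LIMSEQ_subseq_LIMSEQ[OF this s] show "(\<lambda>k. phi_level G ((r \<circ> s) k) x) \<longlonglongrightarrow> \<phi> x"
      by (simp add: o_def)
    show "(\<lambda>k. phi_level G ((r \<circ> s) k) x) \<longlonglongrightarrow> martin_integral G \<iota> m x"
      using level_limit_phi_limit[OF m] x by (simp add: phi_limit_def)
  qed
  then show ?thesis using s m by blast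
qed

end

section \<open>Limit points and MERWs\<close>

lemma martin_integral_cong:
  assumes "(m, m') \<in> same_martin_integral G \<iota>" "x \<in> verts G"
  shows "martin_integral G \<iota> m x = martin_integral G \<iota> m' x"
  using assms by (simp add: same_martin_integral_def)

lemma equiv_same_martin_integral:
  "equiv A (Restr (same_martin_integral G \<iota>) A)"
  by (auto simp: equiv_def refl_on_def sym_def trans_def same_martin_integral_def)

context bratteli
begin

text \<open>Harmonic functions are total on the type, but only their values on vertices carry
  meaning. This congruence and the next two allow \<phi> to be exchanged for a Martin integral that
  agrees with it there.\<close>

lemma nnhf_cong:
  assumes "\<And>x. x \<in> verts G \<Longrightarrow> \<phi> x = \<psi> x" "nnhf G \<phi>"
  shows "nnhf G \<psi>"
proof -
  have "((\<lambda>y. wt G x y * \<psi> y) has_sum \<psi> x) {y. (x, y) \<in> edges G}" if x: "x \<in> verts G" for x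
  proof -
    have "((\<lambda>y. wt G x y * \<phi> y) has_sum \<psi> x) {y. (x, y) \<in> edges G}"
      using assms x by (simp add: nnhf_def)
    also have "?this \<longleftrightarrow> ?thesis"
      using assms(1) edge_verts(2) by (intro has_sum_cong) auto
    finally show ?thesis .
  qed
  then show ?thesis using assms root_verts unfolding nnhf_def by auto
qed

lemma merw_function_cong:
  assumes "\<And>x. x \<in> verts G \<Longrightarrow> \<phi> x = \<psi> x" "merw_function G \<phi>"
  shows "merw_function G \<psi>"
  using assms nnhf_cong[OF assms(1)] by (auto simp: merw_function_def phi_limit_def)

lemma merw_law_cong:
  assumes eq: "\<And>x. x \<in> verts G \<Longrightarrow> \<phi> x = \<psi> x" and law: "merw_law G \<phi> \<mu>"
  shows "merw_law G \<psi> \<mu>"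
proof -
  have supp: "support_bd G \<psi> = support_bd G \<phi>"
    using eq by (simp add: support_bd_def Let_def cong: conj_cong)
  have kernel: "merw_kernel G \<psi> x y = merw_kernel G \<phi> x y" if "x \<in> verts G" "y \<in> verts G" for x y
    using eq that by (simp add: merw_kernel_def)
  have sub: "verts (support_bd G \<phi>) \<subseteq> verts G" by (auto simp: support_bd_def Let_def)
  have "markov_chain \<mu> (verts (support_bd G \<psi>)) (merw_kernel G \<psi>) (\<lambda>n t. t n)"
    unfolding supp markov_chain_def
  proof (intro conjI allI impI)
    fix n s y assume *: "length s = Suc n \<and> set s \<subseteq> verts (support_bd G \<phi>) \<and> y \<in> verts (support_bd G \<phi>)"
    then have "s ! n \<in> set s" by (intro nth_mem) simp
    with * sub have "s ! n \<in> verts G" "y \<in> verts G" by blast+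
    then show "\<P>(t in \<mu>. (\<forall>i\<le>n. t i = s ! i) \<and> t (Suc n) = y) =
        \<P>(t in \<mu>. \<forall>i\<le>n. t i = s ! i) * merw_kernel G \<psi> (s ! n) y"
      using law * kernel by (simp add: merw_law_def merw_def markov_chain_def)
  qed (use law in \<open>simp_all add: merw_law_def merw_def markov_chain_def\<close>)
  then show ?thesis
    using law merw_function_cong[OF eq] by (simp add: merw_law_def merw_def)
qed

end

context finite_bratteli
begin

text \<open>A cylinder ending at \<open>x\<close> has probability w_s * \<phi> x, and w_s is
  positive.\<close>

lemma merw_law_determines_function:
  assumes "merw_law G \<phi> \<mu>" "merw_law G \<psi> \<mu>" "x \<in> verts G"
  shows "\<phi> x = \<psi> x"
proof -
  have "nnhf G \<phi>" "nnhf G \<psi>" using assms by (auto simp: merw_law_def merw_def merw_function_def)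
  then interpret \<phi>: harmonic_bratteli G \<phi> + \<psi>: harmonic_bratteli G \<psi>
    by unfold_locales
  obtain s where s: "s \<in> fin_paths G (root G) x" using path_from_root[OF assms(3)] by blast
  have "path_wt G s * \<phi> x = path_wt G s * \<psi> x"
    by (rule trans[OF \<phi>.merw_law_cylinder[OF assms(1) s, symmetric] \<psi>.merw_law_cylinder[OF assms(2) s]])
  then show ?thesis using path_wt_pos[OF s] by simp
qed

lemma merw_law_ex1:
  assumes "merw_function G \<phi>"
  shows "\<exists>!\<mu>. merw_law G \<phi> \<mu>"
proof -
  interpret harmonic_bratteli G \<phi>
    using assms by unfold_locales (simp add: merw_function_def)
  show ?thesis using merw_law_exists[OF assms] merw_law_unique by blast
qed

end

context martin_embedded
begin

lemma harmonic_limit_point_merw_function: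
  assumes "m \<in> harmonic_limit_points G \<iota>"
  shows "merw_function G (martin_integral G \<iota> m)"
  using assms level_limit_phi_limit
  by (auto simp: harmonic_limit_points_def limit_points_def merw_function_def)

lemma merw_function_limit_point:
  assumes "merw_function G \<phi>"
  shows "\<exists>m\<in>harmonic_limit_points G \<iota>. \<forall>x\<in>verts G. \<phi> x = martin_integral G \<iota> m x"
proof -
  obtain r where "phi_limit G r \<phi>" using assms by (auto simp: merw_function_def)
  then obtain s m where m: "level_limit G \<iota> (r \<circ> s) m" "\<forall>x\<in>verts G. \<phi> x = martin_integral G \<iota> m x"
    using phi_limit_level_limit by blast
  moreover have "nnhf G (martin_integral G \<iota> m)"
    by (rule nnhf_cong[of \<phi>]) (use assms m(2) in \<open>auto simp: merw_function_def\<close>)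
  ultimately have "m \<in> harmonic_limit_points G \<iota>"
    by (auto simp: harmonic_limit_points_def limit_points_def)
  then show ?thesis using m(2) by blast
qed

definition limit_point_law :: "'c measure \<Rightarrow> (nat \<Rightarrow> 'a) measure" where
  "limit_point_law m = (THE \<mu>. merw_law G (martin_integral G \<iota> m) \<mu>)"

lemma limit_point_law:
  assumes "m \<in> harmonic_limit_points G \<iota>"
  shows "merw_law G (martin_integral G \<iota> m) (limit_point_law m)"
  unfolding limit_point_law_def
  by (rule theI'[OF merw_law_ex1[OF harmonic_limit_point_merw_function[OF assms]]])

lemma limit_point_law_eq_iff:
  assumes "m \<in> harmonic_limit_points G \<iota>" "m' \<in> harmonic_limit_points G \<iota>"
  shows "limit_point_law m = limit_point_law m' \<longleftrightarrow> (m, m') \<in> same_martin_integral G \<iota>"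
proof
  assume "limit_point_law m = limit_point_law m'"
  then show "(m, m') \<in> same_martin_integral G \<iota>"
    using merw_law_determines_function limit_point_law[OF assms(1)] limit_point_law[OF assms(2)]
    by (auto simp: same_martin_integral_def)
next
  assume same: "(m, m') \<in> same_martin_integral G \<iota>"
  have "merw_law G (martin_integral G \<iota> m') (limit_point_law m)"
    by (rule merw_law_cong[OF _ limit_point_law[OF assms(1)]]) (rule martin_integral_cong[OF same])
  then show "limit_point_law m = limit_point_law m'"
    using merw_law_ex1[OF harmonic_limit_point_merw_function[OF assms(2)]] limit_point_law[OF assms(2)] by blast
qed

text \<open>Surjectivity: the function of a MERW is the Martin integral of some limit point, and a
  function has only one law.\<close>

lemma limit_point_law_image: "limit_point_law ` harmonic_limit_points G \<iota> = merw_laws G"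
proof (intro equalityI subsetI)
  fix \<mu> assume "\<mu> \<in> limit_point_law ` harmonic_limit_points G \<iota>"
  then show "\<mu> \<in> merw_laws G" using limit_point_law by (auto simp: merw_laws_def)
next
  fix \<mu> assume "\<mu> \<in> merw_laws G"
  then obtain \<phi> where \<phi>: "merw_law G \<phi> \<mu>" by (auto simp: merw_laws_def)
  then have "merw_function G \<phi>" by (simp add: merw_law_def merw_def)
  then obtain m where m: "m \<in> harmonic_limit_points G \<iota>" "\<forall>x\<in>verts G. \<phi> x = martin_integral G \<iota> m x"
    using merw_function_limit_point by blast
  have "merw_law G (martin_integral G \<iota> m) \<mu>"
    by (rule merw_law_cong[OF _ \<phi>]) (use m(2) in auto)
  then have "\<mu> = limit_point_law m"
    using merw_law_ex1[OF harmonic_limit_point_merw_function[OF m(1)]] limit_point_law[OF m(1)] by blast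
  then show "\<mu> \<in> limit_point_law ` harmonic_limit_points G \<iota>" using m(1) by blast
qed

lemma limit_point_classes_bij:
  fixes A R
  defines "A \<equiv> harmonic_limit_points G \<iota>" and "R \<equiv> Restr (same_martin_integral G \<iota>) (harmonic_limit_points G \<iota>)"
  shows "\<exists>F. bij_betw F (A // R) (merw_laws G) \<and>
    (\<forall>C\<in>A // R. \<forall>m\<in>C. merw_law G (martin_integral G \<iota> m) (F C))"
proof -
  have equiv: "equiv A R" unfolding A_def R_def by (rule equiv_same_martin_integral)
  \<comment> \<open>The chosen representative does not matter: members of a class have equal Martin
    integrals and hence equal laws.\<close>
  define F where "F C = limit_point_law (SOME m. m \<in> C)" for C
  have F: "F C = limit_point_law m" if C: "C \<in> A // R" "m \<in> C" for C m
  proof -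
    have "(SOME m. m \<in> C) \<in> C" using C(2) by (rule someI)
    then have "((SOME m. m \<in> C), m) \<in> R" using quotient_eq_iff[OF equiv C(1) C(1)] C(2) by blast
    then show ?thesis unfolding F_def using limit_point_law_eq_iff by (auto simp: R_def)
  qed
  have sub: "C \<subseteq> A" if "C \<in> A // R" for C
    using that equiv by (auto simp: quotient_def equiv_def R_def A_def)
  have ne: "\<exists>m. m \<in> C" if "C \<in> A // R" for C
    using in_quotient_imp_non_empty[OF equiv that] by blast
  have "inj_on F (A // R)"
  proof (rule inj_onI)
    fix C D assume CD: "C \<in> A // R" "D \<in> A // R" "F C = F D"
    obtain m m' where m: "m \<in> C" "m' \<in> D" using ne CD by blast
    then have "limit_point_law m = limit_point_law m'" using F CD by simp
    moreover have "m \<in> A" "m' \<in> A" using m sub CD by auto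
    ultimately have "(m, m') \<in> R" using limit_point_law_eq_iff by (simp add: A_def R_def)
    then show "C = D" using quotient_eqI[OF equiv CD(1,2) m] by blast
  qed
  moreover have "F ` (A // R) = merw_laws G"
  proof (intro equalityI subsetI)
    fix \<mu> assume "\<mu> \<in> F ` (A // R)"
    then obtain C m where "C \<in> A // R" "m \<in> C" "\<mu> = F C" using ne by blast
    moreover from this have "m \<in> A" using sub by blast
    ultimately show "\<mu> \<in> merw_laws G" using F limit_point_law_image unfolding A_def by blast
  next
    fix \<mu> assume "\<mu> \<in> merw_laws G"
    then obtain m where m: "m \<in> A" "\<mu> = limit_point_law m"
      unfolding limit_point_law_image[symmetric] A_def by blast
    have "F (R `` {m}) = \<mu>"
      using F[OF quotientI[OF m(1)] equiv_class_self[OF equiv m(1)]] m(2) by simp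
    then show "\<mu> \<in> F ` (A // R)" using quotientI[OF m(1)] by blast
  qed
  ultimately have "bij_betw F (A // R) (merw_laws G)" by (simp add: bij_betw_def)
  moreover have "merw_law G (martin_integral G \<iota> m) (F C)" if "C \<in> A // R" "m \<in> C" for C m
    using F[OF that] limit_point_law[of m] sub[OF that(1)] that(2) by (auto simp: A_def)
  ultimately show ?thesis by blast
qed

lemma limit_points_bij:
  assumes "Restr (same_martin_integral G \<iota>) (harmonic_limit_points G \<iota>) \<subseteq> Id"
  shows "\<exists>F. bij_betw F (harmonic_limit_points G \<iota>) (merw_laws G) \<and>
    (\<forall>m\<in>harmonic_limit_points G \<iota>. merw_law G (martin_integral G \<iota> m) (F m))"
proof -
  have "inj_on limit_point_law (harmonic_limit_points G \<iota>)"
    using limit_point_law_eq_iff assms by (fastforce simp: inj_on_def)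
  then show ?thesis
    using limit_point_law_image limit_point_law by (auto simp: bij_betw_def)
qed

end

theorem corollary2p1:
  fixes G :: "'a wbd" and \<epsilon> :: "'a \<Rightarrow> real" and \<iota> :: "'a \<Rightarrow> 'c::complete_space"
  assumes bd: "weighted_bratteli G"
    and fin: "\<And>n. dim_level G (root G) n < \<infinity>"
    and eps: "\<And>x. x \<in> verts G \<Longrightarrow> \<epsilon> x > 0" "\<epsilon> summable_on verts G"
    and emb: "martin_embedding G \<epsilon> \<iota>"
  shows
    "(\<forall>\<phi> (P :: 'b measure) X.
        merw G \<phi> P X \<and> (AE \<omega> in P. X 0 \<omega> = root G) \<longrightarrow>
          merw_law G \<phi> (path_law G P X) \<and>
          ssbd (support_bd G \<phi>) G \<and>
          central_measure (support_bd G \<phi>)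
            (restrict_space (path_law G P X) (inf_paths (support_bd G \<phi>))) \<and>
          central_chain (support_bd G \<phi>)
            (restrict_space (path_law G P X) (inf_paths (support_bd G \<phi>))) P X \<and>
          (\<forall>x \<in> verts (support_bd G \<phi>). \<forall>y \<in> verts (support_bd G \<phi>). \<forall>t \<in> fin_paths G x y.
             \<forall>n. length t = Suc n \<longrightarrow>
             \<P>(\<omega> in P. (\<forall>i\<in>{0<..<n}. X (lev G x + i) \<omega> = t ! i)
                 \<bar> X (lev G x) \<omega> = x \<and> X (lev G x + n) \<omega> = y)
               = path_wt G t / (\<Sum>\<^sub>\<infinity>s\<in>fin_paths G x y. path_wt G s))) \<and>
     (\<forall>\<phi> (Q :: 'd measure) Y. merw G \<phi> Q Y \<longrightarrow>
        (\<forall>x \<in> verts (support_bd G \<phi>). \<forall>y \<in> verts (support_bd G \<phi>). \<forall>t \<in> fin_paths G x y.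
           \<forall>n. length t = Suc n \<and> \<P>(\<omega> in Q. Y 0 \<omega> = x) > 0 \<longrightarrow>
           \<P>(\<omega> in Q. (\<forall>i\<in>{0<..<n}. Y i \<omega> = t ! i) \<bar> Y 0 \<omega> = x \<and> Y n \<omega> = y)
             = path_wt G t / (\<Sum>\<^sub>\<infinity>s\<in>fin_paths G x y. path_wt G s))) \<and>
     (\<forall>\<phi>. merw_function G \<phi> \<longrightarrow> (\<exists>!\<mu>. merw_law G \<phi> \<mu>)) \<and>
     (\<forall>\<phi> \<phi>' \<mu>. merw_law G \<phi> \<mu> \<and> merw_law G \<phi>' \<mu> \<longrightarrow> (\<forall>x \<in> verts G. \<phi> x = \<phi>' x)) \<and>
     (\<forall>r m. level_limit G \<iota> r m \<longrightarrow> phi_limit G r (martin_integral G \<iota> m)) \<and>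
     (\<forall>r \<phi>. phi_limit G r \<phi> \<longrightarrow>
        (\<exists>s m. strict_mono s \<and> level_limit G \<iota> (r \<circ> s) m \<and>
           (\<forall>x \<in> verts G. \<phi> x = martin_integral G \<iota> m x))) \<and>
     ((\<forall>x \<in> verts G. finite {y. (x, y) \<in> edges G}) \<longrightarrow>
        (\<forall>r \<phi>. phi_limit G r \<phi> \<longrightarrow> nnhf G \<phi>) \<and>
        harmonic_limit_points G \<iota> = limit_points G \<iota>) \<and>
     (\<exists>F. bij_betw F
            (harmonic_limit_points G \<iota> //
               Restr (same_martin_integral G \<iota>) (harmonic_limit_points G \<iota>))
            (merw_laws G) \<and>
          (\<forall>C \<in> harmonic_limit_points G \<iota> //
               Restr (same_martin_integral G \<iota>) (harmonic_limit_points G \<iota>).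
             \<forall>m \<in> C. merw_law G (martin_integral G \<iota> m) (F C))) \<and>
     (Restr (same_martin_integral G \<iota>) (harmonic_limit_points G \<iota>) \<subseteq> Id \<longrightarrow>
        (\<exists>F. bij_betw F (harmonic_limit_points G \<iota>) (merw_laws G) \<and>
          (\<forall>m \<in> harmonic_limit_points G \<iota>. merw_law G (martin_integral G \<iota> m) (F m))))"
proof -
  interpret martin_embedded G \<epsilon> \<iota>
    by unfold_locales (use assms in auto)
  have harmonic: "harmonic_bratteli G \<phi>" if "merw_function G \<phi>" for \<phi>
    using that by unfold_locales (simp add: merw_function_def)
  show ?thesis
  proof (intro conjI allI impI; (elim conjE)?)
    fix \<phi> and P :: "'b measure" and X
    assume merw: "merw G \<phi> P X" and start: "AE \<omega> in P. X 0 \<omega> = root G"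
    then have fn: "merw_function G \<phi>" by (simp add: merw_def)
    interpret harmonic_bratteli G \<phi> by (rule harmonic[OF fn])
    interpret rooted_merw_chain G \<phi> P X
      using merw start by unfold_locales (simp_all add: merw_def)
    show "merw_law G \<phi> (path_law G P X)" by (rule merw_law_path_law[OF fn])
    show "ssbd (support_bd G \<phi>) G" by (rule support_ssbd)
    show "central_measure (support_bd G \<phi>) (restrict_space (path_law G P X) (inf_paths (support_bd G \<phi>)))"
      unfolding restrict_law by (rule central_law)
    show "central_chain (support_bd G \<phi>) (restrict_space (path_law G P X) (inf_paths (support_bd G \<phi>))) P X"
      unfolding restrict_law by (rule central_chain_law)
    show "\<forall>x\<in>verts (support_bd G \<phi>). \<forall>y\<in>verts (support_bd G \<phi>). \<forall>t\<in>fin_paths G x y. \<forall>n. length t = Suc n \<longrightarrow>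
        \<P>(\<omega> in P. (\<forall>i\<in>{0<..<n}. X (lev G x + i) \<omega> = t ! i) \<bar> X (lev G x) \<omega> = x \<and> X (lev G x + n) \<omega> = y)
          = path_wt G t / (\<Sum>\<^sub>\<infinity>s\<in>fin_paths G x y. path_wt G s)"
      \<comment> \<open>A support vertex is visited with positive probability at the time equal to
        its level, so no positivity assumption is needed for the chain from the root.\<close>
      using bridge vertex_prob_pos by blast
  next
    fix \<phi> and Q :: "'d measure" and Y
    assume merw: "merw G \<phi> Q Y"
    interpret harmonic_bratteli G \<phi> using merw by (intro harmonic) (simp add: merw_def)
    interpret merw_chain G \<phi> Q Y
      using merw by unfold_locales (simp add: merw_def)
    show "\<forall>x\<in>verts (support_bd G \<phi>). \<forall>y\<in>verts (support_bd G \<phi>). \<forall>t\<in>fin_paths G x y. \<forall>n.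
        length t = Suc n \<and> \<P>(\<omega> in Q. Y 0 \<omega> = x) > 0 \<longrightarrow>
        \<P>(\<omega> in Q. (\<forall>i\<in>{0<..<n}. Y i \<omega> = t ! i) \<bar> Y 0 \<omega> = x \<and> Y n \<omega> = y)
          = path_wt G t / (\<Sum>\<^sub>\<infinity>s\<in>fin_paths G x y. path_wt G s)"
      using bridge[where m = 0, simplified] by blast
  next
    show "\<exists>!\<mu>. merw_law G \<phi> \<mu>" if "merw_function G \<phi>" for \<phi> using that by (rule merw_law_ex1)
    show "\<forall>x\<in>verts G. \<phi> x = \<phi>' x" if "merw_law G \<phi> \<mu>" "merw_law G \<phi>' \<mu>" for \<phi> \<phi>' \<mu>
      using merw_law_determines_function[OF that] by blast
    show "phi_limit G r (martin_integral G \<iota> m)" if "level_limit G \<iota> r m" for r m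
      using that by (rule level_limit_phi_limit)
    show "\<exists>s m. strict_mono s \<and> level_limit G \<iota> (r \<circ> s) m \<and> (\<forall>x\<in>verts G. \<phi> x = martin_integral G \<iota> m x)"
      if "phi_limit G r \<phi>" for r \<phi> using that by (rule phi_limit_level_limit)
    show "nnhf G \<phi>" if "\<forall>x\<in>verts G. finite {y. (x, y) \<in> edges G}" "phi_limit G r \<phi>" for r \<phi>
      using that by (rule phi_limit_nnhf)
    show "harmonic_limit_points G \<iota> = limit_points G \<iota>" if "\<forall>x\<in>verts G. finite {y. (x, y) \<in> edges G}"
      using phi_limit_nnhf[OF that] level_limit_phi_limit
      by (auto simp: harmonic_limit_points_def limit_points_def)
  qed (use limit_point_classes_bij limit_points_bij in blast)+
qed

end
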